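(* Let $X$ be a quasi-compact scheme and let $T\subset X$ be a closed subscheme (regarded as a set of points of $X$). Then every covering $((U_i,S_i)\to (X,T))_{i\in I}$ of $(X,T)$ in the marked étale site $(X,T)_{\mathrm{et}}$ admits a finite subcovering, i.e., there is a finite subset $J\subset I$ such that $((U_i,S_i)\to (X,T))_{i\in J}$ is a covering in $(X,T)_{\mathrm{et}}$.
   Context: A marked scheme $(X,T)$ is a scheme $X$ together with a set $T$ of points of $X$. A morphism of marked schemes $f:(Y,S)\to (X,T)$ is a morphism of schemes $f:Y\to X$ with $f(S)\subset T$. The marked étale site $(X,T)_{\mathrm{et}}$ is defined as follows. Its underlying category is the category of morphisms of marked schemes $f:(U,S)\to (X,T)$ with $f:U\to X$ étale and $S=f^{-1}(T)$ (morphisms are morphisms over $(X,T)$). A family $(p_i:(U_i,S_i)\to (U,S))_{i\in I}$ in this category is a covering if it is (jointly) surjective and every point $s\in S$ splits, i.e., there exist an index $i$ and a point $u_i\in S_i$ mapping to $s$ such that the induced field homomorphism $k(s)\to k(u_i)$ is an isomorphism. (For $T=\varnothing$ this is the small étale site, for $T=X$ the Nisnevich site.) *)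

theory Defs
  imports
    "HOL-Analysis.Abstract_Topology"
    "HOL-Algebra.Indexed_Polynomials"
    "HOL-Algebra.Finite_Extensions"
    "HOL-Algebra.Free_Abelian_Groups"
begin

section \<open>Commutative algebra\<close>

subsection \<open>Local rings and residue fields\<close>

definition local_ring :: "'a ring \<Rightarrow> bool" where
  "local_ring R \<longleftrightarrow> cring R \<and> (\<exists>!m. maximalideal m R)"

definition max_ideal :: "'a ring \<Rightarrow> 'a set" where
  "max_ideal R = (THE m. maximalideal m R)"

definition local_hom :: "'a ring \<Rightarrow> 'b ring \<Rightarrow> ('a \<Rightarrow> 'b) \<Rightarrow> bool" where
  "local_hom R S h \<longleftrightarrow>
     h \<in> ring_hom R S \<and> {a \<in> carrier R. h a \<in> max_ideal S} = max_ideal R"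

definition residue_field :: "'a ring \<Rightarrow> 'a set ring" where
  "residue_field R = R Quot max_ideal R"

text \<open>The homomorphism of residue fields induced by a local homomorphism \<open>h\<close>. Residue classes
  are cosets; for a local \<open>h\<close> all members of the union below are the same coset.\<close>

definition residue_map :: "'b ring \<Rightarrow> ('a \<Rightarrow> 'b) \<Rightarrow> 'a set \<Rightarrow> 'b set" where
  "residue_map S h A = (\<Union>a\<in>A. max_ideal S +>\<^bsub>S\<^esub> h a)"

subsection \<open>Localisation at a multiplicative set\<close>

text \<open>The fraction \<open>a / s\<close>, as the class of all pairs \<open>(b, t)\<close> with \<open>u a t = u b s\<close> for
  some \<open>u\<close> in the multiplicative set.\<close>

definition loc_frac :: "'a ring \<Rightarrow> 'a set \<Rightarrow> 'a \<Rightarrow> 'a \<Rightarrow> ('a \<times> 'a) set" where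
  "loc_frac A M a s = {(b, t). b \<in> carrier A \<and> t \<in> M \<and>
     (\<exists>u\<in>M. u \<otimes>\<^bsub>A\<^esub> (a \<otimes>\<^bsub>A\<^esub> t) = u \<otimes>\<^bsub>A\<^esub> (b \<otimes>\<^bsub>A\<^esub> s))}"

definition localization :: "'a ring \<Rightarrow> 'a set \<Rightarrow> ('a \<times> 'a) set ring" where
  "localization A M =
     \<lparr>carrier = {loc_frac A M a s | a s. a \<in> carrier A \<and> s \<in> M},
      monoid.mult = (\<lambda>P Q. \<Union>(a, s)\<in>P. \<Union>(b, t)\<in>Q. loc_frac A M (a \<otimes>\<^bsub>A\<^esub> b) (s \<otimes>\<^bsub>A\<^esub> t)),
      monoid.one = loc_frac A M \<one>\<^bsub>A\<^esub> \<one>\<^bsub>A\<^esub>,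
      ring.zero = loc_frac A M \<zero>\<^bsub>A\<^esub> \<one>\<^bsub>A\<^esub>,
      ring.add = (\<lambda>P Q. \<Union>(a, s)\<in>P. \<Union>(b, t)\<in>Q.
               loc_frac A M ((a \<otimes>\<^bsub>A\<^esub> t) \<oplus>\<^bsub>A\<^esub> (b \<otimes>\<^bsub>A\<^esub> s)) (s \<otimes>\<^bsub>A\<^esub> t))\<rparr>"

abbreviation localization_at_prime :: "'a ring \<Rightarrow> 'a set \<Rightarrow> ('a \<times> 'a) set ring" where
  "localization_at_prime A p \<equiv> localization A (carrier A - p)"

subsection \<open>Algebras of finite presentation\<close>

definition mpoly_ring :: "'a ring \<Rightarrow> nat \<Rightarrow> (nat multiset \<Rightarrow> 'a) ring" where
  "mpoly_ring R n =
     \<lparr>carrier = ring.indexed_pset R {..<n} (carrier R),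
      monoid.mult = (\<lambda>P Q m. \<Oplus>\<^bsub>R\<^esub>k\<in>{k. k \<subseteq># m}. P k \<otimes>\<^bsub>R\<^esub> Q (m - k)),
      monoid.one = ring.indexed_const R \<one>\<^bsub>R\<^esub>,
      ring.zero = ring.indexed_const R \<zero>\<^bsub>R\<^esub>,
      ring.add = ring.indexed_padd R\<rparr>"

definition finitely_presented :: "'a ring \<Rightarrow> 'b ring \<Rightarrow> ('a \<Rightarrow> 'b) \<Rightarrow> bool" where
  "finitely_presented R S h \<longleftrightarrow> h \<in> ring_hom R S \<and>
     (\<exists>n F \<phi>. finite F \<and> F \<subseteq> carrier (mpoly_ring R n) \<and>
        \<phi> \<in> ring_iso (mpoly_ring R n Quot (Idl\<^bsub>mpoly_ring R n\<^esub> F)) S \<and>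
        (\<forall>r\<in>carrier R. \<phi> ((Idl\<^bsub>mpoly_ring R n\<^esub> F) +>\<^bsub>mpoly_ring R n\<^esub> ring.indexed_const R r) = h r))"

subsection \<open>Flatness\<close>

definition module_hom :: "'a ring \<Rightarrow> ('a, 'b) module \<Rightarrow> ('a, 'c) module \<Rightarrow> ('b \<Rightarrow> 'c) \<Rightarrow> bool" where
  "module_hom R M N \<phi> \<longleftrightarrow> \<phi> \<in> carrier M \<rightarrow> carrier N \<and>
     (\<forall>x\<in>carrier M. \<forall>y\<in>carrier M. \<phi> (x \<oplus>\<^bsub>M\<^esub> y) = \<phi> x \<oplus>\<^bsub>N\<^esub> \<phi> y) \<and>
     (\<forall>r\<in>carrier R. \<forall>x\<in>carrier M. \<phi> (r \<odot>\<^bsub>M\<^esub> x) = r \<odot>\<^bsub>N\<^esub> \<phi> x)"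

definition restrict_scalars :: "'b ring \<Rightarrow> ('a \<Rightarrow> 'b) \<Rightarrow> ('a, 'b) module" where
  "restrict_scalars S h = ring.extend S \<lparr>smult = (\<lambda>r s. h r \<otimes>\<^bsub>S\<^esub> s)\<rparr>"

text \<open>The abelian group \<open>M \<otimes>\<^sub>R N\<close> is the free abelian group on pairs modulo the
  bilinearity relations.\<close>

definition tensor_relations ::
    "'a ring \<Rightarrow> ('a, 'b) module \<Rightarrow> ('a, 'c) module \<Rightarrow> ('b \<times> 'c \<Rightarrow>\<^sub>0 int) set" where
  "tensor_relations R M N =
     generate (free_Abelian_group (carrier M \<times> carrier N))
      ({frag_of (x \<oplus>\<^bsub>M\<^esub> x', y) - frag_of (x, y) - frag_of (x', y) | x x' y.
          x \<in> carrier M \<and> x' \<in> carrier M \<and> y \<in> carrier N} \<union>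
       {frag_of (x, y \<oplus>\<^bsub>N\<^esub> y') - frag_of (x, y) - frag_of (x, y') | x y y'.
          x \<in> carrier M \<and> y \<in> carrier N \<and> y' \<in> carrier N} \<union>
       {frag_of (r \<odot>\<^bsub>M\<^esub> x, y) - frag_of (x, r \<odot>\<^bsub>N\<^esub> y) | r x y.
          r \<in> carrier R \<and> x \<in> carrier M \<and> y \<in> carrier N})"

definition tensor ::
    "'a ring \<Rightarrow> ('a, 'b) module \<Rightarrow> ('a, 'c) module \<Rightarrow> ('b \<times> 'c \<Rightarrow>\<^sub>0 int) set monoid" where
  "tensor R M N = free_Abelian_group (carrier M \<times> carrier N) Mod tensor_relations R M N"

text \<open>The map \<open>\<phi> \<otimes> id : M' \<otimes> N \<rightarrow> M \<otimes> N\<close> induced by \<open>\<phi> : M' \<rightarrow> M\<close>, on cosets.\<close>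

definition tensor_map ::
    "'a ring \<Rightarrow> ('a, 'c) module \<Rightarrow> ('a, 'd) module \<Rightarrow> ('b \<Rightarrow> 'c) \<Rightarrow>
     ('b \<times> 'd \<Rightarrow>\<^sub>0 int) set \<Rightarrow> ('c \<times> 'd \<Rightarrow>\<^sub>0 int) set" where
  "tensor_map R M N \<phi> C =
     (\<Union>c\<in>C. tensor_relations R M N #>\<^bsub>free_Abelian_group (carrier M \<times> carrier N)\<^esub>
               frag_extend (\<lambda>(x, y). frag_of (\<phi> x, y)) c)"

text \<open>Flatness: tensoring preserves injectivity. A definition in HOL cannot quantify over
  modules of all types. The type \<open>(nat \<Rightarrow> 'a) set\<close> contains a copy of every finitely
  generated \<open>R\<close>-module (cosets of a submodule of \<open>R\<^sup>n\<close>); these suffice, because an element of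
  the kernel of \<open>M' \<otimes> S \<rightarrow> M \<otimes> S\<close> already lies in the kernel for suitable finitely generated
  submodules of \<open>M'\<close> and \<open>M\<close>.\<close>

definition flat_hom :: "'a ring \<Rightarrow> 'b ring \<Rightarrow> ('a \<Rightarrow> 'b) \<Rightarrow> bool" where
  "flat_hom R S h \<longleftrightarrow> h \<in> ring_hom R S \<and>
     (\<forall>(M' :: ('a, (nat \<Rightarrow> 'a) set) module) (M :: ('a, (nat \<Rightarrow> 'a) set) module) \<phi>.
        module R M' \<and> module R M \<and> module_hom R M' M \<phi> \<and> inj_on \<phi> (carrier M') \<longrightarrow>
        inj_on (tensor_map R M (restrict_scalars S h) \<phi>)
          (carrier (tensor R M' (restrict_scalars S h))))"

subsection \<open>Finite separable field extensions\<close>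

text \<open>Polynomials are lists of coefficients, leading coefficient first.\<close>

definition poly_deriv :: "'a ring \<Rightarrow> 'a list \<Rightarrow> 'a list" where
  "poly_deriv L p = ring.normalize L (map (\<lambda>i. [i] \<cdot>\<^bsub>L\<^esub> ring.coeff L p i) (rev [1..<length p]))"

definition separable_poly :: "'a ring \<Rightarrow> 'a set \<Rightarrow> 'a list \<Rightarrow> bool" where
  "separable_poly L K p \<longleftrightarrow>
     (\<forall>d\<in>carrier (K[X]\<^bsub>L\<^esub>). d divides\<^bsub>K[X]\<^bsub>L\<^esub>\<^esub> p \<and> d divides\<^bsub>K[X]\<^bsub>L\<^esub>\<^esub> poly_deriv L p
        \<longrightarrow> d \<in> Units (K[X]\<^bsub>L\<^esub>))"

definition finite_separable_extension :: "'a ring \<Rightarrow> 'a set \<Rightarrow> bool" where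
  "finite_separable_extension L K \<longleftrightarrow>
     field L \<and> subfield K L \<and> ring.finite_dimension L K (carrier L) \<and>
     (\<forall>x\<in>carrier L. ring.algebraic L K x \<and> separable_poly L K (ring.Irr L K x))"

section \<open>Locally ringed spaces\<close>

text \<open>Spaces are called \<open>\<XX>\<close>, since a plain capital X is HOL-Algebra notation for the polynomial
  variable. The sections over all open sets share one type; their carriers may be arbitrary.\<close>

record ('x, 'r) rspace =
  topo :: "'x topology"
  sect :: "'x set \<Rightarrow> 'r ring"
  restr :: "'x set \<Rightarrow> 'x set \<Rightarrow> 'r \<Rightarrow> 'r"

abbreviation points :: "('x, 'r) rspace \<Rightarrow> 'x set" where
  "points \<XX> \<equiv> topspace (topo \<XX>)"

text \<open>The sheaf condition covers the empty family, so that the sections over the empty set form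
  the zero ring.\<close>

locale ringed_space =
  fixes \<XX> :: "('x, 'r) rspace"
  assumes sect_cring: "openin (topo \<XX>) U \<Longrightarrow> cring (sect \<XX> U)"
    and restr_hom: "\<lbrakk>openin (topo \<XX>) U; openin (topo \<XX>) V; V \<subseteq> U\<rbrakk>
      \<Longrightarrow> restr \<XX> U V \<in> ring_hom (sect \<XX> U) (sect \<XX> V)"
    and restr_id: "\<lbrakk>openin (topo \<XX>) U; s \<in> carrier (sect \<XX> U)\<rbrakk> \<Longrightarrow> restr \<XX> U U s = s"
    and restr_restr: "\<lbrakk>openin (topo \<XX>) U; openin (topo \<XX>) V; openin (topo \<XX>) W; W \<subseteq> V; V \<subseteq> U;
        s \<in> carrier (sect \<XX> U)\<rbrakk> \<Longrightarrow> restr \<XX> V W (restr \<XX> U V s) = restr \<XX> U W s"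
    and sheaf: "\<lbrakk>\<And>U. U \<in> \<U> \<Longrightarrow> openin (topo \<XX>) U;
        \<And>U. U \<in> \<U> \<Longrightarrow> \<sigma> U \<in> carrier (sect \<XX> U);
        \<And>U V. \<lbrakk>U \<in> \<U>; V \<in> \<U>\<rbrakk> \<Longrightarrow> restr \<XX> U (U \<inter> V) (\<sigma> U) = restr \<XX> V (U \<inter> V) (\<sigma> V)\<rbrakk>
      \<Longrightarrow> \<exists>!t. t \<in> carrier (sect \<XX> (\<Union>\<U>)) \<and> (\<forall>U\<in>\<U>. restr \<XX> (\<Union>\<U>) U t = \<sigma> U)"

definition germ :: "('x, 'r) rspace \<Rightarrow> 'x \<Rightarrow> 'x set \<Rightarrow> 'r \<Rightarrow> ('x set \<times> 'r) set" where
  "germ \<XX> x U s = {(V, t). openin (topo \<XX>) V \<and> x \<in> V \<and> t \<in> carrier (sect \<XX> V) \<and>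
     (\<exists>W. openin (topo \<XX>) W \<and> x \<in> W \<and> W \<subseteq> U \<inter> V \<and> restr \<XX> U W s = restr \<XX> V W t)}"

definition stalk :: "('x, 'r) rspace \<Rightarrow> 'x \<Rightarrow> ('x set \<times> 'r) set ring" where
  "stalk \<XX> x =
     \<lparr>carrier = {germ \<XX> x U s | U s. openin (topo \<XX>) U \<and> x \<in> U \<and> s \<in> carrier (sect \<XX> U)},
      monoid.mult = (\<lambda>A B. \<Union>(U, s)\<in>A. \<Union>(V, t)\<in>B.
        germ \<XX> x (U \<inter> V) (restr \<XX> U (U \<inter> V) s \<otimes>\<^bsub>sect \<XX> (U \<inter> V)\<^esub> restr \<XX> V (U \<inter> V) t)),
      monoid.one = germ \<XX> x (points \<XX>) \<one>\<^bsub>sect \<XX> (points \<XX>)\<^esub>,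
      ring.zero = germ \<XX> x (points \<XX>) \<zero>\<^bsub>sect \<XX> (points \<XX>)\<^esub>,
      ring.add = (\<lambda>A B. \<Union>(U, s)\<in>A. \<Union>(V, t)\<in>B.
        germ \<XX> x (U \<inter> V) (restr \<XX> U (U \<inter> V) s \<oplus>\<^bsub>sect \<XX> (U \<inter> V)\<^esub> restr \<XX> V (U \<inter> V) t))\<rparr>"

locale locally_ringed_space = ringed_space +
  assumes stalk_local: "x \<in> points \<XX> \<Longrightarrow> local_ring (stalk \<XX> x)"

text \<open>A morphism \<open>f : Y \<rightarrow> \<XX>\<close> consists of a map of points and, for open \<open>V\<close> in \<open>\<XX>\<close>, a map from
  the sections over \<open>V\<close> to the sections over the preimage of \<open>V\<close>. Only the values on
  points, open sets and sections matter; \<open>same_map\<close> is equality in this sense.\<close>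

record ('y, 's, 'x, 'r) rmap =
  pt_map :: "'y \<Rightarrow> 'x"
  sec_map :: "'x set \<Rightarrow> 'r \<Rightarrow> 's"

definition preim :: "('y, 's) rspace \<Rightarrow> ('y, 's, 'x, 'r) rmap \<Rightarrow> 'x set \<Rightarrow> 'y set" where
  "preim Y f V = {y \<in> points Y. pt_map f y \<in> V}"

definition stalk_map ::
    "('y, 's) rspace \<Rightarrow> ('y, 's, 'x, 'r) rmap \<Rightarrow> 'y \<Rightarrow> ('x set \<times> 'r) set \<Rightarrow> ('y set \<times> 's) set" where
  "stalk_map Y f y A = (\<Union>(V, s)\<in>A. germ Y y (preim Y f V) (sec_map f V s))"

locale lrs_morphism =
  dom: locally_ringed_space Y + cod: locally_ringed_space \<XX>
  for Y :: "('y, 's) rspace" and \<XX> :: "('x, 'r) rspace" +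
  fixes f :: "('y, 's, 'x, 'r) rmap"
  assumes continuous: "continuous_map (topo Y) (topo \<XX>) (pt_map f)"
    and sec_hom: "openin (topo \<XX>) V \<Longrightarrow> sec_map f V \<in> ring_hom (sect \<XX> V) (sect Y (preim Y f V))"
    and sec_natural: "\<lbrakk>openin (topo \<XX>) V; openin (topo \<XX>) W; W \<subseteq> V; s \<in> carrier (sect \<XX> V)\<rbrakk>
      \<Longrightarrow> sec_map f W (restr \<XX> V W s) = restr Y (preim Y f V) (preim Y f W) (sec_map f V s)"
    and stalk_local_hom: "y \<in> points Y
      \<Longrightarrow> local_hom (stalk \<XX> (pt_map f y)) (stalk Y y) (stalk_map Y f y)"

definition id_map :: "('x, 'r, 'x, 'r) rmap" where
  "id_map = \<lparr>pt_map = (\<lambda>x. x), sec_map = (\<lambda>V s. s)\<rparr>"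

definition comp_map ::
    "('y, 's) rspace \<Rightarrow> ('y, 's, 'x, 'r) rmap \<Rightarrow> ('z, 't, 'y, 's) rmap \<Rightarrow> ('z, 't, 'x, 'r) rmap" where
  "comp_map Y f g =
     \<lparr>pt_map = (\<lambda>z. pt_map f (pt_map g z)),
      sec_map = (\<lambda>V s. sec_map g (preim Y f V) (sec_map f V s))\<rparr>"

definition same_map ::
    "('y, 's) rspace \<Rightarrow> ('x, 'r) rspace \<Rightarrow>
     ('y, 's, 'x, 'r) rmap \<Rightarrow> ('y, 's, 'x, 'r) rmap \<Rightarrow> bool" where
  "same_map Y \<XX> f g \<longleftrightarrow>
     (\<forall>y\<in>points Y. pt_map f y = pt_map g y) \<and>
     (\<forall>V s. openin (topo \<XX>) V \<and> s \<in> carrier (sect \<XX> V) \<longrightarrow> sec_map f V s = sec_map g V s)"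

definition lrs_isomorphic :: "('y, 's) rspace \<Rightarrow> ('x, 'r) rspace \<Rightarrow> bool" where
  "lrs_isomorphic Y \<XX> \<longleftrightarrow>
     (\<exists>f g. lrs_morphism Y \<XX> f \<and> lrs_morphism \<XX> Y g \<and>
        same_map \<XX> \<XX> (comp_map Y f g) id_map \<and> same_map Y Y (comp_map \<XX> g f) id_map)"

definition open_subspace :: "('x, 'r) rspace \<Rightarrow> 'x set \<Rightarrow> ('x, 'r) rspace" where
  "open_subspace \<XX> U = \<XX>\<lparr>topo := subtopology (topo \<XX>) U\<rparr>"

section \<open>Schemes\<close>

subsection \<open>The spectrum of a ring\<close>

definition zariski_open :: "'a ring \<Rightarrow> 'a set set \<Rightarrow> bool" where
  "zariski_open A U \<longleftrightarrow> (\<exists>E\<subseteq>carrier A. U = {p. primeideal p A \<and> \<not> E \<subseteq> p})"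

lemma istopology_zariski: "istopology (zariski_open A)"
  unfolding istopology_def
proof (intro conjI allI impI)
  fix S T assume "zariski_open A S" "zariski_open A T"
  then obtain E F where E: "E \<subseteq> carrier A" "S = {p. primeideal p A \<and> \<not> E \<subseteq> p}"
    and F: "F \<subseteq> carrier A" "T = {p. primeideal p A \<and> \<not> F \<subseteq> p}"
    unfolding zariski_open_def by auto
  define G where "G = {a \<otimes>\<^bsub>A\<^esub> b | a b. a \<in> E \<and> b \<in> F}"
  have iff: "G \<subseteq> p \<longleftrightarrow> E \<subseteq> p \<or> F \<subseteq> p" if p: "primeideal p A" for p
  proof -
    interpret primeideal p A by (rule p)
    show ?thesis
    proof
      assume G: "G \<subseteq> p"
      show "E \<subseteq> p \<or> F \<subseteq> p"
      proof (rule ccontr)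
        assume "\<not> (E \<subseteq> p \<or> F \<subseteq> p)"
        then obtain a b where ab: "a \<in> E" "a \<notin> p" "b \<in> F" "b \<notin> p" by blast
        then have "a \<otimes>\<^bsub>A\<^esub> b \<in> p" using G unfolding G_def by blast
        then show False using I_prime ab E(1) F(1) by (meson subsetD)
      qed
    next
      assume "E \<subseteq> p \<or> F \<subseteq> p"
      then show "G \<subseteq> p"
      proof
        assume "E \<subseteq> p"
        then show ?thesis unfolding G_def using F(1) I_r_closed by (clarsimp simp: subset_iff)
      next
        assume "F \<subseteq> p"
        then show ?thesis unfolding G_def using E(1) I_l_closed by (clarsimp simp: subset_iff)
      qed
    qed
  qed
  show "zariski_open A (S \<inter> T)"
  proof (cases "S \<inter> T = {}")
    case True
    then show ?thesis unfolding zariski_open_def by (intro exI[of _ "{}"]) auto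
  next
    case False
    then obtain p where "primeideal p A" using E by auto
    then interpret primeideal p A .
    have "G \<subseteq> carrier A" using E F unfolding G_def by auto
    then show ?thesis unfolding zariski_open_def E F using iff by (intro exI[of _ G]) auto
  qed
next
  fix \<K> assume "\<forall>K\<in>\<K>. zariski_open A K"
  then obtain E where E: "\<And>K. K \<in> \<K> \<Longrightarrow> E K \<subseteq> carrier A \<and> K = {p. primeideal p A \<and> \<not> E K \<subseteq> p}"
    unfolding zariski_open_def by metis
  have "\<Union>\<K> = {p. primeideal p A \<and> \<not> (\<Union>K\<in>\<K>. E K) \<subseteq> p}"
    using E by blast
  then show "zariski_open A (\<Union>\<K>)"
    unfolding zariski_open_def using E by (intro exI[of _ "\<Union>K\<in>\<K>. E K"]) auto
qed

text \<open>Sections of the structure sheaf over \<open>U\<close> are the (extensional) functions on \<open>U\<close> with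
  values in the localisations at the points of \<open>U\<close> that are locally given by a fraction.\<close>

definition spec_sections :: "'a ring \<Rightarrow> 'a set set \<Rightarrow> ('a set \<Rightarrow> ('a \<times> 'a) set) set" where
  "spec_sections A U = {s \<in> (\<Pi>\<^sub>E p\<in>U. carrier (localization_at_prime A p)).
     \<forall>p\<in>U. \<exists>V a b. zariski_open A V \<and> p \<in> V \<and> V \<subseteq> U \<and> a \<in> carrier A \<and> b \<in> carrier A \<and>
       (\<forall>q\<in>V. b \<notin> q \<and> s q = loc_frac A (carrier A - q) a b)}"

definition Spec :: "'a ring \<Rightarrow> ('a set, 'a set \<Rightarrow> ('a \<times> 'a) set) rspace" where
  "Spec A =
     \<lparr>topo = topology (zariski_open A),
      sect = (\<lambda>U. \<lparr>carrier = spec_sections A U,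
        monoid.mult = (\<lambda>s t. \<lambda>p\<in>U. s p \<otimes>\<^bsub>localization_at_prime A p\<^esub> t p),
        monoid.one = (\<lambda>p\<in>U. \<one>\<^bsub>localization_at_prime A p\<^esub>),
        ring.zero = (\<lambda>p\<in>U. \<zero>\<^bsub>localization_at_prime A p\<^esub>),
        ring.add = (\<lambda>s t. \<lambda>p\<in>U. s p \<oplus>\<^bsub>localization_at_prime A p\<^esub> t p)\<rparr>),
      restr = (\<lambda>U V s. restrict s V)\<rparr>"

lemma openin_Spec: "openin (topo (Spec A)) U \<longleftrightarrow> zariski_open A U"
  using topology_inverse'[OF istopology_zariski[of A]] by (simp add: Spec_def)

lemma points_Spec: "points (Spec A) = {p. primeideal p A}"
proof -
  have "\<not> carrier A \<subseteq> p" if "primeideal p A" for p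
  proof -
    interpret primeideal p A by (rule that)
    show ?thesis using I_notcarr a_subset by blast
  qed
  then have "zariski_open A {p. primeideal p A}"
    unfolding zariski_open_def by (intro exI[of _ "carrier A"]) auto
  then show ?thesis
    unfolding topspace_def openin_Spec by (auto simp: zariski_open_def)
qed

subsection \<open>Schemes and their morphisms\<close>

text \<open>The ring \<open>A\<close> is sought in the type of the sections of \<open>\<XX>\<close>; this is no restriction,
  since it is necessarily isomorphic to the ring of sections over \<open>U\<close>.\<close>

definition affine_open :: "('x, 'r) rspace \<Rightarrow> 'x set \<Rightarrow> bool" where
  "affine_open \<XX> U \<longleftrightarrow> openin (topo \<XX>) U \<and>
     (\<exists>A :: 'r ring. cring A \<and> lrs_isomorphic (open_subspace \<XX> U) (Spec A))"

definition scheme :: "('x, 'r) rspace \<Rightarrow> bool" where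
  "scheme \<XX> \<longleftrightarrow> locally_ringed_space \<XX> \<and> (\<forall>x\<in>points \<XX>. \<exists>U. affine_open \<XX> U \<and> x \<in> U)"

definition quasi_compact :: "('x, 'r) rspace \<Rightarrow> bool" where
  "quasi_compact \<XX> \<longleftrightarrow> compact_space (topo \<XX>)"

definition scheme_morphism ::
    "('y, 's) rspace \<Rightarrow> ('x, 'r) rspace \<Rightarrow> ('y, 's, 'x, 'r) rmap \<Rightarrow> bool" where
  "scheme_morphism Y \<XX> f \<longleftrightarrow> scheme Y \<and> scheme \<XX> \<and> lrs_morphism Y \<XX> f"

text \<open>The last conjunct says that the map from the structure sheaf of \<open>\<XX>\<close> to the direct image of
  that of \<open>Z\<close> is surjective as a map of sheaves, i.e. locally on \<open>\<XX>\<close>.\<close>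

definition closed_immersion ::
    "('z, 't) rspace \<Rightarrow> ('x, 'r) rspace \<Rightarrow> ('z, 't, 'x, 'r) rmap \<Rightarrow> bool" where
  "closed_immersion Z \<XX> j \<longleftrightarrow> scheme_morphism Z \<XX> j \<and>
     closedin (topo \<XX>) (pt_map j ` points Z) \<and>
     homeomorphic_map (topo Z) (subtopology (topo \<XX>) (pt_map j ` points Z)) (pt_map j) \<and>
     (\<forall>V t x. openin (topo \<XX>) V \<and> t \<in> carrier (sect Z (preim Z j V)) \<and> x \<in> V \<longrightarrow>
        (\<exists>W s. openin (topo \<XX>) W \<and> x \<in> W \<and> W \<subseteq> V \<and> s \<in> carrier (sect \<XX> W) \<and>
           sec_map j W s = restr Z (preim Z j V) (preim Z j W) t))"

definition residue_field_at :: "('x, 'r) rspace \<Rightarrow> 'x \<Rightarrow> ('x set \<times> 'r) set set ring" where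
  "residue_field_at \<XX> x = residue_field (stalk \<XX> x)"

definition residue_field_map ::
    "('y, 's) rspace \<Rightarrow> ('y, 's, 'x, 'r) rmap \<Rightarrow> 'y \<Rightarrow>
     ('x set \<times> 'r) set set \<Rightarrow> ('y set \<times> 's) set set" where
  "residue_field_map Y f y = residue_map (stalk Y y) (stalk_map Y f y)"

subsection \<open>Etale morphisms\<close>

text \<open>A morphism is etale if it is flat, locally of finite presentation and unramified.\<close>

definition flat_at ::
    "('y, 's) rspace \<Rightarrow> ('x, 'r) rspace \<Rightarrow> ('y, 's, 'x, 'r) rmap \<Rightarrow> 'y \<Rightarrow> bool" where
  "flat_at Y \<XX> f y \<longleftrightarrow> flat_hom (stalk \<XX> (pt_map f y)) (stalk Y y) (stalk_map Y f y)"

definition finitely_presented_at ::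
    "('y, 's) rspace \<Rightarrow> ('x, 'r) rspace \<Rightarrow> ('y, 's, 'x, 'r) rmap \<Rightarrow> 'y \<Rightarrow> bool" where
  "finitely_presented_at Y \<XX> f y \<longleftrightarrow>
     (\<exists>V W. affine_open Y V \<and> y \<in> V \<and> affine_open \<XX> W \<and> pt_map f ` V \<subseteq> W \<and>
        finitely_presented (sect \<XX> W) (sect Y V) (\<lambda>s. restr Y (preim Y f W) V (sec_map f W s)))"

definition unramified_at ::
    "('y, 's) rspace \<Rightarrow> ('x, 'r) rspace \<Rightarrow> ('y, 's, 'x, 'r) rmap \<Rightarrow> 'y \<Rightarrow> bool" where
  "unramified_at Y \<XX> f y \<longleftrightarrow>
     Idl\<^bsub>stalk Y y\<^esub> (stalk_map Y f y ` max_ideal (stalk \<XX> (pt_map f y))) = max_ideal (stalk Y y) \<and>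
     finite_separable_extension (residue_field_at Y y)
       (residue_field_map Y f y ` carrier (residue_field_at \<XX> (pt_map f y)))"

definition etale ::
    "('y, 's) rspace \<Rightarrow> ('x, 'r) rspace \<Rightarrow> ('y, 's, 'x, 'r) rmap \<Rightarrow> bool" where
  "etale Y \<XX> f \<longleftrightarrow> scheme_morphism Y \<XX> f \<and>
     (\<forall>y\<in>points Y. flat_at Y \<XX> f y \<and> finitely_presented_at Y \<XX> f y \<and> unramified_at Y \<XX> f y)"

section \<open>The marked etale site\<close>

definition marked_scheme :: "('x, 'r) rspace \<Rightarrow> 'x set \<Rightarrow> bool" where
  "marked_scheme \<XX> T \<longleftrightarrow> scheme \<XX> \<and> T \<subseteq> points \<XX>"

definition marked_morphism ::
    "('y, 's) rspace \<Rightarrow> 'y set \<Rightarrow> ('x, 'r) rspace \<Rightarrow> 'x set \<Rightarrow> ('y, 's, 'x, 'r) rmap \<Rightarrow> bool" where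
  "marked_morphism Y S \<XX> T f \<longleftrightarrow>
     marked_scheme Y S \<and> marked_scheme \<XX> T \<and> scheme_morphism Y \<XX> f \<and> pt_map f ` S \<subseteq> T"

text \<open>\<open>f : (U, S) \<rightarrow> (\<XX>, T)\<close> is an object of the marked etale site of \<open>(\<XX>, T)\<close>.\<close>

definition met_object ::
    "('x, 'r) rspace \<Rightarrow> 'x set \<Rightarrow> ('u, 's) rspace \<Rightarrow> 'u set \<Rightarrow> ('u, 's, 'x, 'r) rmap \<Rightarrow> bool" where
  "met_object \<XX> T U S f \<longleftrightarrow>
     marked_morphism U S \<XX> T f \<and> etale U \<XX> f \<and> S = preim U f T"

text \<open>\<open>p\<close> is a morphism over \<open>(\<XX>, T)\<close> from \<open>f : (U, S) \<rightarrow> (\<XX>, T)\<close> to \<open>g : (V, R) \<rightarrow> (\<XX>, T)\<close>.\<close>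

definition met_morphism ::
    "('x, 'r) rspace \<Rightarrow> 'x set \<Rightarrow>
     ('u, 's) rspace \<Rightarrow> 'u set \<Rightarrow> ('u, 's, 'x, 'r) rmap \<Rightarrow>
     ('v, 'q) rspace \<Rightarrow> 'v set \<Rightarrow> ('v, 'q, 'x, 'r) rmap \<Rightarrow>
     ('u, 's, 'v, 'q) rmap \<Rightarrow> bool" where
  "met_morphism \<XX> T U S f V R g p \<longleftrightarrow>
     met_object \<XX> T U S f \<and> met_object \<XX> T V R g \<and> marked_morphism U S V R p \<and>
     same_map U \<XX> (comp_map V g p) f"

text \<open>The family \<open>p i : (U i, S i) \<rightarrow> (V, R)\<close>, \<open>i \<in> I\<close>, is a covering in the marked etale site of
  \<open>(\<XX>, T)\<close>; here \<open>f i\<close> and \<open>g\<close> are the structure morphisms of \<open>(U i, S i)\<close> and \<open>(V, R)\<close>.\<close>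

definition met_covering ::
    "('x, 'r) rspace \<Rightarrow> 'x set \<Rightarrow>
     ('v, 'q) rspace \<Rightarrow> 'v set \<Rightarrow> ('v, 'q, 'x, 'r) rmap \<Rightarrow>
     'i set \<Rightarrow> ('i \<Rightarrow> ('u, 's) rspace) \<Rightarrow> ('i \<Rightarrow> 'u set) \<Rightarrow> ('i \<Rightarrow> ('u, 's, 'x, 'r) rmap) \<Rightarrow>
     ('i \<Rightarrow> ('u, 's, 'v, 'q) rmap) \<Rightarrow> bool" where
  "met_covering \<XX> T V R g I U S f p \<longleftrightarrow>
     met_object \<XX> T V R g \<and>
     (\<forall>i\<in>I. met_morphism \<XX> T (U i) (S i) (f i) V R g (p i)) \<and>
     (\<forall>v\<in>points V. \<exists>i\<in>I. \<exists>u\<in>points (U i). pt_map (p i) u = v) \<and>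
     (\<forall>v\<in>R. \<exists>i\<in>I. \<exists>u\<in>S i. pt_map (p i) u = v \<and>
        residue_field_map (U i) (p i) u \<in> ring_iso (residue_field_at V v) (residue_field_at (U i) u))"

end

theory Submission
  imports Defs "HOL-Analysis.Function_Topology" "HOL-Algebra.UnivPoly"
begin

text \<open>
  A covering of \<open>(\<XX>, T)\<close> is cut down to a finite one by compactness of \<open>\<XX>\<close> in the constructible
  topology, in which the zero sets of finitely many functions on open sets are open.

  A spectrum is compact in this topology, because prime ideals are the points of a closed subset of
  a product of two-point spaces (\<open>constructible_compactness\<close>); a quasi-compact scheme is covered by
  finitely many spectra (\<open>scheme_constructibly_compact\<close>). So it suffices to find, for each point \<open>x\<close>, an
  index \<open>i\<close> and a constructible neighbourhood of \<open>x\<close> all of whose points are in the image of \<open>U i\<close>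
  and, as far as they lie in \<open>T\<close>, split in \<open>U i\<close>.

  Let \<open>u\<close> be a point of an etale scheme over \<open>x\<close>. On affine open sets the morphism is given by a finitely
  presented algebra \<open>R \<rightarrow> S\<close>, and the residue field of \<open>u\<close> is algebraic over that of \<open>x\<close>. Therefore
  the image of every constructible neighbourhood of \<open>u\<close> is a constructible neighbourhood of \<open>x\<close>
  (\<open>constructibly_open_at_finitely_presented\<close>). This is elementary: a presentation reduces it to a
  polynomial ring in one variable, where long division by an equation of minimal degree of \<open>u\<close> over \<open>x\<close>
  gives an explicit neighbourhood.

  If \<open>u\<close> has the same residue field as \<open>x\<close>, each of finitely many generators of \<open>S\<close> takes at \<open>u\<close> the value of
  a fraction over \<open>R\<close>. That it takes the value of this fraction is a constructible condition, so the
  points of \<open>U i\<close> over points near \<open>x\<close> can be chosen to satisfy it, and they split (\<open>spread_out_splitting\<close>). For \<open>x\<close>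
  in \<open>T\<close> one starts with a point \<open>u\<close> that splits. For \<open>x\<close> outside \<open>T\<close> one starts with any \<open>u\<close> and intersects the
  neighbourhood with the complement of the closed set \<open>T\<close>.

  To translate between points and primes, the ring of sections over an affine open set is compared with
  the set (\<open>affine_open_spectrum_like\<close>): its primes are the points, and sections near a point are
  fractions of sections over the whole set.
\<close>

section \<open>Prime ideals and the constructible topology on a spectrum\<close>

lemma prime_idealD:
  assumes "primeideal Q R"
  shows "cring R" "ideal Q R" "Q \<subseteq> carrier R" "\<zero>\<^bsub>R\<^esub> \<in> Q" "\<one>\<^bsub>R\<^esub> \<notin> Q"
    "\<And>a b. \<lbrakk>a \<in> Q; b \<in> Q\<rbrakk> \<Longrightarrow> a \<oplus>\<^bsub>R\<^esub> b \<in> Q"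
    "\<And>a. a \<in> Q \<Longrightarrow> \<ominus>\<^bsub>R\<^esub> a \<in> Q"
    "\<And>a b. \<lbrakk>a \<in> Q; b \<in> carrier R\<rbrakk> \<Longrightarrow> a \<otimes>\<^bsub>R\<^esub> b \<in> Q"
    "\<And>a b. \<lbrakk>a \<in> carrier R; b \<in> Q\<rbrakk> \<Longrightarrow> a \<otimes>\<^bsub>R\<^esub> b \<in> Q"
    "\<And>a b. \<lbrakk>a \<in> carrier R; b \<in> carrier R\<rbrakk> \<Longrightarrow> a \<otimes>\<^bsub>R\<^esub> b \<in> Q \<longleftrightarrow> a \<in> Q \<or> b \<in> Q"
proof -
  interpret primeideal Q R by (rule assms)
  show "cring R" "ideal Q R" "Q \<subseteq> carrier R" "\<zero>\<^bsub>R\<^esub> \<in> Q"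
    using a_subset by (auto intro: cring_axioms is_ideal)
  show "\<one>\<^bsub>R\<^esub> \<notin> Q" using one_imp_carrier I_notcarr by blast
  show "\<And>a b. \<lbrakk>a \<in> Q; b \<in> Q\<rbrakk> \<Longrightarrow> a \<oplus>\<^bsub>R\<^esub> b \<in> Q" by simp
  show "\<And>a. a \<in> Q \<Longrightarrow> \<ominus>\<^bsub>R\<^esub> a \<in> Q" by simp
  show "\<And>a b. \<lbrakk>a \<in> Q; b \<in> carrier R\<rbrakk> \<Longrightarrow> a \<otimes>\<^bsub>R\<^esub> b \<in> Q" by (rule I_r_closed)
  show "\<And>a b. \<lbrakk>a \<in> carrier R; b \<in> Q\<rbrakk> \<Longrightarrow> a \<otimes>\<^bsub>R\<^esub> b \<in> Q" by (rule I_l_closed)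
  show "\<And>a b. \<lbrakk>a \<in> carrier R; b \<in> carrier R\<rbrakk> \<Longrightarrow> a \<otimes>\<^bsub>R\<^esub> b \<in> Q \<longleftrightarrow> a \<in> Q \<or> b \<in> Q"
    using I_prime I_l_closed I_r_closed by blast
qed

lemma (in cring) ideal_criterion:
  assumes "Q \<subseteq> carrier R" "\<zero> \<in> Q"
    and "\<And>a b. \<lbrakk>a \<in> Q; b \<in> Q\<rbrakk> \<Longrightarrow> a \<oplus> b \<in> Q"
    and "\<And>a b. \<lbrakk>a \<in> carrier R; b \<in> Q\<rbrakk> \<Longrightarrow> a \<otimes> b \<in> Q"
  shows "ideal Q R"
proof (rule idealI)
  have neg: "\<ominus> a \<in> Q" if "a \<in> Q" for a
  proof -
    have "a \<in> carrier R" using that assms(1) by blast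
    then have "\<ominus> a = (\<ominus> \<one>) \<otimes> a" by (simp add: l_minus)
    then show ?thesis using assms(4)[of "\<ominus> \<one>" a] that by simp
  qed
  show "ring R" by (rule ring_axioms)
  show "subgroup Q (add_monoid R)"
    by (rule add.subgroupI) (use assms(1-3) neg in \<open>auto simp: a_inv_def\<close>)
  show "\<And>a x. \<lbrakk>a \<in> Q; x \<in> carrier R\<rbrakk> \<Longrightarrow> x \<otimes> a \<in> Q" using assms(4) .
  show "\<And>a x. \<lbrakk>a \<in> Q; x \<in> carrier R\<rbrakk> \<Longrightarrow> a \<otimes> x \<in> Q"
    using assms(1,4) m_comm by (metis subsetD)
qed

lemma (in cring) primeideal_criterion:
  assumes "Q \<subseteq> carrier R" "\<zero> \<in> Q" "\<one> \<notin> Q"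
    and "\<And>a b. \<lbrakk>a \<in> Q; b \<in> Q\<rbrakk> \<Longrightarrow> a \<oplus> b \<in> Q"
    and "\<And>a b. \<lbrakk>a \<in> carrier R; b \<in> Q\<rbrakk> \<Longrightarrow> a \<otimes> b \<in> Q"
    and "\<And>a b. \<lbrakk>a \<in> carrier R; b \<in> carrier R; a \<otimes> b \<in> Q\<rbrakk> \<Longrightarrow> a \<in> Q \<or> b \<in> Q"
  shows "primeideal Q R"
proof (rule primeidealI)
  show "ideal Q R" by (rule ideal_criterion[OF assms(1,2,4,5)])
  show "cring R" by (rule cring_axioms)
  show "carrier R \<noteq> Q" using assms(3) one_closed by blast
qed (use assms(6) in blast)

text \<open>If neither \<open>a\<close> nor \<open>b\<close> lies in an ideal \<open>Q\<close> maximal among those that avoid \<open>M\<close>, then \<open>Q + (a)\<close> and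
  \<open>Q + (b)\<close> both meet \<open>M\<close>, and the product of the elements found there keeps \<open>a b\<close> out of \<open>Q\<close>.\<close>

lemma (in cring) maximal_ideal_avoiding:
  assumes I: "ideal I R" and M: "M \<subseteq> carrier R" "\<one> \<in> M" "\<And>a b. \<lbrakk>a \<in> M; b \<in> M\<rbrakk> \<Longrightarrow> a \<otimes> b \<in> M"
    and disj: "I \<inter> M = {}"
  obtains Q where "primeideal Q R" "I \<subseteq> Q" "Q \<inter> M = {}"
    "\<And>J. \<lbrakk>ideal J R; Q \<subseteq> J; J \<inter> M = {}\<rbrakk> \<Longrightarrow> J = Q"
proof -
  define \<S> where "\<S> = {J. ideal J R \<and> I \<subseteq> J \<and> J \<inter> M = {}}"
  have "\<exists>Q\<in>\<S>. \<forall>J\<in>\<S>. Q \<subseteq> J \<longrightarrow> J = Q"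
  proof (rule subset_Zorn)
    fix C assume C: "subset.chain \<S> C"
    show "\<exists>U\<in>\<S>. \<forall>J\<in>C. J \<subseteq> U"
    proof (cases "C = {}")
      case True
      have "I \<in> \<S>" using I disj by (simp add: \<S>_def)
      then show ?thesis using True by blast
    next
      case False
      have mem: "ideal J R" "I \<subseteq> J" "J \<inter> M = {}" if "J \<in> C" for J
        using C that by (auto simp: subset.chain_def \<S>_def)
      have "subset.chain {J. ideal J R} C"
        using C by (auto simp: subset.chain_def \<S>_def)
      then have "ideal (\<Union>C) R" using chain_Union_is_ideal[of C] False by simp
      then have "\<Union>C \<in> \<S>" using mem False by (fastforce simp: \<S>_def)
      then show ?thesis by blast
    qed
  qed
  then obtain Q where "Q \<in> \<S>" and Q_max: "\<And>J. \<lbrakk>J \<in> \<S>; Q \<subseteq> J\<rbrakk> \<Longrightarrow> J = Q" by meson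
  then have Q: "ideal Q R" "I \<subseteq> Q" "Q \<inter> M = {}" by (simp_all add: \<S>_def)
  have max: "J = Q" if "ideal J R" "Q \<subseteq> J" "J \<inter> M = {}" for J
    using Q_max[of J] that Q(2) by (simp add: \<S>_def)
  interpret Q: ideal Q R by (rule Q)
  have meets: "\<exists>x\<in>Q. \<exists>r\<in>carrier R. x \<oplus> r \<otimes> a \<in> M" if a: "a \<in> carrier R" "a \<notin> Q" for a
  proof -
    have P: "ideal (PIdl a) R" by (rule cgenideal_ideal[OF a(1)])
    let ?J = "Q <+>\<^bsub>R\<^esub> PIdl a"
    have J: "ideal ?J R" by (rule add_ideals[OF Q(1) P])
    have z: "\<zero> \<in> PIdl a" "a \<in> PIdl a"
      using additive_subgroup.zero_closed[OF ideal.axioms(1)[OF P]] cgenideal_self[OF a(1)] by auto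
    have "x \<in> ?J" if "x \<in> Q" for x
    proof -
      have "x = x \<oplus> \<zero>" using that by simp
      then show ?thesis unfolding set_add_def' using that z(1) by blast
    qed
    moreover have "a \<in> ?J"
    proof -
      have "a = \<zero> \<oplus> a" using a by simp
      then show ?thesis unfolding set_add_def' using z(2) Q.zero_closed by blast
    qed
    ultimately have "?J \<inter> M \<noteq> {}" using max[OF J] a(2) by blast
    then show ?thesis unfolding set_add_def' cgenideal_def by blast
  qed
  have "primeideal Q R"
  proof (rule primeidealI)
    show "carrier R \<noteq> Q" using M(2) Q(3) by blast
    fix a b assume ab: "a \<in> carrier R" "b \<in> carrier R" "a \<otimes> b \<in> Q"
    show "a \<in> Q \<or> b \<in> Q"
    proof (rule ccontr)
      assume "\<not> ?thesis"
      then obtain x r y s where x: "x \<in> Q" "r \<in> carrier R" "x \<oplus> r \<otimes> a \<in> M"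
        and y: "y \<in> Q" "s \<in> carrier R" "y \<oplus> s \<otimes> b \<in> M"
        using meets ab(1,2) by meson
      have c: "x \<in> carrier R" "y \<in> carrier R" using x(1) y(1) by auto
      have "(x \<oplus> r \<otimes> a) \<otimes> (y \<oplus> s \<otimes> b)
          = x \<otimes> (y \<oplus> s \<otimes> b) \<oplus> ((r \<otimes> a) \<otimes> y \<oplus> (r \<otimes> s) \<otimes> (a \<otimes> b))"
        using c x(2) y(2) ab by (simp add: l_distr r_distr m_ac a_ac)
      also have "\<dots> \<in> Q"
        using x y ab c by (intro Q.a_closed) (auto intro: Q.I_r_closed Q.I_l_closed)
      finally show False using M(3)[OF x(3) y(3)] Q(3) by blast
    qed
  qed (use Q(1) cring_axioms in auto)
  then show thesis using Q(2,3) max by (rule that)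
qed

lemma (in cring) prime_ideal_avoiding:
  assumes "ideal I R" "M \<subseteq> carrier R" "\<one> \<in> M" "\<And>a b. \<lbrakk>a \<in> M; b \<in> M\<rbrakk> \<Longrightarrow> a \<otimes> b \<in> M" "I \<inter> M = {}"
  obtains Q where "primeideal Q R" "I \<subseteq> Q" "Q \<inter> M = {}"
proof (rule maximal_ideal_avoiding[OF assms(1-3) _ assms(5)])
  show "a \<otimes> b \<in> M" if "a \<in> M" "b \<in> M" for a b using that by (rule assms(4))
qed (rule that)

lemma (in cring) maximalideal_containing:
  assumes I: "ideal I R" "\<one> \<notin> I"
  obtains m where "maximalideal m R" "I \<subseteq> m"
proof -
  obtain Q where Q: "primeideal Q R" "I \<subseteq> Q" "Q \<inter> {\<one>} = {}"
    and max: "\<And>J. \<lbrakk>ideal J R; Q \<subseteq> J; J \<inter> {\<one>} = {}\<rbrakk> \<Longrightarrow> J = Q"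
  proof (rule maximal_ideal_avoiding[of I "{\<one>}"])
    show "ideal I R" by (rule I(1))
    show "I \<inter> {\<one>} = {}" using I(2) by simp
  qed auto
  note QD = prime_idealD[OF Q(1)]
  have "maximalideal Q R"
  proof (rule maximalidealI)
    show "ideal Q R" by (rule QD(2))
    show "carrier R \<noteq> Q" using QD(5) one_closed by metis
    fix J assume J: "ideal J R" "Q \<subseteq> J"
    show "J = Q \<or> J = carrier R"
      using max[OF J] ideal.one_imp_carrier[OF J(1)] by (cases "\<one> \<in> J") auto
  qed
  then show thesis using Q(2) by (rule that)
qed

text \<open>The sets \<open>{p. F \<subseteq> p \<and> s \<notin> p}\<close>, for finite \<open>F\<close>, form a basis of the constructible topology.
  Primes are characteristic functions cut out by conditions on finitely many coordinates each, so
  they form a closed subspace of a product of two-point spaces; hence the topology is compact.\<close>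

lemma (in cring) constructible_compactness:
  assumes F: "\<And>q. primeideal q R \<Longrightarrow> finite (F q) \<and> F q \<subseteq> q"
    and s: "\<And>q. primeideal q R \<Longrightarrow> s q \<in> carrier R - q"
  obtains \<Q> where "finite \<Q>" "\<And>q. q \<in> \<Q> \<Longrightarrow> primeideal q R"
    "\<And>p. primeideal p R \<Longrightarrow> \<exists>q\<in>\<Q>. F q \<subseteq> p \<and> s q \<notin> p"
proof -
  define Y where "Y = product_topology (\<lambda>_::'a. discrete_topology (UNIV::bool set)) (carrier R)"
  define \<chi> where "\<chi> q = restrict (\<lambda>a. a \<in> q) (carrier R)" for q
  define E where "E q = {f \<in> topspace Y. (\<forall>a\<in>F q. f a) \<and> \<not> f (s q)}" for q
  have top: "topspace Y = carrier R \<rightarrow>\<^sub>E UNIV"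
    by (simp add: Y_def)
  have "compact_space Y"
    unfolding Y_def compact_space_product_topology by (simp add: compact_space_discrete_topology)
  have coord: "openin Y {f \<in> topspace Y. f a = b}" "closedin Y {f \<in> topspace Y. f a = b}"
    if a: "a \<in> carrier R" for a b
  proof -
    have c: "continuous_map Y (discrete_topology UNIV) (\<lambda>f. f a)"
      unfolding Y_def using a by (rule continuous_map_product_projection)
    show "openin Y {f \<in> topspace Y. f a = b}"
      using openin_continuous_map_preimage[OF c, of "{b}"] by simp
    show "closedin Y {f \<in> topspace Y. f a = b}"
      using closedin_continuous_map_preimage[OF c, of "{b}"] by simp
  qed
  have opn: "openin Y (E q)" if q: "primeideal q R" for q
  proof -
    have sub: "F q \<subseteq> carrier R" "s q \<in> carrier R"
      using F[OF q] s[OF q] prime_idealD(3)[OF q] by auto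
    have "openin Y ((\<Inter>a\<in>F q. {f \<in> topspace Y. f a = True}) \<inter> topspace Y)"
      using F[OF q] sub(1) by (intro openin_INT coord(1)) auto
    moreover have "openin Y {f \<in> topspace Y. f (s q) = False}"
      by (rule coord(1)[OF sub(2)])
    moreover have "E q = ((\<Inter>a\<in>F q. {f \<in> topspace Y. f a = True}) \<inter> topspace Y)
        \<inter> {f \<in> topspace Y. f (s q) = False}"
      by (auto simp: E_def)
    ultimately show ?thesis by (simp only: openin_Int)
  qed
  define C where "C = \<chi> ` {q. primeideal q R}"
  define c where "c a b = {f \<in> topspace Y. f a = b}" for a and b :: bool
  have cl: "closedin Y (c a b)" if "a \<in> carrier R" for a b
    unfolding c_def by (rule coord(2)[OF that])
  have C_eq: "C = (c \<zero> True \<inter> c \<one> False)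
      \<inter> (\<Inter>a\<in>carrier R. \<Inter>b\<in>carrier R. c a False \<union> c b False \<union> c (a \<oplus> b) True)
      \<inter> (\<Inter>a\<in>carrier R. \<Inter>b\<in>carrier R. c b False \<union> c (a \<otimes> b) True)
      \<inter> (\<Inter>a\<in>carrier R. \<Inter>b\<in>carrier R. c a True \<union> c b True \<union> c (a \<otimes> b) False)" (is "C = ?D")
  proof
    show "C \<subseteq> ?D"
    proof
      fix f assume "f \<in> C"
      then obtain q where q: "primeideal q R" "f = \<chi> q" unfolding C_def by blast
      have f: "f \<in> topspace Y" "\<And>a. a \<in> carrier R \<Longrightarrow> f a \<longleftrightarrow> a \<in> q"
        by (auto simp: q(2) \<chi>_def top)
      show "f \<in> ?D"
        using prime_idealD(4-10)[OF q(1)] f unfolding c_def by auto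
    qed
    show "?D \<subseteq> C"
    proof
      fix f assume f: "f \<in> ?D"
      then have ft: "f \<in> topspace Y" by (simp add: c_def)
      define q where "q = {a \<in> carrier R. f a}"
      have "primeideal q R"
      proof (rule primeideal_criterion)
        show "\<zero> \<in> q" "\<one> \<notin> q" using f by (auto simp: q_def c_def)
        show "a \<oplus> b \<in> q" if "a \<in> q" "b \<in> q" for a b
          using f that by (auto simp: q_def c_def)
        show "a \<otimes> b \<in> q" if "a \<in> carrier R" "b \<in> q" for a b
          using f that by (auto simp: q_def c_def)
        show "a \<in> q \<or> b \<in> q" if "a \<in> carrier R" "b \<in> carrier R" "a \<otimes> b \<in> q" for a b
          using f that by (auto simp: q_def c_def)
      qed (auto simp: q_def)
      moreover have "f = \<chi> q"
        using ft by (auto simp: top \<chi>_def q_def PiE_iff extensional_def fun_eq_iff)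
      ultimately show "f \<in> C" by (simp add: C_def)
    qed
  qed
  have "closedin Y C"
    unfolding C_eq by (intro closedin_Int closedin_INT closedin_Un cl) auto
  then have "compactin Y C"
    using \<open>compact_space Y\<close> closedin_compact_space by blast
  moreover have "C \<subseteq> \<Union> (E ` {q. primeideal q R})"
  proof
    fix f assume "f \<in> C"
    then obtain q where q: "primeideal q R" "f = \<chi> q" unfolding C_def by blast
    then have "f \<in> E q"
      using F[OF q(1)] s[OF q(1)] prime_idealD(3)[OF q(1)] by (auto simp: E_def \<chi>_def top)
    with q(1) show "f \<in> \<Union> (E ` {q. primeideal q R})" by blast
  qed
  moreover have "\<And>U. U \<in> E ` {q. primeideal q R} \<Longrightarrow> openin Y U" using opn by blast
  ultimately obtain \<F> where \<F>: "finite \<F>" "\<F> \<subseteq> E ` {q. primeideal q R}" "C \<subseteq> \<Union>\<F>"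
    by (metis (no_types, lifting) compactinD)
  from finite_subset_image[OF this(1,2)] obtain \<Q>
    where \<Q>: "\<Q> \<subseteq> {q. primeideal q R}" "finite \<Q>" "\<F> = E ` \<Q>" by blast
  show thesis
  proof
    show "finite \<Q>" "\<And>q. q \<in> \<Q> \<Longrightarrow> primeideal q R" using \<Q> by auto
    fix p assume p: "primeideal p R"
    then have "\<chi> p \<in> \<Union> (E ` \<Q>)" using \<F>(3) \<Q>(3) by (auto simp: C_def)
    then obtain q where q: "q \<in> \<Q>" "\<chi> p \<in> E q" by blast
    then have "F q \<subseteq> carrier R" "s q \<in> carrier R"
      using F s \<Q>(1) prime_idealD(3) by blast+
    then have "F q \<subseteq> p" "s q \<notin> p" using q(2) by (auto simp: E_def \<chi>_def)
    with q(1) show "\<exists>q\<in>\<Q>. F q \<subseteq> p \<and> s q \<notin> p" by blast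
  qed
qed

section \<open>Constructibly open homomorphisms\<close>

definition comap :: "('a, 'm) ring_scheme \<Rightarrow> ('a \<Rightarrow> 'b) \<Rightarrow> 'b set \<Rightarrow> 'a set" where
  "comap A h P = {a \<in> carrier A. h a \<in> P}"

lemma comap_comp: "h \<in> carrier A \<rightarrow> carrier B \<Longrightarrow> comap A (k \<circ> h) P = comap A h (comap B k P)"
  by (auto simp: comap_def)

lemma primeideal_comap:
  assumes "cring A" "h \<in> ring_hom A B" "primeideal P B"
  shows "primeideal (comap A h P) A"
proof -
  interpret A: cring A by (rule assms(1))
  interpret P: primeideal P B by (rule assms(3))
  interpret ring_hom_cring A B h
    by (rule ring_hom_cringI[OF assms(1) P.cring_axioms assms(2)])
  note P = prime_idealD[OF assms(3)]
  show ?thesis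
    by (rule A.primeideal_criterion) (use P in \<open>auto simp: comap_def\<close>)
qed

text \<open>Near \<open>P\<close>, the map of spectra induced by \<open>h\<close> is open in the constructible topology: basic
  neighbourhoods of \<open>P\<close> map onto neighbourhoods of its image. The notion is local at \<open>P\<close>, because the
  residue field at \<open>P\<close> decides about it below.\<close>

definition constructibly_open_at ::
    "('a, 'm) ring_scheme \<Rightarrow> ('b, 'n) ring_scheme \<Rightarrow> ('a \<Rightarrow> 'b) \<Rightarrow> 'b set \<Rightarrow> bool" where
  "constructibly_open_at A B h P \<longleftrightarrow>
     (\<forall>G b. finite G \<and> G \<subseteq> P \<and> b \<in> carrier B - P \<longrightarrow>
        (\<exists>F s. finite F \<and> F \<subseteq> comap A h P \<and> s \<in> carrier A - comap A h P \<and>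
           (\<forall>q. primeideal q A \<and> F \<subseteq> q \<and> s \<notin> q \<longrightarrow>
              (\<exists>Q. primeideal Q B \<and> G \<subseteq> Q \<and> b \<notin> Q \<and> comap A h Q = q))))"

lemma constructibly_open_at_comp:
  assumes h: "h \<in> carrier A \<rightarrow> carrier B"
    and 1: "constructibly_open_at A B h (comap B k P)" and 2: "constructibly_open_at B C k P"
  shows "constructibly_open_at A C (k \<circ> h) P"
  unfolding constructibly_open_at_def
proof (intro allI impI)
  fix G b assume "finite G \<and> G \<subseteq> P \<and> b \<in> carrier C - P"
  with 2 obtain F' s' where F': "finite F'" "F' \<subseteq> comap B k P" "s' \<in> carrier B - comap B k P"
    and ex: "\<And>q. \<lbrakk>primeideal q B; F' \<subseteq> q; s' \<notin> q\<rbrakk>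
      \<Longrightarrow> \<exists>Q. primeideal Q C \<and> G \<subseteq> Q \<and> b \<notin> Q \<and> comap B k Q = q"
    unfolding constructibly_open_at_def by meson
  from 1 F' obtain F s where "finite F" "F \<subseteq> comap A h (comap B k P)"
      "s \<in> carrier A - comap A h (comap B k P)"
    and ex': "\<And>q. \<lbrakk>primeideal q A; F \<subseteq> q; s \<notin> q\<rbrakk>
      \<Longrightarrow> \<exists>Q. primeideal Q B \<and> F' \<subseteq> Q \<and> s' \<notin> Q \<and> comap A h Q = q"
    unfolding constructibly_open_at_def by meson
  moreover have "\<exists>Q. primeideal Q C \<and> G \<subseteq> Q \<and> b \<notin> Q \<and> comap A h (comap B k Q) = q"
    if "primeideal q A" "F \<subseteq> q" "s \<notin> q" for q
    using ex'[OF that] ex by metis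
  ultimately show "\<exists>F s. finite F \<and> F \<subseteq> comap A (k \<circ> h) P \<and> s \<in> carrier A - comap A (k \<circ> h) P \<and>
     (\<forall>q. primeideal q A \<and> F \<subseteq> q \<and> s \<notin> q \<longrightarrow>
        (\<exists>Q. primeideal Q C \<and> G \<subseteq> Q \<and> b \<notin> Q \<and> comap A (k \<circ> h) Q = q))"
    unfolding comap_comp[OF h] by (intro exI[of _ F] exI[of _ s]) simp
qed

text \<open>A closed immersion given by finitely many equations is constructibly open: its image is the
  basic set where these equations hold.\<close>

lemma constructibly_open_at_quotient:
  assumes A: "cring A" and B: "cring B" and h: "h \<in> ring_hom A B" "h ` carrier A = carrier B"
    and K: "finite K" "K \<subseteq> carrier A" "Idl\<^bsub>A\<^esub> K = {a \<in> carrier A. h a = \<zero>\<^bsub>B\<^esub>}"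
    and P: "primeideal P B"
  shows "constructibly_open_at A B h P"
  unfolding constructibly_open_at_def
proof (intro allI impI)
  interpret A: cring A by (rule A)
  interpret B: cring B by (rule B)
  interpret h: ring_hom_cring A B h
    by (rule ring_hom_cringI[OF A B h(1)])
  note PD = prime_idealD[OF P]
  fix G b assume G: "finite G \<and> G \<subseteq> P \<and> b \<in> carrier B - P"
  then have "G \<subseteq> h ` carrier A" using PD(3) h(2) by blast
  then obtain G' where G': "finite G'" "G' \<subseteq> carrier A" "G = h ` G'"
    using G finite_subset_image by metis
  obtain s where s: "s \<in> carrier A" "b = h s" using G h(2) by blast
  have Kz: "h a = \<zero>\<^bsub>B\<^esub>" if "a \<in> K" for a
    using that A.genideal_self[OF K(2)] K(3) by blast
  show "\<exists>F s. finite F \<and> F \<subseteq> comap A h P \<and> s \<in> carrier A - comap A h P \<and>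
     (\<forall>q. primeideal q A \<and> F \<subseteq> q \<and> s \<notin> q \<longrightarrow>
        (\<exists>Q. primeideal Q B \<and> G \<subseteq> Q \<and> b \<notin> Q \<and> comap A h Q = q))"
  proof (rule exI[of _ "G' \<union> K"], rule exI[of _ s], intro conjI allI impI)
    show "finite (G' \<union> K)" using G' K by simp
    show "G' \<union> K \<subseteq> comap A h P"
      using G G' K(2) Kz PD(4) by (auto simp: comap_def)
    show "s \<in> carrier A - comap A h P" using s G by (auto simp: comap_def)
    fix q assume q: "primeideal q A \<and> G' \<union> K \<subseteq> q \<and> s \<notin> q"
    then have qp: "primeideal q A" by simp
    note qD = prime_idealD[OF qp]
    have ker: "a \<in> q" if "a \<in> carrier A" "h a = \<zero>\<^bsub>B\<^esub>" for a
      using A.genideal_minimal[OF qD(2), of K] q K(3) that by blast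
    have sat: "a \<in> q" if a: "a \<in> carrier A" "h a \<in> h ` q" for a
    proof -
      obtain c where c: "c \<in> q" "h a = h c" using a by blast
      have cc: "c \<in> carrier A" using c qD(3) by blast
      have "h (a \<oplus>\<^bsub>A\<^esub> \<ominus>\<^bsub>A\<^esub> c) = \<zero>\<^bsub>B\<^esub>" using a c cc by (simp add: B.r_neg)
      then have "a \<oplus>\<^bsub>A\<^esub> \<ominus>\<^bsub>A\<^esub> c \<in> q" using ker a(1) cc by simp
      then have "a \<oplus>\<^bsub>A\<^esub> \<ominus>\<^bsub>A\<^esub> c \<oplus>\<^bsub>A\<^esub> c \<in> q" using c(1) qD(6) by blast
      moreover have "a \<oplus>\<^bsub>A\<^esub> \<ominus>\<^bsub>A\<^esub> c \<oplus>\<^bsub>A\<^esub> c = a"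
        using a(1) cc by (simp add: A.a_assoc A.l_neg)
      ultimately show ?thesis by simp
    qed
    have "primeideal (h ` q) B"
    proof (rule B.primeideal_criterion)
      show "h ` q \<subseteq> carrier B" using qD(3) by auto
      show "\<zero>\<^bsub>B\<^esub> \<in> h ` q" using qD(4) h.hom_zero by force
      show "\<one>\<^bsub>B\<^esub> \<notin> h ` q" using sat[of "\<one>\<^bsub>A\<^esub>"] qD(5) by auto
      show "x \<oplus>\<^bsub>B\<^esub> y \<in> h ` q" if xy: "x \<in> h ` q" "y \<in> h ` q" for x y
      proof -
        obtain a c where ac: "a \<in> q" "c \<in> q" "x = h a" "y = h c" using xy by blast
        then have "x \<oplus>\<^bsub>B\<^esub> y = h (a \<oplus>\<^bsub>A\<^esub> c)" using qD(3) by (simp add: subset_iff)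
        then show ?thesis using qD(6) ac by blast
      qed
      show "x \<otimes>\<^bsub>B\<^esub> y \<in> h ` q" if xy: "x \<in> carrier B" "y \<in> h ` q" for x y
      proof -
        obtain a c where ac: "a \<in> carrier A" "c \<in> q" "x = h a" "y = h c" using xy h(2) by blast
        then have "x \<otimes>\<^bsub>B\<^esub> y = h (a \<otimes>\<^bsub>A\<^esub> c)" using qD(3) by (simp add: subset_iff)
        then show ?thesis using qD(9) ac by blast
      qed
      show "x \<in> h ` q \<or> y \<in> h ` q" if xy: "x \<in> carrier B" "y \<in> carrier B" "x \<otimes>\<^bsub>B\<^esub> y \<in> h ` q" for x y
      proof -
        obtain a c where ac: "a \<in> carrier A" "c \<in> carrier A" "x = h a" "y = h c"
          using xy h(2) by blast
        then have "a \<otimes>\<^bsub>A\<^esub> c \<in> q" using xy(3) by (intro sat) auto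
        then show ?thesis using qD(10) ac by blast
      qed
    qed
    moreover have "comap A h (h ` q) = q"
      using sat qD(3) by (auto simp: comap_def)
    moreover have "G \<subseteq> h ` q" unfolding G'(3) using q by (intro image_mono) simp
    moreover have "b \<notin> h ` q" unfolding s(2) using sat[OF s(1)] q by (intro notI) simp
    ultimately show "\<exists>Q. primeideal Q B \<and> G \<subseteq> Q \<and> b \<notin> Q \<and> comap A h Q = q"
      by (intro exI[of _ "h ` q"]) simp
  qed
qed

section \<open>Residually algebraic primes and polynomial rings in one variable\<close>

primrec horner :: "('b, 'n) ring_scheme \<Rightarrow> ('a \<Rightarrow> 'b) \<Rightarrow> 'b \<Rightarrow> 'a list \<Rightarrow> 'b" where
  "horner B h b [] = \<zero>\<^bsub>B\<^esub>"
| "horner B h b (c # cs) = h c \<oplus>\<^bsub>B\<^esub> b \<otimes>\<^bsub>B\<^esub> horner B h b cs"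

lemma horner_closed:
  assumes "cring B" "h ` set cs \<subseteq> carrier B" "b \<in> carrier B"
  shows "horner B h b cs \<in> carrier B"
proof -
  interpret B: cring B by (rule assms(1))
  show ?thesis using assms(2,3) by (induction cs) auto
qed

lemma horner_hom:
  assumes "cring B" "cring C" "k \<in> ring_hom B C" "h ` set cs \<subseteq> carrier B" "b \<in> carrier B"
  shows "k (horner B h b cs) = horner C (k \<circ> h) (k b) cs"
proof -
  interpret k: ring_hom_cring B C k by (rule ring_hom_cringI[OF assms(1-3)])
  show ?thesis using assms(4)
  proof (induction cs)
    case (Cons c cs)
    have "horner B h b cs \<in> carrier B"
      by (rule horner_closed[OF assms(1) _ assms(5)]) (use Cons.prems in auto)
    with Cons show ?case using assms(5) by simp
  qed simp
qed

text \<open>The extension of residue fields at \<open>P\<close> is algebraic. Denominators are cleared, so that the condition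
  speaks of polynomials over \<open>A\<close> that do not vanish modulo \<open>P\<close>, listed from the constant coefficient on.\<close>

definition residually_algebraic ::
    "('a, 'm) ring_scheme \<Rightarrow> ('b, 'n) ring_scheme \<Rightarrow> ('a \<Rightarrow> 'b) \<Rightarrow> 'b set \<Rightarrow> bool" where
  "residually_algebraic A B h P \<longleftrightarrow>
     (\<forall>b\<in>carrier B. \<exists>cs. set cs \<subseteq> carrier A \<and> horner B h b cs \<in> P \<and> (\<exists>c\<in>set cs. h c \<notin> P))"

text \<open>In an algebraic extension of a field, the inverse of an element is a polynomial in it: solve the
  equation for its lowest coefficient that is not zero.\<close>

lemma inverse_modulo:
  assumes A: "cring A" and h: "h \<in> ring_hom A B" and P: "primeideal P B"
    and alg: "residually_algebraic A B h P" and b: "b \<in> carrier B" "b \<notin> P"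
  obtains b' t where "b' \<in> carrier B" "t \<in> carrier A" "h t \<notin> P" "b \<otimes>\<^bsub>B\<^esub> b' \<oplus>\<^bsub>B\<^esub> h t \<in> P"
proof -
  note PD = prime_idealD[OF P]
  interpret h: ring_hom_cring A B h by (rule ring_hom_cringI[OF A PD(1) h])
  obtain cs where "set cs \<subseteq> carrier A" "horner B h b cs \<in> P" "\<exists>c\<in>set cs. h c \<notin> P"
    using alg b unfolding residually_algebraic_def by meson
  then have "\<exists>b' t. b' \<in> carrier B \<and> t \<in> carrier A \<and> h t \<notin> P \<and> b \<otimes>\<^bsub>B\<^esub> b' \<oplus>\<^bsub>B\<^esub> h t \<in> P"
  proof (induction cs)
    case (Cons c cs)
    have cl: "horner B h b cs \<in> carrier B" "h c \<in> carrier B" "c \<in> carrier A"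
      using horner_closed[OF PD(1) _ b(1), of h cs] Cons.prems(1) by auto
    show ?case
    proof (cases "h c \<in> P")
      case False
      then show ?thesis using Cons.prems cl b by (metis horner.simps(2) h.S.a_comm h.S.m_closed)
    next
      case True
      have "\<ominus>\<^bsub>B\<^esub> h c \<oplus>\<^bsub>B\<^esub> (h c \<oplus>\<^bsub>B\<^esub> b \<otimes>\<^bsub>B\<^esub> horner B h b cs) \<in> P"
        using Cons.prems(2) PD(6,7) True by simp
      then have "b \<otimes>\<^bsub>B\<^esub> horner B h b cs \<in> P"
        using cl b by (simp add: h.S.r_neg1)
      then have "horner B h b cs \<in> P" using PD(10) b cl by blast
      then show ?thesis using Cons True by auto
    qed
  qed simp
  with that show thesis by blast
qed

lemma ideal_finsum:
  fixes R (structure)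
  assumes I: "ideal I R" and f: "\<And>i. i \<in> S \<Longrightarrow> f i \<in> I"
  shows "finsum R f S \<in> I"
proof -
  interpret ideal I R by (rule I)
  show ?thesis
  proof (cases "finite S")
    case True
    then show ?thesis using f
    proof (induction S)
      case (insert i S)
      then have "finsum R f (insert i S) = f i \<oplus> finsum R f S"
        by (intro finsum_insert) auto
      with insert show ?case by simp
    qed simp
  qed simp
qed

text \<open>Modulo \<open>q\<close> only the term with index \<open>d\<close> survives.\<close>

lemma finsum_notin_ideal:
  fixes R (structure)
  assumes q: "ideal q R" and f: "\<And>i. i \<in> S \<Longrightarrow> f i \<in> carrier R"
    and S: "finite S" "d \<in> S" and d: "f d \<notin> q" and rest: "\<And>i. \<lbrakk>i \<in> S; i \<noteq> d\<rbrakk> \<Longrightarrow> f i \<in> q"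
  shows "finsum R f S \<notin> q"
proof
  interpret ideal q R by (rule q)
  assume sum: "finsum R f S \<in> q"
  let ?r = "finsum R f (S - {d})"
  have r: "?r \<in> q" by (rule ideal_finsum[OF q]) (use rest in auto)
  have "finsum R f (insert d (S - {d})) = f d \<oplus> ?r"
    using S f by (intro finsum_insert) auto
  then have "f d \<oplus> ?r \<in> q" using sum S(2) by (simp add: insert_absorb)
  then have "f d \<oplus> ?r \<oplus> \<ominus> ?r \<in> q" using r by simp
  moreover have "f d \<oplus> ?r \<oplus> \<ominus> ?r = f d" using f[OF S(2)] Icarr[OF r] by (simp add: a_assoc r_neg)
  ultimately show False using d by simp
qed

context UP_cring
begin

abbreviation const :: "'a \<Rightarrow> nat \<Rightarrow> 'a" where
  "const a \<equiv> up_ring.monom P a 0"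

lemma const_hom: "const \<in> ring_hom R P"
  by (rule ring_hom_memI) (simp_all add: monom_mult[of _ _ 0 0, simplified])

lemma coeff_horner:
  assumes "set cs \<subseteq> carrier R"
  shows "up_ring.coeff P (horner P const (up_ring.monom P \<one> 1) cs) i = (if i < length cs then cs ! i else \<zero>)"
  using assms
proof (induction cs arbitrary: i)
  case (Cons c cs)
  let ?f = "horner P const (up_ring.monom P \<one> 1) cs"
  have f: "?f \<in> carrier P" by (rule horner_closed) (use Cons.prems UP_cring in auto)
  have X: "up_ring.coeff P (up_ring.monom P \<one> 1 \<otimes>\<^bsub>P\<^esub> ?f) i = (if i = 0 then \<zero> else up_ring.coeff P ?f (i - 1))"
  proof (cases i)
    case 0
    then show ?thesis using coeff_mult[of "up_ring.monom P \<one> 1" ?f 0] f by simp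
  next
    case (Suc j)
    then show ?thesis using coeff_monom_mult[OF R.one_closed f, of 1 j] f by simp
  qed
  have "up_ring.coeff P (horner P const (up_ring.monom P \<one> 1) (c # cs)) i
      = up_ring.coeff P (const c) i \<oplus> up_ring.coeff P (up_ring.monom P \<one> 1 \<otimes>\<^bsub>P\<^esub> ?f) i"
    using Cons.prems f by (simp del: coeff_mult)
  also have "\<dots> = (if i = 0 then c else if i - 1 < length cs then cs ! (i - 1) else \<zero>)"
    unfolding X using Cons by (auto simp: nth_mem subset_iff)
  finally show ?case by (cases i) auto
qed simp

text \<open>Long division by a polynomial \<open>g \<in> N\<close> of least degree that does not vanish modulo \<open>p\<close> reduces
  membership in \<open>N\<close> to membership of coefficients in \<open>p\<close>. For \<open>q\<close> near \<open>p\<close> the polynomial \<open>g\<close> keeps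
  its degree modulo \<open>q\<close>, so that \<open>q\<close> and \<open>g\<close> generate an ideal lying over \<open>q\<close>. The condition
  \<open>b \<notin> Q\<close> is enforced by an inverse of \<open>b\<close> modulo \<open>N\<close>.\<close>

lemma constructibly_open_at_polynomial_ring:
  assumes N: "primeideal N P" and alg: "residually_algebraic R P const N"
  shows "constructibly_open_at R P const N"
  unfolding constructibly_open_at_def
proof (intro allI impI)
  fix G b assume G: "finite G \<and> G \<subseteq> N \<and> b \<in> carrier P - N"
  note ND = prime_idealD[OF N]
  interpret P: cring P by (rule UP_cring)
  define p where "p = comap R const N"
  have pr: "primeideal p R"
    unfolding p_def by (rule primeideal_comap[OF R.cring_axioms const_hom N])
  note pD = prime_idealD[OF pr]
  have p_iff: "const a \<in> N \<longleftrightarrow> a \<in> p" if "a \<in> carrier R" for a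
    using that by (simp add: p_def comap_def)
  \<comment> \<open>the elements of \<open>N\<close> that are not zero modulo \<open>p\<close>\<close>
  define D where "D = {g \<in> N. \<exists>i. up_ring.coeff P g i \<notin> p}"
  have "\<exists>g. g \<in> D"
  proof -
    obtain cs where cs: "set cs \<subseteq> carrier R" "horner P const (up_ring.monom P \<one> 1) cs \<in> N"
      and c: "\<exists>c\<in>set cs. const c \<notin> N"
      using alg unfolding residually_algebraic_def by (metis R.one_closed monom_closed)
    obtain i where i: "i < length cs" "const (cs ! i) \<notin> N" using c by (auto simp: in_set_conv_nth)
    then have "up_ring.coeff P (horner P const (up_ring.monom P \<one> 1) cs) i \<notin> p"
      using coeff_horner[OF cs(1), of i] p_iff[of "cs ! i"] cs(1) by (simp add: nth_mem subset_iff)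
    then show ?thesis using cs(2) unfolding D_def by blast
  qed
  then obtain g where gD: "g \<in> D" and g_min: "\<And>f. f \<in> D \<Longrightarrow> deg R g \<le> deg R f"
    using ex_has_least_nat[of "\<lambda>g. g \<in> D" _ "deg R"] by meson
  then have gN: "g \<in> N" by (simp add: D_def)
  then have g: "g \<in> carrier P" using ND(3) by blast
  let ?d = "deg R g" and ?l = "up_ring.coeff P g (deg R g)"
  have l: "?l \<in> carrier R" using g by simp
  have small: "up_ring.coeff P r i \<in> p" if "r \<in> N" "r = \<zero>\<^bsub>P\<^esub> \<or> deg R r < ?d" for r i
  proof (cases "r = \<zero>\<^bsub>P\<^esub>")
    case True
    then show ?thesis using pD(4) by simp
  next
    case False
    then show ?thesis using that g_min[of r] by (auto simp: D_def)
  qed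
  obtain i where i: "up_ring.coeff P g i \<notin> p" using gD by (auto simp: D_def)
  have l_p: "?l \<notin> p"
  proof
    assume lp: "?l \<in> p"
    let ?f = "g \<oplus>\<^bsub>P\<^esub> \<ominus>\<^bsub>P\<^esub> up_ring.monom P ?l ?d"
    have m: "up_ring.monom P ?l ?d \<in> carrier P" using l by simp
    have "up_ring.monom P ?l ?d = const ?l \<otimes>\<^bsub>P\<^esub> up_ring.monom P \<one> ?d"
      using monom_mult[of ?l \<one> 0 ?d] l by simp
    then have "up_ring.monom P ?l ?d \<in> N" using ND(8) p_iff[OF l] lp by simp
    then have fN: "?f \<in> N" using gN ND(6,7) by blast
    have fc: "up_ring.coeff P ?f n = (if n = ?d then \<zero> else up_ring.coeff P g n)" for n
      using g m l by (simp add: R.r_neg)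
    have id: "i \<noteq> ?d" using i lp by blast
    have "up_ring.coeff P g i \<noteq> \<zero>" using i pD(4) by metis
    then have "i \<le> ?d" using deg_aboveD[OF _ g] by (meson not_le)
    then have "i < ?d" using id by simp
    have "deg R ?f \<le> ?d - 1"
      by (rule deg_aboveI) (use fc deg_aboveD[OF _ g] g m in \<open>auto simp del: coeff_add\<close>)
    then have "deg R ?f < ?d" using \<open>i < ?d\<close> by linarith
    moreover have "up_ring.coeff P ?f i \<notin> p" unfolding fc using i id by simp
    then have "?f \<in> D" using fN unfolding D_def by blast
    ultimately show False using g_min[of ?f] by linarith
  qed
  have d_pos: "?d > 0"
  proof (rule ccontr)
    assume "\<not> ?thesis"
    then have "g = const ?l" using deg_zero_impl_monom[OF g] by simp
    then show False using p_iff[OF l] l_p gN by simp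
  qed
  obtain b' t where b': "b' \<in> carrier P" and t: "t \<in> carrier R" "const t \<notin> N"
    and bt: "b \<otimes>\<^bsub>P\<^esub> b' \<oplus>\<^bsub>P\<^esub> const t \<in> N"
    using inverse_modulo[OF R.cring_axioms const_hom N alg] G by blast
  \<comment> \<open>the last element forces \<open>b \<notin> Q\<close> as soon as \<open>t \<notin> q\<close>\<close>
  define G' where "G' = insert (b \<otimes>\<^bsub>P\<^esub> b' \<oplus>\<^bsub>P\<^esub> const t) G"
  have G'N: "finite G'" "G' \<subseteq> N" using G bt by (auto simp: G'_def)
  have "\<exists>r k w. r \<in> carrier P \<and> w \<in> carrier P \<and> (\<forall>i. up_ring.coeff P r i \<in> p) \<and>
      const (?l [^] (k::nat)) \<otimes>\<^bsub>P\<^esub> c = g \<otimes>\<^bsub>P\<^esub> w \<oplus>\<^bsub>P\<^esub> r" if c: "c \<in> G'" for c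
  proof -
    have cN: "c \<in> N" "c \<in> carrier P" using c G'N(2) ND(3) by auto
    have "g \<noteq> \<zero>\<^bsub>P\<^esub>" using l_p pD(4) by auto
    then obtain w r k where w: "w \<in> carrier P" "r \<in> carrier P"
      and eq: "?l [^] (k::nat) \<odot>\<^bsub>P\<^esub> c = g \<otimes>\<^bsub>P\<^esub> w \<oplus>\<^bsub>P\<^esub> r" and r: "r = \<zero>\<^bsub>P\<^esub> \<or> deg R r < ?d"
      using long_div_theorem[OF g cN(2)] by blast
    have eq': "const (?l [^] k) \<otimes>\<^bsub>P\<^esub> c = g \<otimes>\<^bsub>P\<^esub> w \<oplus>\<^bsub>P\<^esub> r"
      using eq cN(2) l by (simp add: monom_mult_is_smult)
    have gw: "g \<otimes>\<^bsub>P\<^esub> w \<in> N" "g \<otimes>\<^bsub>P\<^esub> w \<in> carrier P" using gN w(1) ND(8) g by auto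
    have "\<ominus>\<^bsub>P\<^esub> (g \<otimes>\<^bsub>P\<^esub> w) \<oplus>\<^bsub>P\<^esub> (g \<otimes>\<^bsub>P\<^esub> w \<oplus>\<^bsub>P\<^esub> r) \<in> N"
      using ND(6,7,9) gw cN(1) l unfolding eq'[symmetric] by simp
    then have "r \<in> N" using gw(2) w(2) by (simp add: P.r_neg1)
    then have "\<forall>i. up_ring.coeff P r i \<in> p" using small r by blast
    then show ?thesis using w eq' by blast
  qed
  then obtain r k w where r: "\<And>c. c \<in> G' \<Longrightarrow> r c \<in> carrier P" "\<And>c i. c \<in> G' \<Longrightarrow> up_ring.coeff P (r c) i \<in> p"
    and w: "\<And>c. c \<in> G' \<Longrightarrow> w c \<in> carrier P"
    and div: "\<And>c. c \<in> G' \<Longrightarrow> const (?l [^] (k c::nat)) \<otimes>\<^bsub>P\<^esub> c = g \<otimes>\<^bsub>P\<^esub> w c \<oplus>\<^bsub>P\<^esub> r c"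
    by metis
  define F where "F = (\<Union>c\<in>G'. up_ring.coeff P (r c) ` {..deg R (r c)})"
  show "\<exists>F s. finite F \<and> F \<subseteq> comap R const N \<and> s \<in> carrier R - comap R const N \<and>
     (\<forall>q. primeideal q R \<and> F \<subseteq> q \<and> s \<notin> q \<longrightarrow>
        (\<exists>Q. primeideal Q P \<and> G \<subseteq> Q \<and> b \<notin> Q \<and> comap R const Q = q))"
    unfolding p_def[symmetric]
  proof (rule exI[of _ F], rule exI[of _ "?l \<otimes> t"], intro conjI allI impI)
    show "finite F" unfolding F_def using G'N(1) by blast
    show "F \<subseteq> p" unfolding F_def using r(2) by blast
    show "?l \<otimes> t \<in> carrier R - p" using l l_p t p_iff[of t] pD(10) by simp
    fix q assume q: "primeideal q R \<and> F \<subseteq> q \<and> ?l \<otimes> t \<notin> q"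
    then have qp: "primeideal q R" and Fq: "F \<subseteq> q" by simp_all
    note qD = prime_idealD[OF qp]
    have lt: "?l \<notin> q" "t \<notin> q" using q qD(8,9) l t by blast+
    have rq: "up_ring.coeff P (r c) i \<in> q" if c: "c \<in> G'" for c i
    proof (cases "i \<le> deg R (r c)")
      case True
      then show ?thesis using Fq c by (auto simp: F_def)
    next
      case False
      then show ?thesis using deg_aboveD[OF _ r(1)[OF c]] qD(4) by simp
    qed
    \<comment> \<open>the ideal generated by \<open>q\<close> and \<open>g\<close>\<close>
    define J where "J = {g \<otimes>\<^bsub>P\<^esub> v \<oplus>\<^bsub>P\<^esub> z | v z. v \<in> carrier P \<and> z \<in> carrier P \<and> (\<forall>i. up_ring.coeff P z i \<in> q)}"
    have JI: "g \<otimes>\<^bsub>P\<^esub> v \<oplus>\<^bsub>P\<^esub> z \<in> J"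
      if "v \<in> carrier P" "z \<in> carrier P" "\<And>i. up_ring.coeff P z i \<in> q" for v z
      using that unfolding J_def by blast
    have J_ideal: "ideal J P"
    proof (rule P.ideal_criterion)
      show "J \<subseteq> carrier P"
      proof
        fix x assume "x \<in> J"
        then obtain v z where "x = g \<otimes>\<^bsub>P\<^esub> v \<oplus>\<^bsub>P\<^esub> z" "v \<in> carrier P" "z \<in> carrier P"
          unfolding J_def by blast
        then show "x \<in> carrier P" using g by simp
      qed
      have "g \<otimes>\<^bsub>P\<^esub> \<zero>\<^bsub>P\<^esub> \<oplus>\<^bsub>P\<^esub> \<zero>\<^bsub>P\<^esub> \<in> J" by (rule JI) (simp_all add: qD(4))
      then show "\<zero>\<^bsub>P\<^esub> \<in> J" using g by simp
      show "a \<otimes>\<^bsub>P\<^esub> x \<in> J" if "a \<in> carrier P" "x \<in> J" for a x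
      proof -
        obtain v z where v: "x = g \<otimes>\<^bsub>P\<^esub> v \<oplus>\<^bsub>P\<^esub> z" "v \<in> carrier P" "z \<in> carrier P"
            "\<forall>i. up_ring.coeff P z i \<in> q"
          using \<open>x \<in> J\<close> unfolding J_def by blast
        have "a \<otimes>\<^bsub>P\<^esub> x = g \<otimes>\<^bsub>P\<^esub> (a \<otimes>\<^bsub>P\<^esub> v) \<oplus>\<^bsub>P\<^esub> a \<otimes>\<^bsub>P\<^esub> z"
          using v that g by (simp add: P.r_distr P.m_lcomm)
        moreover have "up_ring.coeff P (a \<otimes>\<^bsub>P\<^esub> z) n \<in> q" for n
          unfolding coeff_mult[OF that(1) v(3)]
          by (rule ideal_finsum[OF qD(2)]) (use v that qD(9) in auto)
        ultimately show ?thesis using JI v that by simp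
      qed
      show "x \<oplus>\<^bsub>P\<^esub> y \<in> J" if "x \<in> J" "y \<in> J" for x y
      proof -
        obtain v z where v: "x = g \<otimes>\<^bsub>P\<^esub> v \<oplus>\<^bsub>P\<^esub> z" "v \<in> carrier P" "z \<in> carrier P"
            "\<forall>i. up_ring.coeff P z i \<in> q"
          using \<open>x \<in> J\<close> unfolding J_def by blast
        obtain v' z' where v': "y = g \<otimes>\<^bsub>P\<^esub> v' \<oplus>\<^bsub>P\<^esub> z'" "v' \<in> carrier P" "z' \<in> carrier P"
            "\<forall>i. up_ring.coeff P z' i \<in> q"
          using \<open>y \<in> J\<close> unfolding J_def by blast
        have "x \<oplus>\<^bsub>P\<^esub> y = g \<otimes>\<^bsub>P\<^esub> (v \<oplus>\<^bsub>P\<^esub> v') \<oplus>\<^bsub>P\<^esub> (z \<oplus>\<^bsub>P\<^esub> z')"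
          using v v' g by (simp add: P.r_distr P.a_ac)
        moreover have "up_ring.coeff P (z \<oplus>\<^bsub>P\<^esub> z') n \<in> q" for n
          using v v' qD(6) by simp
        ultimately show ?thesis using JI v v' by simp
      qed
    qed
    have J_disj: "const a \<notin> J" if a: "a \<in> carrier R" "a \<notin> q" for a
    proof
      assume "const a \<in> J"
      then obtain v z where v: "const a = g \<otimes>\<^bsub>P\<^esub> v \<oplus>\<^bsub>P\<^esub> z" "v \<in> carrier P" "z \<in> carrier P"
          "\<forall>i. up_ring.coeff P z i \<in> q" unfolding J_def by blast
      let ?gv = "g \<otimes>\<^bsub>P\<^esub> v"
      have gv: "?gv \<in> carrier P" using g v by simp
      have sum: "up_ring.coeff P (const a) n = up_ring.coeff P ?gv n \<oplus> up_ring.coeff P z n" for n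
        unfolding v(1) by (rule coeff_add[OF gv v(3)])
      show False
      proof (cases "\<exists>j. up_ring.coeff P v j \<notin> q")
        case False
        then have "up_ring.coeff P ?gv 0 \<in> q"
          unfolding coeff_mult[OF g v(2)] by (intro ideal_finsum[OF qD(2)]) (use g qD(9) in auto)
        then have "up_ring.coeff P ?gv 0 \<oplus> up_ring.coeff P z 0 \<in> q" using v(4) qD(6) by blast
        then show False using sum[of 0] a by simp
      next
        case True
        have bnd: "j \<le> deg R v" if "up_ring.coeff P v j \<notin> q" for j
          using that deg_aboveD[OF _ v(2)] qD(4) by (metis not_le)
        define j where "j = Max {j. up_ring.coeff P v j \<notin> q}"
        have fin: "finite {j. up_ring.coeff P v j \<notin> q}"
          by (rule finite_subset[of _ "{..deg R v}"]) (use bnd in auto)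
        have j: "up_ring.coeff P v j \<notin> q" using Max_in[OF fin] True unfolding j_def by blast
        have j_max: "up_ring.coeff P v i \<in> q" if "i > j" for i
          using Max_ge[OF fin, of i] that unfolding j_def[symmetric] by fastforce
        \<comment> \<open>modulo \<open>q\<close> this coefficient is the product of the leading ones of \<open>g\<close> and \<open>v\<close>\<close>
        have "up_ring.coeff P ?gv (?d + j) \<notin> q"
          unfolding coeff_mult[OF g v(2)]
        proof (rule finsum_notin_ideal[OF qD(2), where d = ?d])
          show "up_ring.coeff P g ?d \<otimes> up_ring.coeff P v (?d + j - ?d) \<notin> q"
            using j lt(1) qD(10) l v(2) by simp
          show "up_ring.coeff P g i \<otimes> up_ring.coeff P v (?d + j - i) \<in> q" if "i \<in> {..?d + j}" "i \<noteq> ?d" for i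
          proof (cases "i < ?d")
            case True
            then have "up_ring.coeff P v (?d + j - i) \<in> q" by (intro j_max) linarith
            then show ?thesis using qD(9) g by simp
          next
            case False
            then have "up_ring.coeff P g i = \<zero>" using that(2) deg_aboveD[OF _ g, of i] by simp
            then show ?thesis using v(2) qD(4) by simp
          qed
        qed (use g v in auto)
        moreover have "up_ring.coeff P ?gv (?d + j) \<oplus> up_ring.coeff P z (?d + j) = \<zero>"
          using sum[of "?d + j"] a(1) d_pos by simp
        then have "up_ring.coeff P ?gv (?d + j) = \<ominus> up_ring.coeff P z (?d + j)"
          by (intro R.minus_equality[symmetric] coeff_closed gv v(3))
        ultimately show False using v(4) qD(7) by simp
      qed
    qed
    define M where "M = const ` (carrier R - q)"
    obtain Q where Q: "primeideal Q P" "J \<subseteq> Q" "Q \<inter> M = {}"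
    proof (rule P.prime_ideal_avoiding[OF J_ideal, of M])
      show "M \<subseteq> carrier P" by (auto simp: M_def)
      show "\<one>\<^bsub>P\<^esub> \<in> M" unfolding M_def using qD(5) by (intro image_eqI[of _ _ \<one>]) auto
      show "x \<otimes>\<^bsub>P\<^esub> y \<in> M" if xy: "x \<in> M" "y \<in> M" for x y
      proof -
        obtain a c where ac: "x = const a" "y = const c" "a \<in> carrier R - q" "c \<in> carrier R - q"
          using xy unfolding M_def by blast
        then have "x \<otimes>\<^bsub>P\<^esub> y = const (a \<otimes> c)" using ring_hom_mult[OF const_hom] by simp
        moreover have "a \<otimes> c \<in> carrier R - q" using ac qD(10) by simp
        ultimately show ?thesis unfolding M_def by blast
      qed
      show "J \<inter> M = {}" using J_disj by (auto simp: M_def)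
    qed
    note QD = prime_idealD[OF Q(1)]
    have Q_iff: "const a \<in> Q \<longleftrightarrow> a \<in> q" if a: "a \<in> carrier R" for a
    proof
      assume "const a \<in> Q"
      then show "a \<in> q" using Q(3) a by (auto simp: M_def)
    next
      assume "a \<in> q"
      then have "g \<otimes>\<^bsub>P\<^esub> \<zero>\<^bsub>P\<^esub> \<oplus>\<^bsub>P\<^esub> const a \<in> J" using a qD(4) by (intro JI) auto
      then show "const a \<in> Q" using g a Q(2) by auto
    qed
    have G'Q: "c \<in> Q" if c: "c \<in> G'" for c
    proof -
      have cc: "c \<in> carrier P" using c G'N(2) ND(3) by blast
      have "const (?l [^] k c) \<otimes>\<^bsub>P\<^esub> c \<in> Q"
        unfolding div[OF c] using JI[OF w[OF c] r(1)[OF c] rq[OF c]] Q(2) by blast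
      moreover have "?l [^] n \<notin> q" for n :: nat
        by (induction n) (use qD(5,10) lt l in auto)
      then have "const (?l [^] k c) \<notin> Q" using Q_iff l by simp
      ultimately show ?thesis using QD(10) cc l by simp
    qed
    have "b \<notin> Q"
    proof
      assume b: "b \<in> Q"
      have cl: "b \<in> carrier P" "const t \<in> carrier P" using G t by auto
      have "b \<otimes>\<^bsub>P\<^esub> b' \<oplus>\<^bsub>P\<^esub> const t \<in> Q" using G'Q by (simp add: G'_def)
      then have "\<ominus>\<^bsub>P\<^esub> (b \<otimes>\<^bsub>P\<^esub> b') \<oplus>\<^bsub>P\<^esub> (b \<otimes>\<^bsub>P\<^esub> b' \<oplus>\<^bsub>P\<^esub> const t) \<in> Q"
        using b b' QD(6-8) by blast
      then have "const t \<in> Q" using cl b' by (simp add: P.r_neg1)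
      then show False using Q_iff[OF t(1)] lt(2) by simp
    qed
    moreover have "G \<subseteq> Q" using G'Q by (auto simp: G'_def)
    moreover have "comap R const Q = q" using Q_iff qD(3) by (auto simp: comap_def)
    ultimately show "\<exists>Q. primeideal Q P \<and> G \<subseteq> Q \<and> b \<notin> Q \<and> comap R const Q = q"
      using Q(1) by (intro exI[of _ Q]) simp
  qed
qed

end

section \<open>Polynomial rings in several variables\<close>

lemma finite_submultisets: "finite {k. k \<subseteq># (m :: 'c multiset)}"
proof (induction m)
  case (add x m)
  have "k \<in> {k. k \<subseteq># m} \<union> add_mset x ` {k. k \<subseteq># m}" if k: "k \<subseteq># add_mset x m" for k
  proof (cases "x \<in># k")
    case True
    then obtain l where l: "k = add_mset x l" by (metis insert_DiffM)
    then have "l \<subseteq># m" using k by (metis mset_subset_eq_add_mset_cancel)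
    then show ?thesis using l by blast
  next
    case False
    have "k \<subseteq># m"
    proof (rule mset_subset_eqI)
      show "count k a \<le> count m a" for a
        using mset_subset_eq_count[OF k, of a] False by (cases "a = x") (auto simp: not_in_iff)
    qed
    then show ?thesis by simp
  qed
  then have "{k. k \<subseteq># add_mset x m} \<subseteq> {k. k \<subseteq># m} \<union> add_mset x ` {k. k \<subseteq># m}" by blast
  then show ?case using add finite_subset by auto
qed simp

context cring
begin

lemma finsum_Sigma:
  assumes "finite A" "\<And>a. a \<in> A \<Longrightarrow> finite (B a)"
    and "\<And>a b. \<lbrakk>a \<in> A; b \<in> B a\<rbrakk> \<Longrightarrow> f a b \<in> carrier R"
  shows "(\<Oplus>a\<in>A. \<Oplus>b\<in>B a. f a b) = (\<Oplus>z\<in>Sigma A B. f (fst z) (snd z))"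
  using assms
proof (induction A)
  case (insert a A)
  have eq: "Sigma (insert a A) B = Pair a ` B a \<union> Sigma A B" by auto
  have "(\<Oplus>z\<in>Pair a ` B a. f (fst z) (snd z)) = (\<Oplus>b\<in>B a. f a b)"
    using insert.prems by (subst add.finprod_reindex) (auto simp: inj_on_def)
  moreover have "(\<Oplus>z\<in>Pair a ` B a \<union> Sigma A B. f (fst z) (snd z))
      = (\<Oplus>z\<in>Pair a ` B a. f (fst z) (snd z)) \<oplus> (\<Oplus>z\<in>Sigma A B. f (fst z) (snd z))"
    using insert by (intro finsum_Un_disjoint) auto
  moreover have "(\<Oplus>a\<in>insert a A. \<Oplus>b\<in>B a. f a b) = (\<Oplus>b\<in>B a. f a b) \<oplus> (\<Oplus>a\<in>A. \<Oplus>b\<in>B a. f a b)"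
    using insert by (intro finsum_insert) auto
  ultimately show ?case using insert unfolding eq by simp
qed simp

text \<open>The Cauchy product of formal power series, a multiset of variables being a monomial. It is the
  multiplication of \<open>mpoly_ring\<close>.\<close>

definition conv :: "('c multiset \<Rightarrow> 'a) \<Rightarrow> ('c multiset \<Rightarrow> 'a) \<Rightarrow> 'c multiset \<Rightarrow> 'a" where
  "conv P Q m = (\<Oplus>k\<in>{k. k \<subseteq># m}. P k \<otimes> Q (m - k))"

lemma conv_carrier_coeff:
  assumes "carrier_coeff P" "carrier_coeff Q"
  shows "carrier_coeff (conv P Q)"
  using assms unfolding carrier_coeff_def conv_def by (auto intro!: finsum_closed)

lemma conv_comm:
  fixes P Q :: "'c multiset \<Rightarrow> 'a"
  assumes "carrier_coeff P" "carrier_coeff Q"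
  shows "conv P Q = conv Q P"
proof
  fix m :: "'c multiset"
  let ?S = "{k. k \<subseteq># m}"
  have dd: "m - (m - k) = k" if "k \<subseteq># m" for k
    using that by (simp add: multiset_eq_iff subseteq_mset_def)
  have img: "(\<lambda>k. m - k) ` ?S = ?S"
  proof (intro equalityI subsetI)
    fix k assume "k \<in> ?S"
    then have "k = m - (m - k)" "m - k \<in> ?S" by (auto simp: dd)
    then show "k \<in> (\<lambda>k. m - k) ` ?S" by blast
  qed auto
  have inj: "inj_on (\<lambda>k. m - k) ?S"
    by (rule inj_onI) (metis mem_Collect_eq dd)
  have "conv P Q m = (\<Oplus>k\<in>(\<lambda>k. m - k) ` ?S. P k \<otimes> Q (m - k))"
    unfolding conv_def img ..
  also have "\<dots> = (\<Oplus>k\<in>?S. P (m - k) \<otimes> Q (m - (m - k)))"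
    using assms inj by (intro finsum_reindex) (auto simp: carrier_coeff_def)
  also have "\<dots> = (\<Oplus>k\<in>?S. Q k \<otimes> P (m - k))"
    using assms
    by (intro finsum_cong') (auto simp: carrier_coeff_def m_comm dd)
  finally show "conv P Q m = conv Q P m" unfolding conv_def .
qed

text \<open>Both sides are the sum over all decompositions of the monomial \<open>m\<close> into three factors.\<close>

lemma conv_assoc:
  fixes P Q S :: "'c multiset \<Rightarrow> 'a"
  assumes "carrier_coeff P" "carrier_coeff Q" "carrier_coeff S"
  shows "conv (conv P Q) S = conv P (conv Q S)"
proof
  fix m :: "'c multiset"
  have c: "P k \<in> carrier R" "Q k \<in> carrier R" "S k \<in> carrier R" for k
    using assms by (auto simp: carrier_coeff_def)
  let ?S = "\<lambda>m. {k. k \<subseteq># m}"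
  let ?f = "\<lambda>z. P (fst z) \<otimes> (Q (snd z) \<otimes> S (m - fst z - snd z))"
  let ?g = "\<lambda>z. (fst z + snd z, fst z)"
  have "conv (conv P Q) S m = (\<Oplus>k\<in>?S m. \<Oplus>l\<in>?S k. P l \<otimes> Q (k - l) \<otimes> S (m - k))"
    unfolding conv_def using c
    by (intro finsum_cong') (auto simp: finsum_ldistr[OF finite_submultisets])
  also have "\<dots> = (\<Oplus>z\<in>Sigma (?S m) ?S. P (snd z) \<otimes> Q (fst z - snd z) \<otimes> S (m - fst z))"
    by (rule finsum_Sigma) (auto simp: c finite_submultisets)
  also have "Sigma (?S m) ?S = ?g ` Sigma (?S m) (\<lambda>l. ?S (m - l))" (is "?L = ?R")
  proof
    show "?L \<subseteq> ?R"
    proof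
      fix z assume "z \<in> ?L"
      then obtain k l where z: "z = (k, l)" "k \<subseteq># m" "l \<subseteq># k" by blast
      then have "l \<subseteq># m" using subset_mset.order_trans by blast
      moreover have "z = ?g (l, k - l)" "k - l \<subseteq># m - l"
        using z by (auto simp: subseteq_mset_def diff_le_mono)
      ultimately have "(l, k - l) \<in> Sigma (?S m) (\<lambda>l. ?S (m - l))" "z = ?g (l, k - l)" by auto
      then show "z \<in> ?R" by blast
    qed
    show "?R \<subseteq> ?L"
      by (auto simp: subset_mset.le_diff_conv2 add.commute)
  qed
  also have "(\<Oplus>z\<in>?R. P (snd z) \<otimes> Q (fst z - snd z) \<otimes> S (m - fst z))
      = (\<Oplus>x\<in>Sigma (?S m) (\<lambda>l. ?S (m - l)). P (snd (?g x)) \<otimes> Q (fst (?g x) - snd (?g x)) \<otimes> S (m - fst (?g x)))"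
    by (rule finsum_reindex) (auto simp: c inj_on_def)
  also have "\<dots> = (\<Oplus>x\<in>Sigma (?S m) (\<lambda>l. ?S (m - l)). ?f x)"
    by (rule finsum_cong') (auto simp: c m_assoc)
  also have "\<dots> = (\<Oplus>l\<in>?S m. \<Oplus>k\<in>?S (m - l). P l \<otimes> (Q k \<otimes> S (m - l - k)))"
    by (rule finsum_Sigma[symmetric]) (auto simp: c finite_submultisets)
  also have "\<dots> = conv P (conv Q S) m"
    unfolding conv_def using c
    by (intro finsum_cong') (auto simp: finsum_rdistr[OF finite_submultisets])
  finally show "conv (conv P Q) S m = conv P (conv Q S) m" .
qed

text \<open>Multiplication by the single term with coefficient \<open>a\<close> and monomial \<open>s\<close>.\<close>

lemma conv_supported:
  assumes Q: "carrier_coeff Q" and a: "a \<in> carrier R"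
  shows "conv (\<lambda>k. if k = s then a else \<zero>) Q m = (if s \<subseteq># m then a \<otimes> Q (m - s) else \<zero>)"
proof -
  have c: "Q k \<in> carrier R" for k using Q by (simp add: carrier_coeff_def)
  have "conv (\<lambda>k. if k = s then a else \<zero>) Q m
      = (\<Oplus>k\<in>{k. k \<subseteq># m}. if k = s then a \<otimes> Q (m - k) else \<zero>)"
    unfolding conv_def by (rule finsum_cong') (auto simp: c a)
  also have "\<dots> = (if s \<subseteq># m then a \<otimes> Q (m - s) else \<zero>)"
  proof (cases "s \<subseteq># m")
    case True
    then show ?thesis
      using add.finprod_singleton_swap[of s "{k. k \<subseteq># m}" "\<lambda>k. a \<otimes> Q (m - k)"] c a
      by (simp add: finite_submultisets Pi_def)
  next
    case False
    then show ?thesis by (simp, intro add.finprod_one_eqI) auto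
  qed
  finally show ?thesis .
qed

lemma conv_const:
  assumes "carrier_coeff Q" "a \<in> carrier R"
  shows "conv (indexed_const a) Q = (\<lambda>m. a \<otimes> Q m)"
  using conv_supported[OF assms, of "{#}"] unfolding indexed_const_def by auto

lemma indexed_var_eq: "indexed_var i = (\<lambda>k. if k = {#i#} then \<one> else \<zero>)"
  unfolding indexed_var_def indexed_pmult_def indexed_const_def
  by (auto simp: fun_eq_iff) (metis add_mset_remove_trivial insert_DiffM)+

lemma carrier_coeff_var [simp]: "carrier_coeff (indexed_var i)"
  unfolding indexed_var_eq carrier_coeff_def by simp

lemma conv_var:
  assumes "carrier_coeff Q"
  shows "conv (indexed_var i) Q = indexed_pmult Q i"
  using conv_supported[OF assms one_closed, of "{#i#}"] assms
  unfolding indexed_var_eq indexed_pmult_def carrier_coeff_def by (auto simp: fun_eq_iff)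

lemma conv_add_left:
  assumes "carrier_coeff P" "carrier_coeff P'" "carrier_coeff Q"
  shows "conv (indexed_padd P P') Q = indexed_padd (conv P Q) (conv P' Q)"
proof
  fix m
  have c: "P k \<in> carrier R" "P' k \<in> carrier R" "Q k \<in> carrier R" for k
    using assms by (auto simp: carrier_coeff_def)
  have "conv (indexed_padd P P') Q m = (\<Oplus>k\<in>{k. k \<subseteq># m}. P k \<otimes> Q (m - k) \<oplus> P' k \<otimes> Q (m - k))"
    unfolding conv_def indexed_padd_def by (rule finsum_cong') (auto simp: c l_distr)
  also have "\<dots> = indexed_padd (conv P Q) (conv P' Q) m"
    unfolding conv_def indexed_padd_def by (rule finsum_addf) (auto simp: c)
  finally show "conv (indexed_padd P P') Q m = indexed_padd (conv P Q) (conv P' Q) m" .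
qed

end

text \<open>The constructions \<open>mpoly_ring\<close> and \<open>localization\<close> are made for rings without further record fields.\<close>

locale plain_cring = cring R for R :: "'a ring" (structure)
begin

lemma mpoly_ring_simps:
  "carrier (mpoly_ring R n) = indexed_pset {..<n} (carrier R)"
  "x \<otimes>\<^bsub>mpoly_ring R n\<^esub> y = conv x y"
  "x \<oplus>\<^bsub>mpoly_ring R n\<^esub> y = indexed_padd x y"
  "\<one>\<^bsub>mpoly_ring R n\<^esub> = indexed_const \<one>"
  "\<zero>\<^bsub>mpoly_ring R n\<^esub> = indexed_const \<zero>"
  by (simp_all add: mpoly_ring_def conv_def[abs_def])

lemma pset_carrier_coeff: "P \<in> indexed_pset I (carrier R) \<Longrightarrow> carrier_coeff P"
  using indexed_pset_in_carrier[of "carrier R"] by blast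

lemma pset_scale:
  assumes "a \<in> carrier R" "Q \<in> indexed_pset I (carrier R)"
  shows "(\<lambda>m. a \<otimes> Q m) \<in> indexed_pset I (carrier R)"
  using assms(2)
proof induction
  case (indexed_const k)
  have eq: "(\<lambda>m. a \<otimes> indexed_const k m) = indexed_const (a \<otimes> k)"
    using assms(1) by (auto simp: indexed_const_def)
  show ?case unfolding eq
    by (rule indexed_pset.indexed_const) (use indexed_const assms(1) in simp)
next
  case (indexed_padd P Q)
  have eq: "(\<lambda>m. a \<otimes> indexed_padd P Q m) = indexed_padd (\<lambda>m. a \<otimes> P m) (\<lambda>m. a \<otimes> Q m)"
    using assms(1) pset_carrier_coeff[OF indexed_padd.hyps(1)] pset_carrier_coeff[OF indexed_padd.hyps(2)]
    by (auto simp: indexed_padd_def r_distr carrier_coeff_def)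
  show ?case unfolding eq by (rule indexed_pset.indexed_padd[OF indexed_padd.IH])
next
  case (indexed_pmult P i)
  have eq: "(\<lambda>m. a \<otimes> indexed_pmult P i m) = indexed_pmult (\<lambda>m. a \<otimes> P m) i"
    using assms(1) by (auto simp: indexed_pmult_def)
  show ?case unfolding eq by (rule indexed_pset.indexed_pmult[OF indexed_pmult.IH indexed_pmult.hyps(2)])
qed

lemma pset_conv:
  assumes "P \<in> indexed_pset I (carrier R)" "Q \<in> indexed_pset I (carrier R)"
  shows "conv P Q \<in> indexed_pset I (carrier R)"
  using assms(1)
proof induction
  case (indexed_const k)
  then show ?case
    using pset_scale[OF _ assms(2)] conv_const[OF pset_carrier_coeff[OF assms(2)]] by simp
next
  case (indexed_padd P P')
  then show ?case
    using conv_add_left[OF pset_carrier_coeff[OF indexed_padd.hyps(1)]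
        pset_carrier_coeff[OF indexed_padd.hyps(2)] pset_carrier_coeff[OF assms(2)]]
    by (simp add: indexed_pset.indexed_padd)
next
  case (indexed_pmult P i)
  note cP = pset_carrier_coeff[OF indexed_pmult.hyps(1)] and cQ = pset_carrier_coeff[OF assms(2)]
  have "conv (indexed_pmult P i) Q = indexed_pmult (conv P Q) i"
    using conv_assoc[OF carrier_coeff_var cP cQ, of i] conv_var[OF cP]
      conv_var[OF conv_carrier_coeff[OF cP cQ]] by metis
  then show ?case using indexed_pmult by (simp add: indexed_pset.indexed_pmult)
qed

lemma mpoly_cring: "cring (mpoly_ring R n)"
proof (rule cringI)
  let ?M = "mpoly_ring R n"
  note cc = pset_carrier_coeff
  show "abelian_group ?M"
  proof (rule abelian_groupI, unfold mpoly_ring_simps)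
    fix x y z assume x: "x \<in> indexed_pset {..<n} (carrier R)"
    show "indexed_padd (indexed_const \<zero>) x = x"
      using cc[OF x] by (simp add: indexed_padd_zero)
    show "\<exists>y\<in>indexed_pset {..<n} (carrier R). indexed_padd y x = indexed_const \<zero>"
    proof
      show "(\<lambda>m. \<ominus> \<one> \<otimes> x m) \<in> indexed_pset {..<n} (carrier R)" by (rule pset_scale[OF _ x]) simp
      show "indexed_padd (\<lambda>m. \<ominus> \<one> \<otimes> x m) x = indexed_const \<zero>"
        using cc[OF x] by (auto simp: indexed_padd_def indexed_const_def carrier_coeff_def l_minus l_neg)
    qed
    assume y: "y \<in> indexed_pset {..<n} (carrier R)"
    show "indexed_padd x y \<in> indexed_pset {..<n} (carrier R)"
      by (rule indexed_pset.indexed_padd[OF x y])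
    show "indexed_padd x y = indexed_padd y x"
      using cc[OF x] cc[OF y] by (auto simp: indexed_padd_def carrier_coeff_def a_comm)
    assume z: "z \<in> indexed_pset {..<n} (carrier R)"
    show "indexed_padd (indexed_padd x y) z = indexed_padd x (indexed_padd y z)"
      using cc[OF x] cc[OF y] cc[OF z] by (auto simp: indexed_padd_def carrier_coeff_def a_assoc)
  qed (simp add: indexed_pset.indexed_const)
  show "comm_monoid ?M"
  proof (rule comm_monoidI, unfold mpoly_ring_simps)
    fix x y z assume x: "x \<in> indexed_pset {..<n} (carrier R)"
    show "conv (indexed_const \<one>) x = x"
      using cc[OF x] conv_const[OF cc[OF x] one_closed] by (auto simp: carrier_coeff_def)
    assume y: "y \<in> indexed_pset {..<n} (carrier R)"
    show "conv x y \<in> indexed_pset {..<n} (carrier R)" by (rule pset_conv[OF x y])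
    show "conv x y = conv y x" by (rule conv_comm[OF cc[OF x] cc[OF y]])
    assume z: "z \<in> indexed_pset {..<n} (carrier R)"
    show "conv (conv x y) z = conv x (conv y z)"
      by (rule conv_assoc[OF cc[OF x] cc[OF y] cc[OF z]])
  qed (simp add: indexed_pset.indexed_const)
  show "(x \<oplus>\<^bsub>?M\<^esub> y) \<otimes>\<^bsub>?M\<^esub> z = x \<otimes>\<^bsub>?M\<^esub> z \<oplus>\<^bsub>?M\<^esub> y \<otimes>\<^bsub>?M\<^esub> z"
    if "x \<in> carrier ?M" "y \<in> carrier ?M" "z \<in> carrier ?M" for x y z
    using that cc conv_add_left unfolding mpoly_ring_simps by meson
qed

lemma mpoly_const_closed: "a \<in> carrier R \<Longrightarrow> indexed_const a \<in> carrier (mpoly_ring R n)"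
  unfolding mpoly_ring_simps by (rule indexed_pset.indexed_const)

lemma mpoly_const_hom: "indexed_const \<in> ring_hom R (mpoly_ring R n)"
proof (rule ring_hom_memI)
  fix x y assume xy: "x \<in> carrier R" "y \<in> carrier R"
  show "indexed_const x \<in> carrier (mpoly_ring R n)" by (rule mpoly_const_closed[OF xy(1)])
  have "carrier_coeff (indexed_const y)" using xy by (simp add: carrier_coeff_def indexed_const_def)
  note eq = conv_const[OF this xy(1)]
  show "indexed_const (x \<otimes> y) = indexed_const x \<otimes>\<^bsub>mpoly_ring R n\<^esub> indexed_const y"
    unfolding mpoly_ring_simps eq using xy by (auto simp: indexed_const_def)
qed (simp_all add: mpoly_ring_simps indexed_padd_const)

lemma mpoly_var_closed: "i < n \<Longrightarrow> indexed_var i \<in> carrier (mpoly_ring R n)"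
  unfolding mpoly_ring_simps indexed_var_def
  by (intro indexed_pset.indexed_pmult indexed_pset.indexed_const) auto

text \<open>The variables generate the polynomial ring as an algebra.\<close>

lemma mpoly_induct [consumes 1, case_names const var add mult]:
  assumes "f \<in> carrier (mpoly_ring R n)"
    and "\<And>a. a \<in> carrier R \<Longrightarrow> Z (indexed_const a)" "\<And>i. i < n \<Longrightarrow> Z (indexed_var i)"
    and add: "\<And>f g. \<lbrakk>f \<in> carrier (mpoly_ring R n); g \<in> carrier (mpoly_ring R n); Z f; Z g\<rbrakk>
      \<Longrightarrow> Z (f \<oplus>\<^bsub>mpoly_ring R n\<^esub> g)"
    and mult: "\<And>f g. \<lbrakk>f \<in> carrier (mpoly_ring R n); g \<in> carrier (mpoly_ring R n); Z f; Z g\<rbrakk>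
      \<Longrightarrow> Z (f \<otimes>\<^bsub>mpoly_ring R n\<^esub> g)"
  shows "Z f"
proof -
  have "f \<in> indexed_pset {..<n} (carrier R)" using assms(1) by (simp add: mpoly_ring_simps)
  then show ?thesis
  proof induction
    case (indexed_const k)
    then show ?case by (rule assms(2))
  next
    case (indexed_padd P Q)
    then show ?case using add[of P Q] by (simp add: mpoly_ring_simps)
  next
    case (indexed_pmult P i)
    have "Z (indexed_var i \<otimes>\<^bsub>mpoly_ring R n\<^esub> P)"
      using indexed_pmult assms(3) mpoly_var_closed by (intro mult) (auto simp: mpoly_ring_simps)
    then show ?case
      using conv_var[OF pset_carrier_coeff[OF indexed_pmult.hyps(1)]] by (simp add: mpoly_ring_simps)
  qed
qed

lemma pset_index_free:
  assumes "P \<in> indexed_pset I (carrier R)" "i \<notin> I"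
  shows "index_free P i"
  using assms
proof induction
  case (indexed_const k) then show ?case by (simp add: indexed_const_index_free)
next
  case (indexed_padd P Q) then show ?case by (simp add: indexed_padd_index_free)
next
  case (indexed_pmult P j) then show ?case by (intro indexed_pmult_index_free) auto
qed

lemma pset_mono: "I \<subseteq> J \<Longrightarrow> indexed_pset I (carrier R) \<subseteq> indexed_pset J (carrier R)"
proof
  fix P assume "I \<subseteq> J" "P \<in> indexed_pset I (carrier R)"
  from this(2,1) show "P \<in> indexed_pset J (carrier R)"
    by induction (auto intro: indexed_pset.intros)
qed

lemma mpoly_inclusion_hom: "id \<in> ring_hom (mpoly_ring R n) (mpoly_ring R (Suc n))"
proof (rule ring_hom_memI)
  have "{..<n} \<subseteq> {..<Suc n}" by auto
  from pset_mono[OF this]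
  show "\<And>x. x \<in> carrier (mpoly_ring R n) \<Longrightarrow> id x \<in> carrier (mpoly_ring R (Suc n))"
    unfolding mpoly_ring_simps by auto
qed (simp_all add: mpoly_ring_simps)

lemma mpoly_finsum_apply:
  assumes "finite S" "\<And>i. i \<in> S \<Longrightarrow> f i \<in> carrier (mpoly_ring R n)"
  shows "finsum (mpoly_ring R n) f S m = (\<Oplus>i\<in>S. f i m)"
  using assms
proof (induction S)
  case empty
  interpret M: cring "mpoly_ring R n" by (rule mpoly_cring)
  show ?case by (simp add: mpoly_ring_simps indexed_const_def)
next
  case (insert x S)
  interpret M: cring "mpoly_ring R n" by (rule mpoly_cring)
  have c: "f i m \<in> carrier R" if "i \<in> insert x S" for i
    using insert.prems[OF that] pset_carrier_coeff by (auto simp: mpoly_ring_simps carrier_coeff_def)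
  have "finsum (mpoly_ring R n) f (insert x S) m = f x m \<oplus> finsum (mpoly_ring R n) f S m"
    using insert by (subst M.finsum_insert) (auto simp: mpoly_ring_simps indexed_padd_def)
  also have "\<dots> = (\<Oplus>i\<in>insert x S. f i m)"
    using insert c by (subst finsum_insert) auto
  finally show ?case .
qed

lemma mpoly_times_var_power:
  assumes c: "c \<in> carrier (mpoly_ring R (Suc n))"
  shows "(c \<otimes>\<^bsub>mpoly_ring R (Suc n)\<^esub> indexed_var n [^]\<^bsub>mpoly_ring R (Suc n)\<^esub> (j::nat)) m
    = (if replicate_mset j n \<subseteq># m then c (m - replicate_mset j n) else \<zero>)"
proof -
  let ?M = "mpoly_ring R (Suc n)"
  interpret M: cring ?M by (rule mpoly_cring)
  have X: "indexed_var n \<in> carrier ?M" by (rule mpoly_var_closed) simp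
  show ?thesis
  proof (induction j arbitrary: m)
    case 0
    show ?case using c by simp
  next
    case (Suc j)
    let ?f = "c \<otimes>\<^bsub>?M\<^esub> indexed_var n [^]\<^bsub>?M\<^esub> j"
    have f: "?f \<in> carrier ?M" using c X by simp
    have "c \<otimes>\<^bsub>?M\<^esub> indexed_var n [^]\<^bsub>?M\<^esub> Suc j = indexed_var n \<otimes>\<^bsub>?M\<^esub> ?f"
      using c X by (simp add: M.m_ac)
    also have "\<dots> = indexed_pmult ?f n"
      using f conv_var[OF pset_carrier_coeff] by (simp add: mpoly_ring_simps)
    finally have eq: "(c \<otimes>\<^bsub>?M\<^esub> indexed_var n [^]\<^bsub>?M\<^esub> Suc j) m = (if n \<in># m then ?f (m - {#n#}) else \<zero>)"
      by (simp add: indexed_pmult_def)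
    show ?case
    proof (cases "n \<in># m")
      case True
      then obtain k where "m = add_mset n k" by (metis insert_DiffM)
      then show ?thesis using eq Suc[of k] by simp
    next
      case False
      then have "\<not> replicate_mset (Suc j) n \<subseteq># m"
        by (metis in_replicate_mset mset_subset_eqD zero_less_Suc)
      then show ?thesis using eq False by simp
    qed
  qed
qed

end

context plain_cring
begin

text \<open>Evaluation at the last variable identifies the polynomials in \<open>n + 1\<close> variables with the
  polynomials in one variable over the ring of polynomials in \<open>n\<close> variables. It is injective because
  the coefficient of \<open>f\<close> in degree \<open>j\<close> is read off from the monomials containing the last
  variable exactly \<open>j\<close> times.\<close>

lemma mpoly_as_univariate:
  obtains \<phi> where "\<phi> \<in> ring_hom (UP (mpoly_ring R n)) (mpoly_ring R (Suc n))"
    "\<And>a. a \<in> carrier (mpoly_ring R n) \<Longrightarrow> \<phi> (up_ring.monom (UP (mpoly_ring R n)) a 0) = a"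
    "\<phi> ` carrier (UP (mpoly_ring R n)) = carrier (mpoly_ring R (Suc n))"
    "\<And>f. \<lbrakk>f \<in> carrier (UP (mpoly_ring R n)); \<phi> f = \<zero>\<^bsub>mpoly_ring R (Suc n)\<^esub>\<rbrakk>
      \<Longrightarrow> f = \<zero>\<^bsub>UP (mpoly_ring R n)\<^esub>"
proof -
  note coefficient_defs = mpoly_ring_simps indexed_const_def index_free_def carrier_coeff_def
    and R_finsum_singleton = add.finprod_singleton_swap
  let ?M = "mpoly_ring R n" and ?N = "mpoly_ring R (Suc n)" and ?X = "ring.indexed_var R n"
  define P where "P = UP ?M"
  interpret M: cring ?M by (rule mpoly_cring)
  interpret N: cring ?N by (rule mpoly_cring)
  interpret UP_cring ?M P by unfold_locales (rule eq_reflection[OF P_def])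
  interpret UP_pre_univ_prop ?M ?N id P
    by (rule UP_pre_univ_prop.intro[OF ring_hom_cringI[OF M.cring_axioms N.cring_axioms
            mpoly_inclusion_hom] UP_cring.intro[OF M.cring_axioms]]) (rule P_def)
  have X: "?X \<in> carrier ?N" by (rule mpoly_var_closed) simp
  define \<phi> where "\<phi> = UnivPoly.eval ?M ?N id ?X"
  have hom: "\<phi> \<in> ring_hom P ?N" unfolding \<phi>_def by (rule eval_ring_hom[OF X])
  have eval_C: "\<phi> (up_ring.monom P a 0) = a" if "a \<in> carrier ?M" for a
    unfolding \<phi>_def using eval_const[OF X that] by simp
  have eval_X: "\<phi> (up_ring.monom P \<one>\<^bsub>?M\<^esub> 1) = ?X"
    unfolding \<phi>_def by (rule eval_monom1[OF X])
  have "f \<in> \<phi> ` carrier P" if "f \<in> carrier ?N" for f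
    using that
  proof (induction rule: mpoly_induct)
    case (const a)
    then have "ring.indexed_const R a \<in> carrier ?M" by (rule mpoly_const_closed)
    then show ?case using eval_C monom_closed by (metis image_eqI)
  next
    case (var i)
    show ?case
    proof (cases "i = n")
      case True
      then show ?thesis using eval_X monom_closed[OF M.one_closed] by (metis image_eqI)
    next
      case False
      then have "ring.indexed_var R i \<in> carrier ?M" using var by (intro mpoly_var_closed) simp
      then show ?thesis using eval_C monom_closed by (metis image_eqI)
    qed
  next
    case (add f g)
    then obtain f' g' where "f' \<in> carrier P" "g' \<in> carrier P" "f = \<phi> f'" "g = \<phi> g'" by blast
    then have "f \<oplus>\<^bsub>?N\<^esub> g = \<phi> (f' \<oplus>\<^bsub>P\<^esub> g')" "f' \<oplus>\<^bsub>P\<^esub> g' \<in> carrier P"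
      using ring_hom_add[OF hom] by simp_all
    then show ?case by simp
  next
    case (mult f g)
    then obtain f' g' where "f' \<in> carrier P" "g' \<in> carrier P" "f = \<phi> f'" "g = \<phi> g'" by blast
    then have "f \<otimes>\<^bsub>?N\<^esub> g = \<phi> (f' \<otimes>\<^bsub>P\<^esub> g')" "f' \<otimes>\<^bsub>P\<^esub> g' \<in> carrier P"
      using ring_hom_mult[OF hom] by simp_all
    then show ?case by simp
  qed
  then have surj: "\<phi> ` carrier P = carrier ?N"
    using ring_hom_closed[OF hom] by blast
  have inj: "f = \<zero>\<^bsub>P\<^esub>" if f: "f \<in> carrier P" and z: "\<phi> f = \<zero>\<^bsub>?N\<^esub>" for f
  proof (rule up_eqI)
    let ?c = "up_ring.coeff P f"
    have c: "?c i \<in> carrier ?M" for i using f by simp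
    then have cN: "?c i \<in> carrier ?N" for i using ring_hom_closed[OF mpoly_inclusion_hom] by fastforce
    have cR: "?c i m \<in> carrier R" for i m
      using pset_carrier_coeff c[of i] by (auto simp: coefficient_defs)
    have free: "?c i m = \<zero>" if "n \<in># m" for i m
      using pset_index_free[of "?c i" "{..<n}" n] c[of i] that by (simp add: coefficient_defs)
    fix j
    have "?c j m = \<zero>" if j: "j \<le> deg ?M f" and m: "n \<notin># m" for m
    proof -
      let ?m = "m + replicate_mset j n"
      have summand: "(?c i \<otimes>\<^bsub>?N\<^esub> ?X [^]\<^bsub>?N\<^esub> i) ?m = (if i = j then ?c j m else \<zero>)" for i
        unfolding mpoly_times_var_power[OF cN]
      proof (cases "replicate_mset i n \<subseteq># ?m")
        case False
        then have "i \<noteq> j" by auto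
        then show "(if replicate_mset i n \<subseteq># ?m then ?c i (?m - replicate_mset i n) else \<zero>)
            = (if i = j then ?c j m else \<zero>)" using False by simp
      next
        case True
        have "count m n = 0" using m by (simp add: not_in_iff)
        then have ij: "i \<le> j" using mset_subset_eq_count[OF True, of n] by simp
        have "n \<in># ?m - replicate_mset i n" if "i < j"
          using that \<open>count m n = 0\<close> by (simp flip: count_greater_zero_iff)
        then show "(if replicate_mset i n \<subseteq># ?m then ?c i (?m - replicate_mset i n) else \<zero>)
            = (if i = j then ?c j m else \<zero>)"
          using True ij free by (cases "i = j") auto
      qed
      have "\<zero> = \<phi> f ?m" unfolding z by (simp add: coefficient_defs)
      also have "\<phi> f = (\<Oplus>\<^bsub>?N\<^esub>i\<in>{..deg ?M f}. ?c i \<otimes>\<^bsub>?N\<^esub> ?X [^]\<^bsub>?N\<^esub> i)"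
        unfolding \<phi>_def eval_on_carrier[OF f] by simp
      also have "\<dots> ?m = (\<Oplus>i\<in>{..deg ?M f}. (?c i \<otimes>\<^bsub>?N\<^esub> ?X [^]\<^bsub>?N\<^esub> i) ?m)"
        by (rule mpoly_finsum_apply) (use cN X in auto)
      also have "\<dots> = (\<Oplus>i\<in>{..deg ?M f}. if i = j then ?c j m else \<zero>)"
        unfolding summand ..
      also have "\<dots> = ?c j m"
        using R_finsum_singleton[of j "{..deg ?M f}" "\<lambda>_. ?c j m"] j cR by simp
      finally show ?thesis by simp
    qed
    then have "?c j m = \<zero>" for m
      using free deg_aboveD[OF _ f, of j]
      by (cases "j \<le> deg ?M f") (auto simp: coefficient_defs)
    then show "?c j = up_ring.coeff P \<zero>\<^bsub>P\<^esub> j"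
      by (auto simp: coefficient_defs)
  qed (use f in auto)
  show thesis
    by (rule that[of \<phi>]) (use hom eval_C surj inj in \<open>auto simp: P_def\<close>)
qed

end

lemma constructibly_open_at_cong:
  assumes "\<And>a. a \<in> carrier A \<Longrightarrow> h a = k a"
  shows "constructibly_open_at A B h P \<longleftrightarrow> constructibly_open_at A B k P"
proof -
  have "comap A h Q = comap A k Q" for Q using assms by (auto simp: comap_def)
  then show ?thesis unfolding constructibly_open_at_def by simp
qed

text \<open>For \<open>A \<rightarrow> A' \<rightarrow> B \<rightarrow> C\<close>, a polynomial over \<open>A\<close> with a given root in \<open>C\<close> maps to one over \<open>A'\<close>.\<close>

lemma residually_algebraic_intermediate:
  assumes alg: "residually_algebraic A C g P"
    and i: "i \<in> carrier A \<rightarrow> carrier A'" and h: "h \<in> carrier A' \<rightarrow> carrier B"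
    and k: "k \<in> ring_hom B C" and B: "cring B" and C: "cring C"
    and g: "\<And>a. a \<in> carrier A \<Longrightarrow> k (h (i a)) = g a"
  shows "residually_algebraic A' B h (comap B k P)"
  unfolding residually_algebraic_def
proof
  fix b assume b: "b \<in> carrier B"
  then have "k b \<in> carrier C" using k ring_hom_closed by metis
  then obtain cs where cs: "set cs \<subseteq> carrier A" "horner C g (k b) cs \<in> P" "\<exists>c\<in>set cs. g c \<notin> P"
    using alg unfolding residually_algebraic_def by meson
  have in_B: "h ` set (map i cs) \<subseteq> carrier B" using cs(1) i h by (auto simp: Pi_iff)
  have "horner C (k \<circ> h) (k b) (map i cs) = horner C g (k b) cs"
    using cs(1) g by (induction cs) auto
  then have "k (horner B h b (map i cs)) \<in> P"
    using horner_hom[OF B C k in_B b] cs(2) by simp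
  then have "horner B h b (map i cs) \<in> comap B k P"
    using horner_closed[OF B in_B b] by (simp add: comap_def)
  moreover have "\<exists>c\<in>set (map i cs). h c \<notin> comap B k P"
  proof -
    obtain c where c: "c \<in> set cs" "g c \<notin> P" using cs(3) by blast
    then have "h (i c) \<notin> comap B k P" using g[of c] cs(1) by (simp add: comap_def subset_iff)
    then show ?thesis using c(1) by (intro bexI[of _ "i c"]) simp_all
  qed
  moreover have "set (map i cs) \<subseteq> carrier A'" using cs(1) i by auto
  ultimately show "\<exists>cs. set cs \<subseteq> carrier A' \<and> horner B h b cs \<in> comap B k P
      \<and> (\<exists>c\<in>set cs. h c \<notin> comap B k P)" by meson
qed

context plain_cring
begin

lemma constructibly_open_at_adjoin_variable:
  assumes Q: "primeideal Q (mpoly_ring R (Suc n))"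
    and alg: "residually_algebraic R (mpoly_ring R (Suc n)) indexed_const Q"
  shows "constructibly_open_at (mpoly_ring R n) (mpoly_ring R (Suc n)) id Q"
proof -
  let ?M = "mpoly_ring R n" and ?N = "mpoly_ring R (Suc n)" and ?P = "UP (mpoly_ring R n)"
  interpret M: cring ?M by (rule mpoly_cring)
  interpret N: cring ?N by (rule mpoly_cring)
  interpret U: UP_cring ?M ?P by unfold_locales simp
  obtain \<phi> where hom: "\<phi> \<in> ring_hom ?P ?N"
    and const: "\<And>a. a \<in> carrier ?M \<Longrightarrow> \<phi> (U.const a) = a"
    and surj: "\<phi> ` carrier ?P = carrier ?N"
    and inj: "\<And>f. \<lbrakk>f \<in> carrier ?P; \<phi> f = \<zero>\<^bsub>?N\<^esub>\<rbrakk> \<Longrightarrow> f = \<zero>\<^bsub>?P\<^esub>"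
    using mpoly_as_univariate[of n] by metis
  interpret \<phi>: ring_hom_cring ?P ?N \<phi>
    by (rule ring_hom_cringI[OF U.UP_cring N.cring_axioms hom])
  have "residually_algebraic ?M ?P U.const (comap ?P \<phi> Q)"
    by (rule residually_algebraic_intermediate[OF alg, of indexed_const])
      (use mpoly_const_closed const hom U.UP_cring N.cring_axioms in auto)
  then have "constructibly_open_at ?M ?P U.const (comap ?P \<phi> Q)"
    by (rule U.constructibly_open_at_polynomial_ring[OF primeideal_comap[OF U.UP_cring hom Q]])
  moreover have "constructibly_open_at ?P ?N \<phi> Q"
  proof (rule constructibly_open_at_quotient[OF U.UP_cring N.cring_axioms hom surj _ _ _ Q])
    show "Idl\<^bsub>?P\<^esub> {\<zero>\<^bsub>?P\<^esub>} = {a \<in> carrier ?P. \<phi> a = \<zero>\<^bsub>?N\<^esub>}"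
      unfolding ring.genideal_zero[OF cring.axioms(1)[OF U.UP_cring]] using inj by auto
  qed auto
  ultimately have "constructibly_open_at ?M ?N (\<phi> \<circ> U.const) Q"
    by (intro constructibly_open_at_comp) auto
  moreover have "constructibly_open_at ?M ?N (\<phi> \<circ> U.const) Q \<longleftrightarrow> constructibly_open_at ?M ?N id Q"
    by (rule constructibly_open_at_cong) (simp add: const)
  ultimately show ?thesis by blast
qed

lemma constructibly_open_at_mpoly:
  assumes "primeideal Q (mpoly_ring R n)" "residually_algebraic R (mpoly_ring R n) indexed_const Q"
  shows "constructibly_open_at R (mpoly_ring R n) indexed_const Q"
  using assms
proof (induction n arbitrary: Q)
  case 0
  let ?M = "mpoly_ring R 0"
  have surj: "indexed_const ` carrier R = carrier ?M"
  proof
    show "carrier ?M \<subseteq> indexed_const ` carrier R"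
    proof
      fix f assume "f \<in> carrier ?M"
      then have "f \<in> indexed_pset {} (carrier R)" by (simp add: mpoly_ring_simps)
      then show "f \<in> indexed_const ` carrier R"
        by induction (auto simp: indexed_padd_const)
    qed
  qed (use mpoly_const_closed in blast)
  have "Idl {\<zero>} = {a \<in> carrier R. indexed_const a = \<zero>\<^bsub>?M\<^esub>}"
    unfolding genideal_zero mpoly_ring_simps by (auto simp: indexed_const_def fun_eq_iff)
  then show ?case
    by (intro constructibly_open_at_quotient[OF cring_axioms mpoly_cring mpoly_const_hom surj _ _ _ 0(1)])
      auto
next
  case (Suc n)
  let ?M = "mpoly_ring R n" and ?N = "mpoly_ring R (Suc n)"
  have "constructibly_open_at R ?M indexed_const (comap ?M id Q)"
  proof (rule Suc.IH)
    show "primeideal (comap ?M id Q) ?M"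
      by (rule primeideal_comap[OF mpoly_cring mpoly_inclusion_hom Suc.prems(1)])
    show "residually_algebraic R ?M indexed_const (comap ?M id Q)"
      by (rule residually_algebraic_intermediate[OF Suc.prems(2), of id])
        (use mpoly_const_closed mpoly_inclusion_hom mpoly_cring in auto)
  qed
  then have "constructibly_open_at R ?N (id \<circ> indexed_const) Q"
    using constructibly_open_at_adjoin_variable[OF Suc.prems] mpoly_const_closed
    by (intro constructibly_open_at_comp) auto
  then show ?case by simp
qed

lemma finitely_presented_surjection:
  assumes B: "cring B" and fp: "finitely_presented R B h"
  obtains n F \<psi> where "finite F" "F \<subseteq> carrier (mpoly_ring R n)" "\<psi> \<in> ring_hom (mpoly_ring R n) B"
    "\<psi> ` carrier (mpoly_ring R n) = carrier B"
    "Idl\<^bsub>mpoly_ring R n\<^esub> F = {f \<in> carrier (mpoly_ring R n). \<psi> f = \<zero>\<^bsub>B\<^esub>}"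
    "\<And>a. a \<in> carrier R \<Longrightarrow> \<psi> (indexed_const a) = h a"
proof -
  from fp obtain n F \<phi> where F: "finite F" "F \<subseteq> carrier (mpoly_ring R n)"
    and iso: "\<phi> \<in> ring_iso (mpoly_ring R n Quot (Idl\<^bsub>mpoly_ring R n\<^esub> F)) B"
    and \<phi>: "\<And>r. r \<in> carrier R \<Longrightarrow>
      \<phi> ((Idl\<^bsub>mpoly_ring R n\<^esub> F) +>\<^bsub>mpoly_ring R n\<^esub> indexed_const r) = h r"
    unfolding finitely_presented_def by blast
  let ?M = "mpoly_ring R n"
  define J where "J = Idl\<^bsub>?M\<^esub> F"
  interpret M: cring ?M by (rule mpoly_cring)
  interpret B: cring B by (rule B)
  interpret J: ideal J ?M unfolding J_def by (rule M.genideal_ideal[OF F(2)])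
  interpret Q: cring "?M Quot J" by (rule J.quotient_is_cring[OF M.cring_axioms])
  have \<phi>_hom: "\<phi> \<in> ring_hom (?M Quot J) B" and \<phi>_bij: "bij_betw \<phi> (carrier (?M Quot J)) (carrier B)"
    using iso unfolding ring_iso_def J_def by auto
  interpret \<phi>: ring_hom_cring "?M Quot J" B \<phi>
    by (rule ring_hom_cringI[OF Q.cring_axioms B.cring_axioms \<phi>_hom])
  define \<psi> where "\<psi> = \<phi> \<circ> (+>\<^bsub>?M\<^esub>) J"
  have hom: "\<psi> \<in> ring_hom ?M B"
    unfolding \<psi>_def by (rule ring_hom_trans[OF J.rcos_ring_hom \<phi>_hom])
  have cosets: "carrier (?M Quot J) = (+>\<^bsub>?M\<^esub>) J ` carrier ?M"
    by (auto simp: FactRing_def A_RCOSETS_def')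
  have surj: "\<psi> ` carrier ?M = carrier B"
    using \<phi>_bij unfolding \<psi>_def bij_betw_def cosets by (simp add: image_comp)
  have "\<psi> f = \<zero>\<^bsub>B\<^esub> \<longleftrightarrow> f \<in> J" if f: "f \<in> carrier ?M" for f
  proof
    assume "\<psi> f = \<zero>\<^bsub>B\<^esub>"
    then have "\<phi> (J +>\<^bsub>?M\<^esub> f) = \<phi> \<zero>\<^bsub>?M Quot J\<^esub>" by (simp add: \<psi>_def)
    then have "J +>\<^bsub>?M\<^esub> f = \<zero>\<^bsub>?M Quot J\<^esub>"
      using \<phi>_bij f unfolding bij_betw_def cosets by (metis Q.zero_closed cosets image_eqI inj_onD)
    then have "J +>\<^bsub>?M\<^esub> f = J" by (simp add: FactRing_def)
    then show "f \<in> J" by (rule J.rcos_const_imp_mem[OF f])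
  next
    assume "f \<in> J"
    then have "J +>\<^bsub>?M\<^esub> f = \<zero>\<^bsub>?M Quot J\<^esub>"
      using M.a_rcos_zero[OF J.is_ideal] by (simp add: FactRing_def)
    then show "\<psi> f = \<zero>\<^bsub>B\<^esub>" by (simp add: \<psi>_def)
  qed
  then have ker: "J = {f \<in> carrier ?M. \<psi> f = \<zero>\<^bsub>B\<^esub>}"
    using J.a_subset by blast
  show thesis
    by (rule that[OF F hom surj ker[unfolded J_def]]) (use \<phi> in \<open>simp add: \<psi>_def J_def\<close>)
qed

text \<open>A local form of Chevalley's theorem, for algebraic residue field extensions: a finitely presented
  algebra arises by adjoining variables one at a time and dividing by finitely many equations, and
  each of these steps is constructibly open.\<close>

lemma constructibly_open_at_finitely_presented:
  assumes B: "cring B" and fp: "finitely_presented R B h" and P: "primeideal P B"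
    and alg: "residually_algebraic R B h P"
  shows "constructibly_open_at R B h P"
proof -
  obtain n F \<psi> where F: "finite F" "F \<subseteq> carrier (mpoly_ring R n)"
    and hom: "\<psi> \<in> ring_hom (mpoly_ring R n) B"
    and surj: "\<psi> ` carrier (mpoly_ring R n) = carrier B"
    and ker: "Idl\<^bsub>mpoly_ring R n\<^esub> F = {f \<in> carrier (mpoly_ring R n). \<psi> f = \<zero>\<^bsub>B\<^esub>}"
    and const: "\<And>a. a \<in> carrier R \<Longrightarrow> \<psi> (indexed_const a) = h a"
    by (rule finitely_presented_surjection[OF B fp]) (rule that)
  let ?M = "mpoly_ring R n"
  have "constructibly_open_at R ?M indexed_const (comap ?M \<psi> P)"
  proof (rule constructibly_open_at_mpoly)
    show "primeideal (comap ?M \<psi> P) ?M" by (rule primeideal_comap[OF mpoly_cring hom P])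
    show "residually_algebraic R ?M indexed_const (comap ?M \<psi> P)"
      by (rule residually_algebraic_intermediate[OF alg, of id])
        (use mpoly_const_closed const hom B mpoly_cring in auto)
  qed
  moreover have "constructibly_open_at ?M B \<psi> P"
    by (rule constructibly_open_at_quotient[OF mpoly_cring B hom surj F ker P])
  ultimately have "constructibly_open_at R B (\<psi> \<circ> indexed_const) P"
    using mpoly_const_closed by (intro constructibly_open_at_comp) auto
  moreover have "constructibly_open_at R B (\<psi> \<circ> indexed_const) P \<longleftrightarrow> constructibly_open_at R B h P"
    by (rule constructibly_open_at_cong) (simp add: const)
  ultimately show ?thesis by blast
qed

end

definition generates_algebra ::
    "('a, 'm) ring_scheme \<Rightarrow> ('b, 'n) ring_scheme \<Rightarrow> ('a \<Rightarrow> 'b) \<Rightarrow> 'b set \<Rightarrow> bool" where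
  "generates_algebra A B h E \<longleftrightarrow> (\<forall>Z. h ` carrier A \<subseteq> Z \<and> E \<subseteq> Z \<and>
     (\<forall>b\<in>carrier B \<inter> Z. \<forall>c\<in>carrier B \<inter> Z. b \<oplus>\<^bsub>B\<^esub> c \<in> Z \<and> b \<otimes>\<^bsub>B\<^esub> c \<in> Z) \<longrightarrow> carrier B \<subseteq> Z)"

lemma (in plain_cring) finitely_presented_generators:
  assumes B: "cring B" and fp: "finitely_presented R B h"
  obtains E where "finite E" "E \<subseteq> carrier B" "generates_algebra R B h E"
proof -
  obtain n F \<psi> where hom: "\<psi> \<in> ring_hom (mpoly_ring R n) B"
    and surj: "\<psi> ` carrier (mpoly_ring R n) = carrier B"
    and const: "\<And>a. a \<in> carrier R \<Longrightarrow> \<psi> (indexed_const a) = h a"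
    by (rule finitely_presented_surjection[OF B fp]) (rule that)
  let ?M = "mpoly_ring R n"
  define E where "E = (\<lambda>i. \<psi> (indexed_var i)) ` {..<n}"
  have "generates_algebra R B h E"
    unfolding generates_algebra_def
  proof (intro allI impI subsetI)
    fix Z b assume Z: "h ` carrier R \<subseteq> Z \<and> E \<subseteq> Z \<and>
      (\<forall>b\<in>carrier B \<inter> Z. \<forall>c\<in>carrier B \<inter> Z. b \<oplus>\<^bsub>B\<^esub> c \<in> Z \<and> b \<otimes>\<^bsub>B\<^esub> c \<in> Z)" and b: "b \<in> carrier B"
    obtain f where f: "f \<in> carrier ?M" "b = \<psi> f" using b surj by blast
    have "\<psi> f \<in> Z"
      using f(1)
    proof (rule mpoly_induct)
      show "\<psi> (indexed_const a) \<in> Z" if "a \<in> carrier R" for a using const Z that by auto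
      show "\<psi> (indexed_var i) \<in> Z" if "i < n" for i using Z that by (auto simp: E_def)
      fix f g assume fg: "f \<in> carrier ?M" "g \<in> carrier ?M" "\<psi> f \<in> Z" "\<psi> g \<in> Z"
      then have cl: "\<psi> f \<in> carrier B \<inter> Z" "\<psi> g \<in> carrier B \<inter> Z" using ring_hom_closed[OF hom] by auto
      then show "\<psi> (f \<oplus>\<^bsub>?M\<^esub> g) \<in> Z" "\<psi> (f \<otimes>\<^bsub>?M\<^esub> g) \<in> Z"
        unfolding ring_hom_add[OF hom fg(1,2)] ring_hom_mult[OF hom fg(1,2)] using Z by blast+
    qed
    then show "b \<in> Z" using f(2) by simp
  qed
  moreover have "finite E" "E \<subseteq> carrier B"
    using mpoly_var_closed ring_hom_closed[OF hom] by (auto simp: E_def)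
  ultimately show thesis using that by simp
qed

section \<open>Local rings and residue fields\<close>

lemma local_ringD:
  assumes "local_ring R"
  shows "cring R" "maximalideal (max_ideal R) R" "primeideal (max_ideal R) R"
    "ideal (max_ideal R) R" "field (residue_field R)"
proof -
  have ex: "\<exists>!m. maximalideal m R" and R: "cring R" using assms by (simp_all add: local_ring_def)
  show m: "cring R" "maximalideal (max_ideal R) R"
    unfolding max_ideal_def using theI'[OF ex] R by simp_all
  show P: "primeideal (max_ideal R) R" by (rule cring.maximalideal_prime[OF m])
  show "ideal (max_ideal R) R" by (rule prime_idealD(2)[OF P])
  show "field (residue_field R)"
    unfolding residue_field_def by (rule maximalideal.quotient_is_field[OF m(2,1)])
qed

lemma max_ideal_eq_nonunits:
  assumes R: "local_ring R"
  shows "max_ideal R = carrier R - Units R"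
proof -
  note RD = local_ringD[OF R] and mD = prime_idealD[OF local_ringD(3)[OF R]]
  interpret cring R by (rule RD(1))
  have "a \<notin> Units R" if "a \<in> max_ideal R" for a
  proof
    assume u: "a \<in> Units R"
    have "inv\<^bsub>R\<^esub> a \<otimes>\<^bsub>R\<^esub> a \<in> max_ideal R"
      by (rule mD(9)[OF Units_inv_closed[OF u] that])
    then show False using mD(5) u by simp
  qed
  moreover have "a \<in> max_ideal R" if a: "a \<in> carrier R" "a \<notin> Units R" for a
  proof -
    have "\<one>\<^bsub>R\<^esub> \<notin> PIdl\<^bsub>R\<^esub> a"
    proof
      assume "\<one>\<^bsub>R\<^esub> \<in> PIdl\<^bsub>R\<^esub> a"
      then obtain r where "r \<in> carrier R" "r \<otimes>\<^bsub>R\<^esub> a = \<one>\<^bsub>R\<^esub>" unfolding cgenideal_def by force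
      then have "a \<in> Units R" using a m_comm unfolding Units_def by auto
      then show False using a by simp
    qed
    then obtain m where m: "maximalideal m R" "PIdl\<^bsub>R\<^esub> a \<subseteq> m"
      using maximalideal_containing[OF cgenideal_ideal[OF a(1)]] by metis
    have "m = max_ideal R" using R m(1) RD(2) unfolding local_ring_def by blast
    then show ?thesis using m(2) cgenideal_self[OF a(1)] by blast
  qed
  ultimately show ?thesis using mD(3) by blast
qed

abbreviation residue :: "'a ring \<Rightarrow> 'a \<Rightarrow> 'a set" where
  "residue R a \<equiv> max_ideal R +>\<^bsub>R\<^esub> a"

lemma residue_hom:
  assumes "local_ring R"
  shows "residue R \<in> ring_hom R (residue_field R)"
  unfolding residue_field_def by (rule ideal.rcos_ring_hom[OF local_ringD(4)[OF assms]])

lemma residue_surj: "carrier (residue_field R) = residue R ` carrier R"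
  by (auto simp: residue_field_def FactRing_def A_RCOSETS_def')

lemma residue_eq_zero_iff:
  assumes "local_ring R" "a \<in> carrier R"
  shows "residue R a = \<zero>\<^bsub>residue_field R\<^esub> \<longleftrightarrow> a \<in> max_ideal R"
proof -
  interpret ideal "max_ideal R" R by (rule local_ringD(4)[OF assms(1)])
  have "\<zero>\<^bsub>residue_field R\<^esub> = max_ideal R" by (simp add: residue_field_def FactRing_def)
  then show ?thesis using rcos_const_imp_mem[OF assms(2)] a_rcos_zero[OF is_ideal] by metis
qed

lemma residue_eq_iff:
  assumes "local_ring R" "a \<in> carrier R" "b \<in> carrier R"
  shows "residue R a = residue R b \<longleftrightarrow> a \<oplus>\<^bsub>R\<^esub> \<ominus>\<^bsub>R\<^esub> b \<in> max_ideal R"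
proof -
  interpret R: cring R by (rule local_ringD(1)[OF assms(1)])
  interpret K: field "residue_field R" by (rule local_ringD(5)[OF assms(1)])
  interpret r: ring_hom_cring R "residue_field R" "residue R"
    by (rule ring_hom_cringI[OF R.cring_axioms K.cring_axioms residue_hom[OF assms(1)]])
  have c: "residue R a \<in> carrier (residue_field R)" "residue R b \<in> carrier (residue_field R)"
    using assms r.hom_closed by blast+
  have "residue R (a \<oplus>\<^bsub>R\<^esub> \<ominus>\<^bsub>R\<^esub> b) = residue R a \<oplus>\<^bsub>residue_field R\<^esub> \<ominus>\<^bsub>residue_field R\<^esub> residue R b"
    using assms r.hom_add r.hom_a_inv by simp
  then show ?thesis
    using residue_eq_zero_iff[OF assms(1), of "a \<oplus>\<^bsub>R\<^esub> \<ominus>\<^bsub>R\<^esub> b"] assms K.r_right_minus_eq[OF c]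
    by (simp add: a_minus_def)
qed

lemma local_homD:
  assumes "local_hom R S h"
  shows "h \<in> ring_hom R S" "\<And>a. a \<in> carrier R \<Longrightarrow> h a \<in> max_ideal S \<longleftrightarrow> a \<in> max_ideal R"
  using assms unfolding local_hom_def by blast+

lemma residue_map_residue:
  assumes R: "local_ring R" and S: "local_ring S" and h: "local_hom R S h" and a: "a \<in> carrier R"
  shows "residue_map S h (residue R a) = residue S (h a)"
proof -
  note hD = local_homD[OF h]
  interpret R: cring R by (rule local_ringD(1)[OF R])
  interpret S: cring S by (rule local_ringD(1)[OF S])
  interpret h: ring_hom_cring R S h by (rule ring_hom_cringI[OF R.cring_axioms S.cring_axioms hD(1)])
  note mR = prime_idealD[OF local_ringD(3)[OF R]] and mS = prime_idealD[OF local_ringD(3)[OF S]]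
  have "residue S (h b) = residue S (h a)" if b: "b \<in> residue R a" for b
  proof -
    obtain m where m: "m \<in> max_ideal R" "b = m \<oplus>\<^bsub>R\<^esub> a"
      using b unfolding a_r_coset_def' by blast
    have mc: "m \<in> carrier R" using m(1) mR(3) by blast
    have "h b \<oplus>\<^bsub>S\<^esub> \<ominus>\<^bsub>S\<^esub> h a = h m"
      using m(2) mc a by (simp add: S.a_assoc S.r_neg)
    then have "h b \<oplus>\<^bsub>S\<^esub> \<ominus>\<^bsub>S\<^esub> h a \<in> max_ideal S" using hD(2)[OF mc] m(1) by simp
    then show ?thesis using residue_eq_iff[OF S, of "h b" "h a"] m(2) mc a by simp
  qed
  moreover have "a \<in> residue R a"
    using a mR(4) unfolding a_r_coset_def' by force
  ultimately show ?thesis unfolding residue_map_def by blast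
qed

lemma residue_map_hom:
  assumes R: "local_ring R" and S: "local_ring S" and h: "local_hom R S h"
  shows "residue_map S h \<in> ring_hom (residue_field R) (residue_field S)"
proof (rule ring_hom_memI)
  interpret R: cring R by (rule local_ringD(1)[OF R])
  note rm = residue_map_residue[OF R S h] and hom = ring_hom_trans[OF local_homD(1)[OF h] residue_hom[OF S]]
    and hR = residue_hom[OF R]
  show "residue_map S h x \<in> carrier (residue_field S)" if "x \<in> carrier (residue_field R)" for x
    using that rm ring_hom_closed[OF hom] unfolding residue_surj[of R] by auto
  show "residue_map S h (x \<otimes>\<^bsub>residue_field R\<^esub> y)
      = residue_map S h x \<otimes>\<^bsub>residue_field S\<^esub> residue_map S h y"
    if xy: "x \<in> carrier (residue_field R)" "y \<in> carrier (residue_field R)" for x y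
  proof -
    obtain a b where ab: "a \<in> carrier R" "b \<in> carrier R" "x = residue R a" "y = residue R b"
      using xy unfolding residue_surj by blast
    then show ?thesis
      using rm ring_hom_mult[OF hR ab(1,2)] ring_hom_mult[OF hom ab(1,2)] by (metis R.m_closed comp_apply)
  qed
  show "residue_map S h (x \<oplus>\<^bsub>residue_field R\<^esub> y)
      = residue_map S h x \<oplus>\<^bsub>residue_field S\<^esub> residue_map S h y"
    if xy: "x \<in> carrier (residue_field R)" "y \<in> carrier (residue_field R)" for x y
  proof -
    obtain a b where ab: "a \<in> carrier R" "b \<in> carrier R" "x = residue R a" "y = residue R b"
      using xy unfolding residue_surj by blast
    then show ?thesis
      using rm ring_hom_add[OF hR ab(1,2)] ring_hom_add[OF hom ab(1,2)] by (metis R.a_closed comp_apply)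
  qed
  show "residue_map S h \<one>\<^bsub>residue_field R\<^esub> = \<one>\<^bsub>residue_field S\<^esub>"
    using rm[OF R.one_closed] ring_hom_one[OF hR] ring_hom_one[OF hom] by simp
qed

text \<open>A homomorphism of fields is an isomorphism as soon as it is surjective.\<close>

lemma residue_map_iso_iff:
  assumes R: "local_ring R" and S: "local_ring S" and h: "local_hom R S h"
  shows "residue_map S h \<in> ring_iso (residue_field R) (residue_field S) \<longleftrightarrow>
    (\<forall>b\<in>carrier S. \<exists>a\<in>carrier R. residue S b = residue S (h a))"
proof -
  note rm = residue_map_residue[OF R S h] and hom = residue_map_hom[OF R S h]
  have "inj_on (residue_map S h) (carrier (residue_field R))"
    by (rule non_trivial_field_hom_is_inj[OF hom local_ringD(5)[OF R] local_ringD(5)[OF S]])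
  then have "residue_map S h \<in> ring_iso (residue_field R) (residue_field S) \<longleftrightarrow>
      carrier (residue_field S) \<subseteq> residue_map S h ` carrier (residue_field R)"
    using hom ring_hom_closed[OF hom] unfolding ring_iso_def bij_betw_def by auto
  also have "\<dots> \<longleftrightarrow> (\<forall>b\<in>carrier S. \<exists>a\<in>carrier R. residue S b = residue S (h a))"
    unfolding residue_surj using rm by (auto simp: image_iff subset_iff)
  finally show ?thesis .
qed

section \<open>Stalks and vanishing ideals\<close>

context ringed_space
begin

lemma germ_mem_iff:
  "(V, t) \<in> germ \<XX> x U s \<longleftrightarrow> openin (topo \<XX>) V \<and> x \<in> V \<and> t \<in> carrier (sect \<XX> V) \<and>
     (\<exists>W. openin (topo \<XX>) W \<and> x \<in> W \<and> W \<subseteq> U \<inter> V \<and> restr \<XX> U W s = restr \<XX> V W t)"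
  unfolding germ_def by blast

lemma restr_closed:
  assumes "openin (topo \<XX>) U" "openin (topo \<XX>) V" "V \<subseteq> U" "s \<in> carrier (sect \<XX> U)"
  shows "restr \<XX> U V s \<in> carrier (sect \<XX> V)"
  using ring_hom_closed[OF restr_hom[OF assms(1-3)] assms(4)] .

lemma germ_self:
  assumes "openin (topo \<XX>) U" "x \<in> U" "s \<in> carrier (sect \<XX> U)"
  shows "(U, s) \<in> germ \<XX> x U s"
  unfolding germ_mem_iff using assms by blast

lemma germ_eq_iff:
  assumes U: "openin (topo \<XX>) U" "x \<in> U" "s \<in> carrier (sect \<XX> U)"
    and V: "openin (topo \<XX>) V" "x \<in> V" "t \<in> carrier (sect \<XX> V)"
  shows "germ \<XX> x U s = germ \<XX> x V t \<longleftrightarrow>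
    (\<exists>W. openin (topo \<XX>) W \<and> x \<in> W \<and> W \<subseteq> U \<inter> V \<and> restr \<XX> U W s = restr \<XX> V W t)"
    (is "_ \<longleftrightarrow> ?R")
proof
  assume "germ \<XX> x U s = germ \<XX> x V t"
  then have "(V, t) \<in> germ \<XX> x U s" using germ_self[OF V] by simp
  then show ?R unfolding germ_mem_iff by blast
next
  have sub: "germ \<XX> x U s \<subseteq> germ \<XX> x V t"
    if U: "openin (topo \<XX>) U" "x \<in> U" "s \<in> carrier (sect \<XX> U)"
      and V: "openin (topo \<XX>) V" "x \<in> V" "t \<in> carrier (sect \<XX> V)"
      and W: "openin (topo \<XX>) W" "x \<in> W" "W \<subseteq> U \<inter> V" "restr \<XX> U W s = restr \<XX> V W t" for U V W s t
  proof
    fix z assume z: "z \<in> germ \<XX> x U s"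
    obtain O' r where zr: "z = (O', r)" by fastforce
    then obtain W' where r: "openin (topo \<XX>) O'" "x \<in> O'" "r \<in> carrier (sect \<XX> O')"
      and W': "openin (topo \<XX>) W'" "x \<in> W'" "W' \<subseteq> U \<inter> O'" "restr \<XX> U W' s = restr \<XX> O' W' r"
      using z germ_mem_iff by auto
    let ?W = "W \<inter> W'"
    have oW: "openin (topo \<XX>) ?W" using W W' by blast
    have "restr \<XX> V ?W t = restr \<XX> W ?W (restr \<XX> V W t)"
      using restr_restr[OF V(1) W(1) oW _ _ V(3)] W(3) by simp
    also have "\<dots> = restr \<XX> U ?W s"
      unfolding W(4)[symmetric] using restr_restr[OF U(1) W(1) oW _ _ U(3)] W(3) by simp
    also have "\<dots> = restr \<XX> W' ?W (restr \<XX> U W' s)"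
      using restr_restr[OF U(1) W'(1) oW _ _ U(3)] W'(3) by simp
    also have "\<dots> = restr \<XX> O' ?W r"
      unfolding W'(4) using restr_restr[OF r(1) W'(1) oW _ _ r(3)] W'(3) by simp
    finally show "z \<in> germ \<XX> x V t"
      unfolding zr germ_mem_iff using r oW W W' by (intro conjI exI[of _ ?W]) auto
  qed
  assume ?R
  then obtain W where W: "openin (topo \<XX>) W" "x \<in> W" "W \<subseteq> U \<inter> V" "restr \<XX> U W s = restr \<XX> V W t"
    by blast
  show "germ \<XX> x U s = germ \<XX> x V t"
  proof
    show "germ \<XX> x U s \<subseteq> germ \<XX> x V t" by (rule sub[OF U V W])
    show "germ \<XX> x V t \<subseteq> germ \<XX> x U s"
      by (rule sub[OF V U W(1,2) _ W(4)[symmetric]]) (use W(3) in blast)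
  qed
qed

lemma germ_restr:
  assumes "openin (topo \<XX>) U" "openin (topo \<XX>) V" "V \<subseteq> U" "x \<in> V" "s \<in> carrier (sect \<XX> U)"
  shows "germ \<XX> x V (restr \<XX> U V s) = germ \<XX> x U s"
proof -
  have "restr \<XX> V V (restr \<XX> U V s) = restr \<XX> U V s"
    using restr_restr[OF assms(1,2,2) _ assms(3,5)] by simp
  then show ?thesis
    using assms restr_closed by (subst germ_eq_iff) (auto intro!: exI[of _ V])
qed

lemma stalk_carrierE:
  assumes "A \<in> carrier (stalk \<XX> x)"
  obtains U s where "openin (topo \<XX>) U" "x \<in> U" "s \<in> carrier (sect \<XX> U)" "A = germ \<XX> x U s"
  using assms that unfolding stalk_def by auto

lemma germ_closed:
  assumes "openin (topo \<XX>) U" "x \<in> U" "s \<in> carrier (sect \<XX> U)"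
  shows "germ \<XX> x U s \<in> carrier (stalk \<XX> x)"
  using assms unfolding stalk_def by auto

text \<open>Addition and multiplication of germs are both given by the union below.\<close>

lemma germ_operation:
  assumes op: "\<And>U V s t. \<lbrakk>openin (topo \<XX>) U; openin (topo \<XX>) V; V \<subseteq> U; s \<in> carrier (sect \<XX> U);
      t \<in> carrier (sect \<XX> U)\<rbrakk>
      \<Longrightarrow> f U s t \<in> carrier (sect \<XX> U) \<and> restr \<XX> U V (f U s t) = f V (restr \<XX> U V s) (restr \<XX> U V t)"
    and U: "openin (topo \<XX>) U" "x \<in> U" and s: "s \<in> carrier (sect \<XX> U)" and t: "t \<in> carrier (sect \<XX> U)"
  shows "(\<Union>(V, a)\<in>germ \<XX> x U s. \<Union>(W, b)\<in>germ \<XX> x U t.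
      germ \<XX> x (V \<inter> W) (f (V \<inter> W) (restr \<XX> V (V \<inter> W) a) (restr \<XX> W (V \<inter> W) b))) = germ \<XX> x U (f U s t)"
proof -
  have "germ \<XX> x (V \<inter> W) (f (V \<inter> W) (restr \<XX> V (V \<inter> W) a) (restr \<XX> W (V \<inter> W) b)) = germ \<XX> x U (f U s t)"
    if Va: "(V, a) \<in> germ \<XX> x U s" and Wb: "(W, b) \<in> germ \<XX> x U t" for V W a b
  proof -
    from Va obtain N where V: "openin (topo \<XX>) V" "x \<in> V" "a \<in> carrier (sect \<XX> V)"
      and N: "openin (topo \<XX>) N" "x \<in> N" "N \<subseteq> U \<inter> V" "restr \<XX> U N s = restr \<XX> V N a"
      unfolding germ_mem_iff by blast
    from Wb obtain N' where W: "openin (topo \<XX>) W" "x \<in> W" "b \<in> carrier (sect \<XX> W)"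
      and N': "openin (topo \<XX>) N'" "x \<in> N'" "N' \<subseteq> U \<inter> W" "restr \<XX> U N' t = restr \<XX> W N' b"
      unfolding germ_mem_iff by blast
    let ?M = "N \<inter> N'" and ?O = "V \<inter> W"
    have M: "openin (topo \<XX>) ?M" "?M \<subseteq> U" "?M \<subseteq> ?O" and O': "openin (topo \<XX>) ?O"
      using N N' V W by auto
    have a: "restr \<XX> V ?O a \<in> carrier (sect \<XX> ?O)" and b: "restr \<XX> W ?O b \<in> carrier (sect \<XX> ?O)"
      using restr_closed V W O' by auto
    have "restr \<XX> V ?M a = restr \<XX> N ?M (restr \<XX> V N a)"
      using restr_restr[OF V(1) N(1) M(1) _ _ V(3)] N(3) by simp
    also have "\<dots> = restr \<XX> U ?M s"
      unfolding N(4)[symmetric] using restr_restr[OF U(1) N(1) M(1) _ _ s] N(3) by simp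
    finally have as: "restr \<XX> V ?M a = restr \<XX> U ?M s" .
    have "restr \<XX> W ?M b = restr \<XX> N' ?M (restr \<XX> W N' b)"
      using restr_restr[OF W(1) N'(1) M(1) _ _ W(3)] N'(3) by simp
    also have "\<dots> = restr \<XX> U ?M t"
      unfolding N'(4)[symmetric] using restr_restr[OF U(1) N'(1) M(1) _ _ t] N'(3) by simp
    finally have bt: "restr \<XX> W ?M b = restr \<XX> U ?M t" .
    have "restr \<XX> ?O ?M (f ?O (restr \<XX> V ?O a) (restr \<XX> W ?O b))
        = f ?M (restr \<XX> ?O ?M (restr \<XX> V ?O a)) (restr \<XX> ?O ?M (restr \<XX> W ?O b))"
      using op[OF O' M(1,3) a b] by simp
    also have "\<dots> = f ?M (restr \<XX> U ?M s) (restr \<XX> U ?M t)"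
      unfolding as[symmetric] bt[symmetric]
      using restr_restr[OF V(1) O' M(1) M(3) _ V(3)] restr_restr[OF W(1) O' M(1) M(3) _ W(3)] by simp
    also have "\<dots> = restr \<XX> U ?M (f U s t)"
      using op[OF U(1) M(1,2) s t] by simp
    finally have eq: "restr \<XX> ?O ?M (f ?O (restr \<XX> V ?O a) (restr \<XX> W ?O b)) = restr \<XX> U ?M (f U s t)" .
    have "x \<in> ?O" "x \<in> ?M" using V W N N' by auto
    moreover have "f ?O (restr \<XX> V ?O a) (restr \<XX> W ?O b) \<in> carrier (sect \<XX> ?O)"
      using op[OF O' O' _ a b] by simp
    moreover have "f U s t \<in> carrier (sect \<XX> U)" using op[OF U(1) U(1) _ s t] by simp
    ultimately show ?thesis
      using M eq O' U by (subst germ_eq_iff) (auto intro!: exI[of _ ?M])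
  qed
  moreover have "(U, s) \<in> germ \<XX> x U s" "(U, t) \<in> germ \<XX> x U t"
    using germ_self U s t by auto
  ultimately show ?thesis by fast
qed

lemma germ_hom:
  assumes U: "openin (topo \<XX>) U" "x \<in> U"
  shows "germ \<XX> x U \<in> ring_hom (sect \<XX> U) (stalk \<XX> x)"
proof (rule ring_hom_memI)
  fix s t assume s: "s \<in> carrier (sect \<XX> U)" and t: "t \<in> carrier (sect \<XX> U)"
  show "germ \<XX> x U s \<in> carrier (stalk \<XX> x)" by (rule germ_closed[OF U s])
  have hom: "restr \<XX> U V \<in> ring_hom (sect \<XX> U) (sect \<XX> V)" "cring (sect \<XX> U)"
    if "openin (topo \<XX>) U" "openin (topo \<XX>) V" "V \<subseteq> U" for U V
    using that restr_hom sect_cring by auto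
  show "germ \<XX> x U (s \<otimes>\<^bsub>sect \<XX> U\<^esub> t) = germ \<XX> x U s \<otimes>\<^bsub>stalk \<XX> x\<^esub> germ \<XX> x U t"
    using germ_operation[of "\<lambda>U. monoid.mult (sect \<XX> U)", OF _ U s t] hom
    by (simp add: stalk_def ring_hom_mult monoid.m_closed[OF ring.is_monoid[OF cring.axioms(1)]])
  show "germ \<XX> x U (s \<oplus>\<^bsub>sect \<XX> U\<^esub> t) = germ \<XX> x U s \<oplus>\<^bsub>stalk \<XX> x\<^esub> germ \<XX> x U t"
    using germ_operation[of "\<lambda>U. ring.add (sect \<XX> U)", OF _ U s t] hom
    by (simp add: stalk_def ring_hom_add
        abelian_monoid.a_closed[OF abelian_group.axioms(1)[OF ring.is_abelian_group[OF cring.axioms(1)]]])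
next
  interpret P: cring "sect \<XX> (points \<XX>)" by (rule sect_cring) simp
  have sub: "U \<subseteq> points \<XX>" using openin_subset[OF U(1)] .
  have "germ \<XX> x (points \<XX>) \<one>\<^bsub>sect \<XX> (points \<XX>)\<^esub>
      = germ \<XX> x U (restr \<XX> (points \<XX>) U \<one>\<^bsub>sect \<XX> (points \<XX>)\<^esub>)"
    using germ_restr[of "points \<XX>" U x] U sub by simp
  also have "restr \<XX> (points \<XX>) U \<one>\<^bsub>sect \<XX> (points \<XX>)\<^esub> = \<one>\<^bsub>sect \<XX> U\<^esub>"
    using ring_hom_one[OF restr_hom[of "points \<XX>" U]] U sub by simp
  finally show "germ \<XX> x U \<one>\<^bsub>sect \<XX> U\<^esub> = \<one>\<^bsub>stalk \<XX> x\<^esub>" by (simp add: stalk_def)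
qed

end

text \<open>The sections over \<open>U\<close> whose value in the residue field at \<open>x\<close> is zero.\<close>

definition vanishing_ideal :: "('x, 'r) rspace \<Rightarrow> 'x set \<Rightarrow> 'x \<Rightarrow> 'r set" where
  "vanishing_ideal \<XX> U x = comap (sect \<XX> U) (germ \<XX> x U) (max_ideal (stalk \<XX> x))"

lemma vanishing_ideal_iff:
  "s \<in> vanishing_ideal \<XX> U x \<longleftrightarrow> s \<in> carrier (sect \<XX> U) \<and> germ \<XX> x U s \<in> max_ideal (stalk \<XX> x)"
  by (simp add: vanishing_ideal_def comap_def)

context locally_ringed_space
begin

lemma stalk_local_at: "openin (topo \<XX>) U \<Longrightarrow> x \<in> U \<Longrightarrow> local_ring (stalk \<XX> x)"
  using stalk_local openin_subset by blast

lemma vanishing_ideal_prime: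
  assumes "openin (topo \<XX>) U" "x \<in> U"
  shows "primeideal (vanishing_ideal \<XX> U x) (sect \<XX> U)"
  unfolding vanishing_ideal_def
  by (rule primeideal_comap[OF sect_cring[OF assms(1)] germ_hom[OF assms]
        local_ringD(3)[OF stalk_local_at[OF assms]]])

lemma vanishing_restr:
  assumes "openin (topo \<XX>) U" "openin (topo \<XX>) V" "V \<subseteq> U" "x \<in> V" "s \<in> carrier (sect \<XX> U)"
  shows "restr \<XX> U V s \<in> vanishing_ideal \<XX> V x \<longleftrightarrow> s \<in> vanishing_ideal \<XX> U x"
  using germ_restr[OF assms] restr_closed[OF assms(1-3,5)] assms(5) by (simp add: vanishing_ideal_iff)

text \<open>The maximal ideal of a local ring consists of the non-units, and an inverse of a germ is the germ of an
  inverse on some neighbourhood. So vanishing can be recognised from sections alone.\<close>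

lemma nonvanishing_iff_invertible:
  assumes U: "openin (topo \<XX>) U" "x \<in> U" and s: "s \<in> carrier (sect \<XX> U)"
  shows "s \<notin> vanishing_ideal \<XX> U x \<longleftrightarrow> (\<exists>W t. openin (topo \<XX>) W \<and> x \<in> W \<and> W \<subseteq> U \<and>
    t \<in> carrier (sect \<XX> W) \<and> restr \<XX> U W s \<otimes>\<^bsub>sect \<XX> W\<^esub> t = \<one>\<^bsub>sect \<XX> W\<^esub>)" (is "_ \<longleftrightarrow> ?R")
proof -
  note loc = stalk_local_at[OF U]
  interpret S: cring "stalk \<XX> x" by (rule local_ringD(1)[OF loc])
  have gs: "germ \<XX> x U s \<in> carrier (stalk \<XX> x)" by (rule germ_closed[OF U s])
  have "s \<notin> vanishing_ideal \<XX> U x \<longleftrightarrow> germ \<XX> x U s \<in> Units (stalk \<XX> x)"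
    using max_ideal_eq_nonunits[OF loc] gs s by (simp add: vanishing_ideal_iff)
  also have "\<dots> \<longleftrightarrow> ?R"
  proof
    assume "germ \<XX> x U s \<in> Units (stalk \<XX> x)"
    then obtain B where "B \<in> carrier (stalk \<XX> x)" and one: "germ \<XX> x U s \<otimes>\<^bsub>stalk \<XX> x\<^esub> B = \<one>\<^bsub>stalk \<XX> x\<^esub>"
      using S.Units_r_inv_ex by blast
    then obtain V t where V: "openin (topo \<XX>) V" "x \<in> V" "t \<in> carrier (sect \<XX> V)" and B: "B = germ \<XX> x V t"
      by (rule_tac stalk_carrierE) auto
    let ?N = "U \<inter> V"
    have N: "openin (topo \<XX>) ?N" "x \<in> ?N" using U V by auto
    let ?s = "restr \<XX> U ?N s" and ?t = "restr \<XX> V ?N t"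
    interpret N: cring "sect \<XX> ?N" by (rule sect_cring[OF N(1)])
    have st: "?s \<in> carrier (sect \<XX> ?N)" "?t \<in> carrier (sect \<XX> ?N)"
      using restr_closed U V N s by auto
    have "germ \<XX> x ?N (?s \<otimes>\<^bsub>sect \<XX> ?N\<^esub> ?t) = germ \<XX> x ?N ?s \<otimes>\<^bsub>stalk \<XX> x\<^esub> germ \<XX> x ?N ?t"
      by (rule ring_hom_mult[OF germ_hom[OF N] st])
    also have "\<dots> = germ \<XX> x U s \<otimes>\<^bsub>stalk \<XX> x\<^esub> germ \<XX> x V t"
      using germ_restr[OF U(1) N(1) _ N(2) s] germ_restr[OF V(1) N(1) _ N(2) V(3)] by simp
    also have "\<dots> = germ \<XX> x ?N \<one>\<^bsub>sect \<XX> ?N\<^esub>"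
      using one B ring_hom_one[OF germ_hom[OF N]] by simp
    finally obtain W where W: "openin (topo \<XX>) W" "x \<in> W" "W \<subseteq> ?N"
      and eq: "restr \<XX> ?N W (?s \<otimes>\<^bsub>sect \<XX> ?N\<^esub> ?t) = restr \<XX> ?N W \<one>\<^bsub>sect \<XX> ?N\<^esub>"
      using germ_eq_iff[OF N _ N, of "?s \<otimes>\<^bsub>sect \<XX> ?N\<^esub> ?t" "\<one>\<^bsub>sect \<XX> ?N\<^esub>"] st by auto
    note rh = restr_hom[OF N(1) W(1,3)]
    have "restr \<XX> U W s \<otimes>\<^bsub>sect \<XX> W\<^esub> restr \<XX> V W t = \<one>\<^bsub>sect \<XX> W\<^esub>"
      using eq ring_hom_mult[OF rh st] ring_hom_one[OF rh]
        restr_restr[OF U(1) N(1) W(1,3) _ s] restr_restr[OF V(1) N(1) W(1,3) _ V(3)] by simp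
    moreover have "restr \<XX> V W t \<in> carrier (sect \<XX> W)"
      using restr_closed[OF V(1) W(1) _ V(3)] W(3) by blast
    ultimately show ?R using W by (intro exI[of _ W] exI[of _ "restr \<XX> V W t"]) simp
  next
    assume ?R
    then obtain W t where W: "openin (topo \<XX>) W" "x \<in> W" "W \<subseteq> U" and t: "t \<in> carrier (sect \<XX> W)"
      and one: "restr \<XX> U W s \<otimes>\<^bsub>sect \<XX> W\<^esub> t = \<one>\<^bsub>sect \<XX> W\<^esub>" by blast
    note gh = germ_hom[OF W(1,2)]
    have "germ \<XX> x U s \<otimes>\<^bsub>stalk \<XX> x\<^esub> germ \<XX> x W t = \<one>\<^bsub>stalk \<XX> x\<^esub>"
      using ring_hom_mult[OF gh restr_closed[OF U(1) W(1,3) s] t] one ring_hom_one[OF gh]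
        germ_restr[OF U(1) W(1,3,2) s] by simp
    moreover have gt: "germ \<XX> x W t \<in> carrier (stalk \<XX> x)" by (rule germ_closed[OF W(1,2) t])
    ultimately show "germ \<XX> x U s \<in> Units (stalk \<XX> x)"
      using gs S.m_comm[OF gs gt] unfolding Units_def by auto
  qed
  finally show ?thesis .
qed

lemma nonvanishing_locus_open:
  assumes U: "openin (topo \<XX>) U" and s: "s \<in> carrier (sect \<XX> U)"
  shows "openin (topo \<XX>) {x \<in> U. s \<notin> vanishing_ideal \<XX> U x}"
proof (subst openin_subopen, intro ballI)
  fix x assume "x \<in> {x \<in> U. s \<notin> vanishing_ideal \<XX> U x}"
  then obtain W t where W: "openin (topo \<XX>) W" "x \<in> W" "W \<subseteq> U"
    and t: "t \<in> carrier (sect \<XX> W)" "restr \<XX> U W s \<otimes>\<^bsub>sect \<XX> W\<^esub> t = \<one>\<^bsub>sect \<XX> W\<^esub>"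
    using nonvanishing_iff_invertible[OF U _ s] by blast
  have "s \<notin> vanishing_ideal \<XX> U y" if "y \<in> W" for y
  proof -
    have "y \<in> U" using that W(3) by blast
    then show ?thesis using nonvanishing_iff_invertible[OF U _ s, of y] that W t by blast
  qed
  then show "\<exists>T. openin (topo \<XX>) T \<and> x \<in> T \<and> T \<subseteq> {x \<in> U. s \<notin> vanishing_ideal \<XX> U x}"
    using W by blast
qed

end

context lrs_morphism
begin

lemma preim_open: "openin (topo \<XX>) V \<Longrightarrow> openin (topo Y) (preim Y f V)"
  using openin_continuous_map_preimage[OF continuous] by (simp add: preim_def)

lemma pt_in_points: "y \<in> points Y \<Longrightarrow> pt_map f y \<in> points \<XX>"
  using continuous by (auto simp: continuous_map_def)

lemma preim_mono: "V \<subseteq> W \<Longrightarrow> preim Y f V \<subseteq> preim Y f W"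
  by (auto simp: preim_def)

lemma sec_map_closed:
  "openin (topo \<XX>) V \<Longrightarrow> s \<in> carrier (sect \<XX> V) \<Longrightarrow> sec_map f V s \<in> carrier (sect Y (preim Y f V))"
  using ring_hom_closed[OF sec_hom] .

text \<open>All members of the union that defines \<open>stalk_map\<close> are the same germ.\<close>

lemma stalk_map_germ:
  assumes y: "y \<in> points Y" and V: "openin (topo \<XX>) V" "pt_map f y \<in> V" and s: "s \<in> carrier (sect \<XX> V)"
  shows "stalk_map Y f y (germ \<XX> (pt_map f y) V s) = germ Y y (preim Y f V) (sec_map f V s)"
proof -
  have restr: "germ Y y (preim Y f W) (sec_map f W (restr \<XX> V W s)) = germ Y y (preim Y f V) (sec_map f V s)"
    if "openin (topo \<XX>) V" "s \<in> carrier (sect \<XX> V)" "openin (topo \<XX>) W" "pt_map f y \<in> W" "W \<subseteq> V" for V W s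
    using that y dom.germ_restr[OF preim_open[of V] preim_open[of W] preim_mono[of W V] _ sec_map_closed[of V s], of y]
    by (simp add: sec_natural preim_def)
  have "germ Y y (preim Y f V') (sec_map f V' t) = germ Y y (preim Y f V) (sec_map f V s)"
    if mem: "(V', t) \<in> germ \<XX> (pt_map f y) V s" for V' t
  proof -
    obtain W where V': "openin (topo \<XX>) V'" "t \<in> carrier (sect \<XX> V')"
      and W: "openin (topo \<XX>) W" "pt_map f y \<in> W" "W \<subseteq> V \<inter> V'" "restr \<XX> V W s = restr \<XX> V' W t"
      using mem unfolding cod.germ_mem_iff by blast
    then show ?thesis using restr[OF V(1) s W(1,2)] restr[OF V' W(1,2)] by simp
  qed
  moreover have "(V, s) \<in> germ \<XX> (pt_map f y) V s" by (rule cod.germ_self[OF V s])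
  ultimately show ?thesis unfolding stalk_map_def by fast
qed

lemma vanishing_sec_map:
  assumes y: "y \<in> points Y" and V: "openin (topo \<XX>) V" "pt_map f y \<in> V" and s: "s \<in> carrier (sect \<XX> V)"
  shows "sec_map f V s \<in> vanishing_ideal Y (preim Y f V) y \<longleftrightarrow> s \<in> vanishing_ideal \<XX> V (pt_map f y)"
  using local_homD(2)[OF stalk_local_hom[OF y] cod.germ_closed[OF V s]] stalk_map_germ[OF assms] s
    sec_map_closed[OF V(1) s] by (simp add: vanishing_ideal_iff)

end

section \<open>Fractions and the spectrum of a ring\<close>

context plain_cring
begin

lemma loc_frac_eq_iff:
  assumes M: "M \<subseteq> carrier R" "\<one> \<in> M" "\<And>a b. \<lbrakk>a \<in> M; b \<in> M\<rbrakk> \<Longrightarrow> a \<otimes> b \<in> M"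
    and ab: "a \<in> carrier R" "b \<in> carrier R" "s \<in> M" "t \<in> M"
  shows "loc_frac R M a s = loc_frac R M b t \<longleftrightarrow> (\<exists>u\<in>M. u \<otimes> (a \<otimes> t) = u \<otimes> (b \<otimes> s))" (is "_ \<longleftrightarrow> ?E a s b t")
proof
  have "(b, t) \<in> loc_frac R M b t" using M(2) ab by (auto simp: loc_frac_def)
  moreover assume "loc_frac R M a s = loc_frac R M b t"
  ultimately have "(b, t) \<in> loc_frac R M a s" by simp
  then show "?E a s b t" by (auto simp: loc_frac_def)
next
  have sub: "loc_frac R M a s \<subseteq> loc_frac R M b t"
    if ab: "a \<in> carrier R" "b \<in> carrier R" "s \<in> M" "t \<in> M" and E: "?E a s b t" for a b s t
  proof (clarsimp simp: loc_frac_def)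
    fix c r v assume c: "c \<in> carrier R" "r \<in> M" "v \<in> M" "v \<otimes> (a \<otimes> r) = v \<otimes> (c \<otimes> s)"
    obtain u where u: "u \<in> M" "u \<otimes> (a \<otimes> t) = u \<otimes> (b \<otimes> s)" using E by blast
    have m: "s \<in> carrier R" "t \<in> carrier R" "u \<in> carrier R" "v \<in> carrier R" "r \<in> carrier R"
      using M(1) ab u c by auto
    have "(u \<otimes> v \<otimes> s) \<otimes> (b \<otimes> r) = (v \<otimes> r) \<otimes> (u \<otimes> (b \<otimes> s))" using m ab c(1) by (simp add: m_ac)
    also have "\<dots> = (u \<otimes> t) \<otimes> (v \<otimes> (a \<otimes> r))" unfolding u(2)[symmetric] using m ab c(1) by (simp add: m_ac)
    also have "\<dots> = (u \<otimes> v \<otimes> s) \<otimes> (c \<otimes> t)" unfolding c(4) using m ab c(1) by (simp add: m_ac)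
    finally show "\<exists>u\<in>M. u \<otimes> (b \<otimes> r) = u \<otimes> (c \<otimes> t)" using M(3) u(1) c(3) ab(3) by blast
  qed
  assume E: "?E a s b t"
  then have "?E b t a s" by metis
  with E show "loc_frac R M a s = loc_frac R M b t" using sub ab by (intro equalityI) auto
qed

lemma loc_frac_self: "\<lbrakk>\<one> \<in> M; a \<in> carrier R; s \<in> M\<rbrakk> \<Longrightarrow> (a, s) \<in> loc_frac R M a s"
  by (auto simp: loc_frac_def)

lemma loc_frac_mult:
  assumes M: "M \<subseteq> carrier R" "\<one> \<in> M" "\<And>a b. \<lbrakk>a \<in> M; b \<in> M\<rbrakk> \<Longrightarrow> a \<otimes> b \<in> M"
    and ab: "a \<in> carrier R" "b \<in> carrier R" "s \<in> M" "t \<in> M"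
  shows "loc_frac R M a s \<otimes>\<^bsub>localization R M\<^esub> loc_frac R M b t = loc_frac R M (a \<otimes> b) (s \<otimes> t)"
proof -
  have "loc_frac R M (a' \<otimes> b') (s' \<otimes> t') = loc_frac R M (a \<otimes> b) (s \<otimes> t)"
    if mem: "(a', s') \<in> loc_frac R M a s" "(b', t') \<in> loc_frac R M b t" for a' s' b' t'
  proof -
    obtain u v where u: "a' \<in> carrier R" "s' \<in> M" "u \<in> M" "u \<otimes> (a \<otimes> s') = u \<otimes> (a' \<otimes> s)"
      and v: "b' \<in> carrier R" "t' \<in> M" "v \<in> M" "v \<otimes> (b \<otimes> t') = v \<otimes> (b' \<otimes> t)"
      using mem by (auto simp: loc_frac_def)
    have m: "s \<in> carrier R" "t \<in> carrier R" "s' \<in> carrier R" "t' \<in> carrier R" "u \<in> carrier R" "v \<in> carrier R"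
      using M(1) ab u v by auto
    have "(u \<otimes> v) \<otimes> ((a' \<otimes> b') \<otimes> (s \<otimes> t)) = (u \<otimes> (a' \<otimes> s)) \<otimes> (v \<otimes> (b' \<otimes> t))"
      using m ab u(1) v(1) by (simp add: m_ac)
    also have "\<dots> = (u \<otimes> v) \<otimes> ((a \<otimes> b) \<otimes> (s' \<otimes> t'))"
      unfolding u(4)[symmetric] v(4)[symmetric] using m ab u(1) v(1) by (simp add: m_ac)
    finally show ?thesis
      using M ab u v by (subst loc_frac_eq_iff[OF M]) (auto intro!: bexI[of _ "u \<otimes> v"])
  qed
  then have "(\<Union>(a', s')\<in>loc_frac R M a s. \<Union>(b', t')\<in>loc_frac R M b t. loc_frac R M (a' \<otimes> b') (s' \<otimes> t'))
      = (\<Union>z\<in>loc_frac R M a s. \<Union>w\<in>loc_frac R M b t. loc_frac R M (a \<otimes> b) (s \<otimes> t))"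
    by (intro SUP_cong refl) (auto split: prod.splits)
  also have "\<dots> = loc_frac R M (a \<otimes> b) (s \<otimes> t)"
    using loc_frac_self[OF M(2)] ab by (simp add: SUP_constant) blast
  finally show ?thesis by (simp add: localization_def)
qed

lemma loc_frac_add:
  assumes M: "M \<subseteq> carrier R" "\<one> \<in> M" "\<And>a b. \<lbrakk>a \<in> M; b \<in> M\<rbrakk> \<Longrightarrow> a \<otimes> b \<in> M"
    and ab: "a \<in> carrier R" "b \<in> carrier R" "s \<in> M" "t \<in> M"
  shows "loc_frac R M a s \<oplus>\<^bsub>localization R M\<^esub> loc_frac R M b t
    = loc_frac R M (a \<otimes> t \<oplus> b \<otimes> s) (s \<otimes> t)"
proof -
  have "loc_frac R M (a' \<otimes> t' \<oplus> b' \<otimes> s') (s' \<otimes> t') = loc_frac R M (a \<otimes> t \<oplus> b \<otimes> s) (s \<otimes> t)"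
    if mem: "(a', s') \<in> loc_frac R M a s" "(b', t') \<in> loc_frac R M b t" for a' s' b' t'
  proof -
    obtain u v where u: "a' \<in> carrier R" "s' \<in> M" "u \<in> M" "u \<otimes> (a \<otimes> s') = u \<otimes> (a' \<otimes> s)"
      and v: "b' \<in> carrier R" "t' \<in> M" "v \<in> M" "v \<otimes> (b \<otimes> t') = v \<otimes> (b' \<otimes> t)"
      using mem by (auto simp: loc_frac_def)
    have m: "s \<in> carrier R" "t \<in> carrier R" "s' \<in> carrier R" "t' \<in> carrier R" "u \<in> carrier R" "v \<in> carrier R"
      using M(1) ab u v by auto
    have "(u \<otimes> v) \<otimes> ((a' \<otimes> t' \<oplus> b' \<otimes> s') \<otimes> (s \<otimes> t))
        = (v \<otimes> t \<otimes> t') \<otimes> (u \<otimes> (a' \<otimes> s)) \<oplus> (u \<otimes> s \<otimes> s') \<otimes> (v \<otimes> (b' \<otimes> t))"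
      using m ab u(1) v(1) by (simp add: l_distr r_distr m_ac)
    also have "\<dots> = (u \<otimes> v) \<otimes> ((a \<otimes> t \<oplus> b \<otimes> s) \<otimes> (s' \<otimes> t'))"
      unfolding u(4)[symmetric] v(4)[symmetric] using m ab u(1) v(1) by (simp add: l_distr r_distr m_ac)
    finally show ?thesis
      using M ab u v m by (subst loc_frac_eq_iff[OF M]) (auto intro!: bexI[of _ "u \<otimes> v"])
  qed
  then have "(\<Union>(a', s')\<in>loc_frac R M a s. \<Union>(b', t')\<in>loc_frac R M b t. loc_frac R M (a' \<otimes> t' \<oplus> b' \<otimes> s') (s' \<otimes> t'))
      = (\<Union>z\<in>loc_frac R M a s. \<Union>w\<in>loc_frac R M b t. loc_frac R M (a \<otimes> t \<oplus> b \<otimes> s) (s \<otimes> t))"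
    by (intro SUP_cong refl) (auto split: prod.splits)
  also have "\<dots> = loc_frac R M (a \<otimes> t \<oplus> b \<otimes> s) (s \<otimes> t)"
    using loc_frac_self[OF M(2)] ab by (simp add: SUP_constant) blast
  finally show ?thesis by (simp add: localization_def)
qed

end

text \<open>That \<open>Spec A\<close> is a locally ringed space is part of any isomorphism of such spaces with \<open>Spec A\<close>.\<close>

locale spectrum = plain_cring A + spec: locally_ringed_space "Spec A" for A :: "'a ring" (structure)
begin

abbreviation \<Gamma> :: "('a set \<Rightarrow> ('a \<times> 'a) set) ring" where
  "\<Gamma> \<equiv> sect (Spec A) (points (Spec A))"

definition fraction :: "'a set set \<Rightarrow> 'a \<Rightarrow> 'a \<Rightarrow> 'a set \<Rightarrow> ('a \<times> 'a) set" where
  "fraction V a b = (\<lambda>q\<in>V. loc_frac A (carrier A - q) a b)"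

definition global :: "'a \<Rightarrow> 'a set \<Rightarrow> ('a \<times> 'a) set" where
  "global a = fraction (points (Spec A)) a \<one>"

definition basic_open :: "'a \<Rightarrow> 'a set set" where
  "basic_open a = {q. primeideal q A \<and> a \<notin> q}"

lemma zariski_basic_open: "a \<in> carrier A \<Longrightarrow> zariski_open A (basic_open a)"
  unfolding zariski_open_def basic_open_def by (intro exI[of _ "{a}"]) auto

lemma complement_multiplicative:
  assumes "primeideal q A"
  shows "carrier A - q \<subseteq> carrier A" "\<one> \<in> carrier A - q"
    "\<And>a b. \<lbrakk>a \<in> carrier A - q; b \<in> carrier A - q\<rbrakk> \<Longrightarrow> a \<otimes> b \<in> carrier A - q"
  using prime_idealD[OF assms] by auto

lemma frac_eq_iff:
  assumes q: "primeideal q A" and ab: "a \<in> carrier A" "b \<in> carrier A"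
    and st: "s \<in> carrier A - q" "t \<in> carrier A - q"
  shows "loc_frac A (carrier A - q) a s = loc_frac A (carrier A - q) b t \<longleftrightarrow>
    (\<exists>u\<in>carrier A - q. u \<otimes> (a \<otimes> t) = u \<otimes> (b \<otimes> s))"
  by (rule loc_frac_eq_iff[OF complement_multiplicative(1,2)[OF q] _ ab st])
    (rule complement_multiplicative(3)[OF q])

lemma frac_mult:
  assumes q: "primeideal q A" and ab: "a \<in> carrier A" "b \<in> carrier A"
    and st: "s \<in> carrier A - q" "t \<in> carrier A - q"
  shows "loc_frac A (carrier A - q) a s \<otimes>\<^bsub>localization_at_prime A q\<^esub> loc_frac A (carrier A - q) b t
    = loc_frac A (carrier A - q) (a \<otimes> b) (s \<otimes> t)"
  by (rule loc_frac_mult[OF complement_multiplicative(1,2)[OF q] _ ab st])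
    (rule complement_multiplicative(3)[OF q])

lemma frac_add:
  assumes q: "primeideal q A" and ab: "a \<in> carrier A" "b \<in> carrier A"
    and st: "s \<in> carrier A - q" "t \<in> carrier A - q"
  shows "loc_frac A (carrier A - q) a s \<oplus>\<^bsub>localization_at_prime A q\<^esub> loc_frac A (carrier A - q) b t
    = loc_frac A (carrier A - q) (a \<otimes> t \<oplus> b \<otimes> s) (s \<otimes> t)"
  by (rule loc_frac_add[OF complement_multiplicative(1,2)[OF q] _ ab st])
    (rule complement_multiplicative(3)[OF q])

lemma zariski_prime: "zariski_open A V \<Longrightarrow> q \<in> V \<Longrightarrow> primeideal q A"
  unfolding zariski_open_def by auto

lemma Spec_simps:
  "carrier (sect (Spec A) V) = spec_sections A V"
  "\<sigma> \<otimes>\<^bsub>sect (Spec A) V\<^esub> \<tau> = (\<lambda>p\<in>V. \<sigma> p \<otimes>\<^bsub>localization_at_prime A p\<^esub> \<tau> p)"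
  "\<sigma> \<oplus>\<^bsub>sect (Spec A) V\<^esub> \<tau> = (\<lambda>p\<in>V. \<sigma> p \<oplus>\<^bsub>localization_at_prime A p\<^esub> \<tau> p)"
  "\<one>\<^bsub>sect (Spec A) V\<^esub> = fraction V \<one> \<one>" "\<zero>\<^bsub>sect (Spec A) V\<^esub> = fraction V \<zero> \<one>"
  "restr (Spec A) U V \<sigma> = restrict \<sigma> V"
  by (simp_all add: Spec_def fraction_def localization_def)

lemma fraction_closed:
  assumes "zariski_open A V" "a \<in> carrier A" "b \<in> carrier A" "\<And>q. q \<in> V \<Longrightarrow> b \<notin> q"
  shows "fraction V a b \<in> carrier (sect (Spec A) V)"
proof -
  have "loc_frac A (carrier A - q) a b \<in> carrier (localization_at_prime A q)" if "q \<in> V" for q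
    using assms(2,3) assms(4)[OF that] unfolding localization_def by auto
  then have "fraction V a b \<in> (\<Pi>\<^sub>E q\<in>V. carrier (localization_at_prime A q))"
    by (simp add: fraction_def)
  moreover have "\<exists>W c d. zariski_open A W \<and> p \<in> W \<and> W \<subseteq> V \<and> c \<in> carrier A \<and> d \<in> carrier A \<and>
      (\<forall>q\<in>W. d \<notin> q \<and> fraction V a b q = loc_frac A (carrier A - q) c d)" if "p \<in> V" for p
    by (rule exI[of _ V], rule exI[of _ a], rule exI[of _ b]) (use that assms in \<open>simp add: fraction_def\<close>)
  ultimately show ?thesis unfolding Spec_simps spec_sections_def by blast
qed

lemma fraction_restr: "V \<subseteq> U \<Longrightarrow> restrict (fraction U a b) V = fraction V a b"
  by (auto simp: fraction_def fun_eq_iff restrict_def)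

lemma fraction_mult:
  assumes V: "zariski_open A V" and "a \<in> carrier A" "b \<in> carrier A" "c \<in> carrier A" "d \<in> carrier A"
    "\<And>q. q \<in> V \<Longrightarrow> b \<notin> q" "\<And>q. q \<in> V \<Longrightarrow> d \<notin> q"
  shows "fraction V a b \<otimes>\<^bsub>sect (Spec A) V\<^esub> fraction V c d = fraction V (a \<otimes> c) (b \<otimes> d)"
proof -
  have "loc_frac A (carrier A - q) a b \<otimes>\<^bsub>localization_at_prime A q\<^esub> loc_frac A (carrier A - q) c d
      = loc_frac A (carrier A - q) (a \<otimes> c) (b \<otimes> d)" if q: "q \<in> V" for q
    by (rule frac_mult[OF zariski_prime[OF V q]]) (use assms q in auto)
  then show ?thesis unfolding Spec_simps fraction_def by (simp add: restrict_def fun_eq_iff)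
qed

lemma fraction_eqI:
  assumes V: "zariski_open A V" and "a \<in> carrier A" "b \<in> carrier A" "c \<in> carrier A" "d \<in> carrier A"
    "\<And>q. q \<in> V \<Longrightarrow> b \<notin> q" "\<And>q. q \<in> V \<Longrightarrow> d \<notin> q" and eq: "a \<otimes> d = c \<otimes> b"
  shows "fraction V a b = fraction V c d"
proof -
  have "loc_frac A (carrier A - q) a b = loc_frac A (carrier A - q) c d" if q: "q \<in> V" for q
  proof -
    note qp = zariski_prime[OF V q]
    show ?thesis
      using assms(2-7) eq q complement_multiplicative(2)[OF qp]
      by (subst frac_eq_iff[OF qp]) (auto intro!: bexI[of _ \<one>])
  qed
  then show ?thesis by (auto simp: fraction_def restrict_def fun_eq_iff)
qed

lemma points_open: "zariski_open A (points (Spec A))"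
  using openin_topspace openin_Spec by blast

lemma global_closed: "a \<in> carrier A \<Longrightarrow> global a \<in> carrier \<Gamma>"
  unfolding global_def using points_open prime_idealD(5)
  by (intro fraction_closed) (auto simp: points_Spec)

lemma global_hom: "global \<in> ring_hom A \<Gamma>"
proof (rule ring_hom_memI)
  have one: "\<one> \<notin> q" if "q \<in> points (Spec A)" for q using that prime_idealD(5) by (simp add: points_Spec)
  fix a b assume ab: "a \<in> carrier A" "b \<in> carrier A"
  show "global a \<in> carrier \<Gamma>" by (rule global_closed[OF ab(1)])
  show "global (a \<otimes> b) = global a \<otimes>\<^bsub>\<Gamma>\<^esub> global b"
    unfolding global_def using fraction_mult[OF points_open ab(1) one_closed ab(2) one_closed] one by simp
  have "loc_frac A (carrier A - q) a \<one> \<oplus>\<^bsub>localization_at_prime A q\<^esub> loc_frac A (carrier A - q) b \<one>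
      = loc_frac A (carrier A - q) (a \<oplus> b) \<one>" if "q \<in> points (Spec A)" for q
    using that frac_add[of q a b \<one> \<one>] ab one by (simp add: points_Spec)
  then show "global (a \<oplus> b) = global a \<oplus>\<^bsub>\<Gamma>\<^esub> global b"
    unfolding Spec_simps global_def fraction_def by (auto simp: restrict_def fun_eq_iff)
qed (simp add: Spec_simps global_def)

text \<open>If \<open>a \<notin> p\<close>, then \<open>1 / a\<close> is an inverse on the basic open set of \<open>a\<close>. Conversely, an inverse of \<open>a / 1\<close>
  near \<open>p\<close> has the form \<open>c / d\<close> in the localisation at \<open>p\<close>, and \<open>u a c = u d\<close> with \<open>u, d \<notin> p\<close> excludes \<open>a \<in> p\<close>.\<close>

lemma global_vanishing_iff:
  assumes a: "a \<in> carrier A" and p: "primeideal p A"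
  shows "global a \<in> vanishing_ideal (Spec A) (points (Spec A)) p \<longleftrightarrow> a \<in> p"
proof -
  let ?P = "points (Spec A)"
  have pP: "p \<in> ?P" using p by (simp add: points_Spec)
  note inv = spec.nonvanishing_iff_invertible[OF openin_topspace pP global_closed[OF a]]
  note pD = prime_idealD[OF p]
  show ?thesis
  proof
    assume van: "global a \<in> vanishing_ideal (Spec A) ?P p"
    show "a \<in> p"
    proof (rule ccontr)
      assume ap: "a \<notin> p"
      let ?W = "basic_open a"
      have W: "zariski_open A ?W" "p \<in> ?W" "?W \<subseteq> ?P"
        using zariski_basic_open[OF a] p ap by (auto simp: basic_open_def points_Spec)
      have aW: "a \<notin> q" "\<one> \<notin> q" if "q \<in> ?W" for q
        using that prime_idealD(5) by (auto simp: basic_open_def)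
      have "restr (Spec A) ?P ?W (global a) \<otimes>\<^bsub>sect (Spec A) ?W\<^esub> fraction ?W \<one> a = fraction ?W (a \<otimes> \<one>) (\<one> \<otimes> a)"
        unfolding Spec_simps(6) global_def fraction_restr[OF W(3)]
        by (rule fraction_mult[OF W(1)]) (use a aW in auto)
      also have "\<dots> = fraction ?W \<one> \<one>"
        by (rule fraction_eqI[OF W(1)]) (use a aW in auto)
      finally have "restr (Spec A) ?P ?W (global a) \<otimes>\<^bsub>sect (Spec A) ?W\<^esub> fraction ?W \<one> a = \<one>\<^bsub>sect (Spec A) ?W\<^esub>"
        by (simp only: Spec_simps(4))
      moreover have "fraction ?W \<one> a \<in> carrier (sect (Spec A) ?W)"
        by (rule fraction_closed[OF W(1)]) (use a aW in auto)
      ultimately show False using inv van W openin_Spec by blast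
    qed
  next
    assume ap: "a \<in> p"
    show "global a \<in> vanishing_ideal (Spec A) ?P p"
    proof (rule ccontr)
      assume "\<not> ?thesis"
      then obtain W t where W: "openin (topo (Spec A)) W" "p \<in> W" "W \<subseteq> ?P" and t: "t \<in> carrier (sect (Spec A) W)"
        and one: "restr (Spec A) ?P W (global a) \<otimes>\<^bsub>sect (Spec A) W\<^esub> t = \<one>\<^bsub>sect (Spec A) W\<^esub>"
        using inv by blast
      have "t p \<in> carrier (localization_at_prime A p)"
        using t W(2) by (auto simp: Spec_simps spec_sections_def)
      then obtain c d where c: "c \<in> carrier A" "d \<in> carrier A - p" and tp: "t p = loc_frac A (carrier A - p) c d"
        by (auto simp: localization_def)
      have "loc_frac A (carrier A - p) a \<one> \<otimes>\<^bsub>localization_at_prime A p\<^esub> t p = loc_frac A (carrier A - p) \<one> \<one>"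
        using fun_cong[OF one, of p] W by (simp add: Spec_simps global_def fraction_def subset_iff)
      then have "loc_frac A (carrier A - p) (a \<otimes> c) (\<one> \<otimes> d) = loc_frac A (carrier A - p) \<one> \<one>"
        unfolding tp using frac_mult[OF p a c(1) _ c(2), of \<one>] pD(5) by simp
      then obtain u where u: "u \<in> carrier A - p" "u \<otimes> (a \<otimes> c \<otimes> \<one>) = u \<otimes> (\<one> \<otimes> (\<one> \<otimes> d))"
        using frac_eq_iff[OF p, of "a \<otimes> c" \<one> "\<one> \<otimes> d" \<one>] a c pD(5) by auto
      have "a \<otimes> c \<otimes> \<one> \<in> p" by (intro pD(8) ap c(1) one_closed)
      then have "u \<otimes> (a \<otimes> c \<otimes> \<one>) \<in> p" by (rule pD(9)[OF DiffD1[OF u(1)]])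
      moreover have "u \<otimes> (\<one> \<otimes> (\<one> \<otimes> d)) \<notin> p" using u(1) c(2) by (simp add: pD(10))
      ultimately show False unfolding u(2) by contradiction
    qed
  qed
qed

end

section \<open>Affine open sets\<close>

lemma prime_ideal_diff_iff:
  assumes Q: "primeideal Q R" and xy: "x \<in> carrier R" "y \<in> carrier R"
    and diff: "x \<oplus>\<^bsub>R\<^esub> \<ominus>\<^bsub>R\<^esub> y \<in> Q"
  shows "x \<in> Q \<longleftrightarrow> y \<in> Q"
proof -
  interpret primeideal Q R by (rule Q)
  note QD = prime_idealD[OF Q]
  let ?d = "x \<oplus>\<^bsub>R\<^esub> \<ominus>\<^bsub>R\<^esub> y"
  have x: "?d \<oplus>\<^bsub>R\<^esub> y = x" using xy by (simp add: a_assoc l_neg)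
  have y: "\<ominus>\<^bsub>R\<^esub> ?d \<oplus>\<^bsub>R\<^esub> x = y" using xy r_neg1[of ?d y] x by simp
  show ?thesis
  proof
    assume "x \<in> Q"
    then have "\<ominus>\<^bsub>R\<^esub> ?d \<oplus>\<^bsub>R\<^esub> x \<in> Q" using QD(6)[OF QD(7)[OF diff]] by blast
    then show "y \<in> Q" unfolding y .
  next
    assume "y \<in> Q"
    then have "?d \<oplus>\<^bsub>R\<^esub> y \<in> Q" using QD(6)[OF diff] by blast
    then show "x \<in> Q" unfolding x .
  qed
qed

text \<open>What is used of an affine open set \<open>U\<close>: its points are the primes of the ring of sections over
  it, its topology is generated by non-vanishing loci of these sections, and any section near a
  point of \<open>U\<close> is a fraction of them.\<close>

locale spectrum_like =
  fixes \<XX> :: "('x, 'r) rspace" and U :: "'x set"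
  assumes point_of_prime: "primeideal Q (sect \<XX> U) \<Longrightarrow> \<exists>!x. x \<in> U \<and> vanishing_ideal \<XX> U x = Q"
    and basic_neighbourhood: "\<lbrakk>openin (topo \<XX>) N; x \<in> N; N \<subseteq> U\<rbrakk> \<Longrightarrow>
      \<exists>s\<in>carrier (sect \<XX> U). s \<notin> vanishing_ideal \<XX> U x \<and>
        (\<forall>y\<in>U. s \<notin> vanishing_ideal \<XX> U y \<longrightarrow> y \<in> N)"
    and local_fraction: "\<lbrakk>openin (topo \<XX>) N; x \<in> N; N \<subseteq> U; t \<in> carrier (sect \<XX> N)\<rbrakk> \<Longrightarrow>
      \<exists>N' a s. openin (topo \<XX>) N' \<and> x \<in> N' \<and> N' \<subseteq> N \<and>
        a \<in> carrier (sect \<XX> U) \<and> s \<in> carrier (sect \<XX> U) \<and>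
        (\<forall>y\<in>N'. s \<notin> vanishing_ideal \<XX> U y) \<and>
        restr \<XX> U N' s \<otimes>\<^bsub>sect \<XX> N'\<^esub> restr \<XX> N N' t = restr \<XX> U N' a"

lemma (in locally_ringed_space) vanishing_fraction_iff:
  assumes U: "openin (topo \<XX>) U" and N: "openin (topo \<XX>) N" "N \<subseteq> U" and N': "openin (topo \<XX>) N'" "N' \<subseteq> N"
    and x: "x \<in> N'" and t: "t \<in> carrier (sect \<XX> N)" and a: "a \<in> carrier (sect \<XX> U)"
    and s: "s \<in> carrier (sect \<XX> U)" "s \<notin> vanishing_ideal \<XX> U x"
    and eq: "restr \<XX> U N' s \<otimes>\<^bsub>sect \<XX> N'\<^esub> restr \<XX> N N' t = restr \<XX> U N' a"
  shows "t \<in> vanishing_ideal \<XX> N x \<longleftrightarrow> a \<in> vanishing_ideal \<XX> U x"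
proof -
  have NU: "N' \<subseteq> U" using N N' by blast
  note vD = prime_idealD[OF vanishing_ideal_prime[OF N'(1) x]]
  have c: "restr \<XX> U N' s \<in> carrier (sect \<XX> N')" "restr \<XX> N N' t \<in> carrier (sect \<XX> N')"
    using restr_closed[OF U N'(1) NU s(1)] restr_closed[OF N(1) N' t] by auto
  have "restr \<XX> U N' a \<in> vanishing_ideal \<XX> N' x \<longleftrightarrow> restr \<XX> N N' t \<in> vanishing_ideal \<XX> N' x"
    using vD(10)[OF c] vanishing_restr[OF U N'(1) NU x s(1)] s(2) eq by simp
  then show ?thesis
    using vanishing_restr[OF U N'(1) NU x a] vanishing_restr[OF N(1) N' x t] by simp
qed

context spectrum
begin

abbreviation van :: "'a set \<Rightarrow> ('a set \<Rightarrow> ('a \<times> 'a) set) set" where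
  "van \<equiv> vanishing_ideal (Spec A) (points (Spec A))"

lemma Spec_fraction:
  assumes N: "openin (topo (Spec A)) N" "p \<in> N" and \<sigma>: "\<sigma> \<in> carrier (sect (Spec A) N)"
  obtains V a b where "openin (topo (Spec A)) V" "p \<in> V" "V \<subseteq> N" "a \<in> carrier A" "b \<in> carrier A"
    "\<And>q. q \<in> V \<Longrightarrow> global b \<notin> van q"
    "restr (Spec A) (points (Spec A)) V (global b) \<otimes>\<^bsub>sect (Spec A) V\<^esub> restr (Spec A) N V \<sigma>
      = restr (Spec A) (points (Spec A)) V (global a)"
proof -
  obtain V a b where V: "zariski_open A V" "p \<in> V" "V \<subseteq> N" "a \<in> carrier A" "b \<in> carrier A"
    and val: "\<And>q. q \<in> V \<Longrightarrow> b \<notin> q" "\<And>q. q \<in> V \<Longrightarrow> \<sigma> q = loc_frac A (carrier A - q) a b"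
  proof -
    have "\<forall>p\<in>N. \<exists>V a b. zariski_open A V \<and> p \<in> V \<and> V \<subseteq> N \<and> a \<in> carrier A \<and> b \<in> carrier A \<and>
        (\<forall>q\<in>V. b \<notin> q \<and> \<sigma> q = loc_frac A (carrier A - q) a b)"
      using \<sigma> by (simp add: Spec_simps(1) spec_sections_def)
    from bspec[OF this N(2)] show thesis using that by metis
  qed
  have VP: "V \<subseteq> points (Spec A)" using zariski_prime[OF V(1)] by (auto simp: points_Spec)
  have one: "\<one> \<notin> q" if "q \<in> V" for q using zariski_prime[OF V(1) that] prime_idealD(5) by blast
  have \<sigma>V: "restrict \<sigma> V = fraction V a b" unfolding fraction_def by (rule restrict_ext) (rule val(2))
  show thesis
  proof (rule that[of V a b])
    show "openin (topo (Spec A)) V" using V(1) by (simp add: openin_Spec)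
    show "global b \<notin> van q" if "q \<in> V" for q
      using global_vanishing_iff[OF V(5) zariski_prime[OF V(1) that]] val(1)[OF that] by simp
    show "restr (Spec A) (points (Spec A)) V (global b) \<otimes>\<^bsub>sect (Spec A) V\<^esub> restr (Spec A) N V \<sigma>
      = restr (Spec A) (points (Spec A)) V (global a)"
      unfolding Spec_simps(6) \<sigma>V global_def fraction_restr[OF VP]
      using fraction_mult[OF V(1,5) one_closed V(4,5)] val(1) one
        fraction_eqI[OF V(1), of "b \<otimes> a" "\<one> \<otimes> b" a \<one>] V(4,5) prime_idealD(10)[OF zariski_prime[OF V(1)]]
      by (simp add: m_comm)
  qed (use V in auto)
qed

text \<open>Otherwise some prime ideal avoids all powers of \<open>a\<close>.\<close>

lemma nilpotent_in_primes:
  assumes a: "a \<in> carrier A" and all: "\<And>q. primeideal q A \<Longrightarrow> a \<in> q"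
  obtains n :: nat where "a [^] n = \<zero>"
proof -
  define M where "M = {a [^] n | n :: nat. True}"
  have "\<zero> \<in> M"
  proof (rule ccontr)
    assume z: "\<zero> \<notin> M"
    obtain Q where Q: "primeideal Q A" "Q \<inter> M = {}"
    proof (rule prime_ideal_avoiding[OF zeroideal, of M])
      show "M \<subseteq> carrier A" "{\<zero>} \<inter> M = {}" using a z by (auto simp: M_def)
      show "\<one> \<in> M" unfolding M_def by (auto intro: exI[of _ "0::nat"] simp del: nat_pow_0 simp: nat_pow_0[symmetric])
      show "x \<otimes> y \<in> M" if "x \<in> M" "y \<in> M" for x y
        using that a unfolding M_def by (auto simp: nat_pow_mult)
    qed
    have "a = a [^] (1::nat)" using a by simp
    then have "a \<in> M" unfolding M_def by blast
    then show False using all[OF Q(1)] Q(2) by blast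
  qed
  then show thesis using that unfolding M_def by force
qed

text \<open>On a basic open set around \<open>p\<close> a section vanishing at all points is \<open>a / b\<close> with \<open>a\<close> in all primes
  of that set, so a power of it is zero there; finitely many such sets suffice.\<close>

lemma vanishing_section_nilpotent:
  assumes \<tau>: "\<tau> \<in> carrier \<Gamma>" and all: "\<And>q. q \<in> points (Spec A) \<Longrightarrow> \<tau> \<in> van q"
  obtains n :: nat where "\<tau> [^]\<^bsub>\<Gamma>\<^esub> n = \<zero>\<^bsub>\<Gamma>\<^esub>"
proof -
  let ?P = "points (Spec A)"
  interpret G: cring \<Gamma> by (rule spec.sect_cring) simp
  have "\<exists>e n. e \<in> carrier A \<and> e \<notin> p \<and>
      restrict (\<tau> [^]\<^bsub>\<Gamma>\<^esub> (n::nat)) (basic_open e) = restrict \<zero>\<^bsub>\<Gamma>\<^esub> (basic_open e)"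
    if p: "primeideal p A" for p
  proof -
    have pP: "p \<in> ?P" using p by (simp add: points_Spec)
    obtain V a b where V: "openin (topo (Spec A)) V" "p \<in> V" "V \<subseteq> ?P" and ab: "a \<in> carrier A" "b \<in> carrier A"
      and b: "\<And>q. q \<in> V \<Longrightarrow> global b \<notin> van q"
      and eq: "restr (Spec A) ?P V (global b) \<otimes>\<^bsub>sect (Spec A) V\<^esub> restr (Spec A) ?P V \<tau>
        = restr (Spec A) ?P V (global a)"
      using Spec_fraction[OF openin_topspace pP \<tau>] by metis
    have "\<exists>E\<subseteq>carrier A. V = {q. primeideal q A \<and> \<not> E \<subseteq> q}"
      using V(1) by (simp add: openin_Spec zariski_open_def)
    then obtain e where e: "e \<in> carrier A" "e \<notin> p" "basic_open e \<subseteq> V"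
      using V(2) by (auto simp: basic_open_def)
    let ?D = "basic_open e"
    have D: "openin (topo (Spec A)) ?D" "?D \<subseteq> ?P"
      using zariski_basic_open[OF e(1)] e(3) V(3) by (auto simp: openin_Spec)
    note rho = spec.restr_hom[OF openin_topspace D]
    interpret D: cring "sect (Spec A) ?D" by (rule spec.sect_cring[OF D(1)])
    interpret rho: ring_hom_cring \<Gamma> "sect (Spec A) ?D" "restr (Spec A) ?P ?D"
      by (rule ring_hom_cringI[OF G.cring_axioms D.cring_axioms rho])
    define g where "g = (\<lambda>a. restr (Spec A) ?P ?D (global a))"
    have g_hom: "g \<in> ring_hom A (sect (Spec A) ?D)"
      unfolding g_def using ring_hom_trans[OF global_hom rho] by (simp add: comp_def)
    interpret g: ring_hom_cring A "sect (Spec A) ?D" g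
      by (rule ring_hom_cringI[OF cring_axioms D.cring_axioms g_hom])
    let ?t = "restr (Spec A) ?P ?D \<tau>"
    have t: "?t \<in> carrier (sect (Spec A) ?D)" using \<tau> by simp
    have van_a: "a \<in> q" if q: "q \<in> ?D" for q
    proof -
      have "global a \<in> van q"
        using spec.vanishing_fraction_iff[OF openin_topspace openin_topspace _ V(1,3) _ \<tau>
            global_closed[OF ab(1)] global_closed[OF ab(2)] b eq] all q e(3) D(2) by blast
      then show ?thesis using global_vanishing_iff[OF ab(1)] q by (simp add: basic_open_def)
    qed
    have "a \<otimes> e \<in> q" if "primeideal q A" for q
      using van_a[of q] prime_idealD(10)[OF that ab(1) e(1)] that by (auto simp: basic_open_def)
    then obtain n :: nat where n: "(a \<otimes> e) [^] n = \<zero>"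
      using nilpotent_in_primes[of "a \<otimes> e"] ab e by auto
    have unit: "\<exists>z\<in>carrier (sect (Spec A) ?D). z \<otimes>\<^bsub>sect (Spec A) ?D\<^esub> g c = \<one>\<^bsub>sect (Spec A) ?D\<^esub>"
      if c: "c \<in> carrier A" "\<And>q. q \<in> ?D \<Longrightarrow> c \<notin> q" for c
    proof
      have oD: "zariski_open A ?D" using D(1) by (simp add: openin_Spec)
      have one: "\<one> \<notin> q" if "q \<in> ?D" for q
        using that prime_idealD(5) by (auto simp: basic_open_def)
      show "fraction ?D \<one> c \<in> carrier (sect (Spec A) ?D)"
        by (rule fraction_closed[OF oD]) (use c in auto)
      have "fraction ?D \<one> c \<otimes>\<^bsub>sect (Spec A) ?D\<^esub> g c = fraction ?D (\<one> \<otimes> c) (c \<otimes> \<one>)"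
        unfolding g_def Spec_simps(6) global_def fraction_restr[OF D(2)]
        by (rule fraction_mult[OF oD]) (use c one in auto)
      also have "\<dots> = fraction ?D \<one> \<one>"
        by (rule fraction_eqI[OF oD]) (use c one in auto)
      finally show "fraction ?D \<one> c \<otimes>\<^bsub>sect (Spec A) ?D\<^esub> g c = \<one>\<^bsub>sect (Spec A) ?D\<^esub>"
        by (simp only: Spec_simps(4))
    qed
    have bD: "b \<notin> q" if "q \<in> ?D" for q
      using b[of q] global_vanishing_iff[OF ab(2)] that e(3) by (auto simp: basic_open_def)
    have beD: "b \<otimes> e \<notin> q" if "q \<in> ?D" for q
      using bD[OF that] prime_idealD(10)[of q A b e] that ab e by (simp add: basic_open_def)
    obtain z where z: "z \<in> carrier (sect (Spec A) ?D)"
      "z \<otimes>\<^bsub>sect (Spec A) ?D\<^esub> g (b \<otimes> e) = \<one>\<^bsub>sect (Spec A) ?D\<^esub>"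
      using unit[of "b \<otimes> e"] ab e beD by auto
    note rV = spec.restr_restr[OF openin_topspace V(1) D(1) e(3) V(3)]
    have rh: "restr (Spec A) V ?D \<in> ring_hom (sect (Spec A) V) (sect (Spec A) ?D)"
      by (rule spec.restr_hom[OF V(1) D(1) e(3)])
    have "g b \<otimes>\<^bsub>sect (Spec A) ?D\<^esub> ?t = g a"
      using arg_cong[OF eq, of "restr (Spec A) V ?D"] ring_hom_mult[OF rh]
        spec.restr_closed[OF openin_topspace V(1,3)] global_closed ab \<tau> rV by (simp add: g_def)
    note gbt = this
    have gc: "g c \<in> carrier (sect (Spec A) ?D)" if "c \<in> carrier A" for c using that by (rule g.hom_closed)
    have "g (b \<otimes> e) \<otimes>\<^bsub>sect (Spec A) ?D\<^esub> ?t = g e \<otimes>\<^bsub>sect (Spec A) ?D\<^esub> (g b \<otimes>\<^bsub>sect (Spec A) ?D\<^esub> ?t)"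
      unfolding g.hom_mult[OF ab(2) e(1)] using gc[OF ab(2)] gc[OF e(1)] t by (simp only: D.m_ac D.m_closed)
    also have "\<dots> = g (a \<otimes> e)"
      unfolding gbt g.hom_mult[OF ab(1) e(1)] by (rule D.m_comm[OF gc[OF e(1)] gc[OF ab(1)]])
    finally have gbe: "g (b \<otimes> e) \<otimes>\<^bsub>sect (Spec A) ?D\<^esub> ?t = g (a \<otimes> e)" .
    have be: "b \<otimes> e \<in> carrier A" "a \<otimes> e \<in> carrier A" using ab e(1) by auto
    have "z \<otimes>\<^bsub>sect (Spec A) ?D\<^esub> g (a \<otimes> e) = (z \<otimes>\<^bsub>sect (Spec A) ?D\<^esub> g (b \<otimes> e)) \<otimes>\<^bsub>sect (Spec A) ?D\<^esub> ?t"
      unfolding gbe[symmetric] by (rule D.m_assoc[symmetric, OF z(1) gc[OF be(1)] t])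
    then have tz: "?t = z \<otimes>\<^bsub>sect (Spec A) ?D\<^esub> g (a \<otimes> e)" unfolding z(2) using t by simp
    have "?t [^]\<^bsub>sect (Spec A) ?D\<^esub> n
        = z [^]\<^bsub>sect (Spec A) ?D\<^esub> n \<otimes>\<^bsub>sect (Spec A) ?D\<^esub> g ((a \<otimes> e) [^] n)"
      unfolding tz g.hom_pow[OF be(2)] by (rule D.nat_pow_distrib[OF z(1) gc[OF be(2)]])
    then have "?t [^]\<^bsub>sect (Spec A) ?D\<^esub> n = \<zero>\<^bsub>sect (Spec A) ?D\<^esub>" using n z by simp
    then have "restr (Spec A) ?P ?D (\<tau> [^]\<^bsub>\<Gamma>\<^esub> n) = restr (Spec A) ?P ?D \<zero>\<^bsub>\<Gamma>\<^esub>"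
      using \<tau> by simp
    then show ?thesis using e by (intro exI[of _ e] exI[of _ n]) (simp add: Spec_simps(6))
  qed
  then obtain e n where e: "\<And>p. primeideal p A \<Longrightarrow> e p \<in> carrier A - p"
    and zero: "\<And>p. primeideal p A \<Longrightarrow>
      restrict (\<tau> [^]\<^bsub>\<Gamma>\<^esub> (n p :: nat)) (basic_open (e p)) = restrict \<zero>\<^bsub>\<Gamma>\<^esub> (basic_open (e p))"
    by (metis DiffI)
  obtain \<Q> where \<Q>: "finite \<Q>" "\<And>q. q \<in> \<Q> \<Longrightarrow> primeideal q A"
    and cover: "\<And>p. primeideal p A \<Longrightarrow> \<exists>q\<in>\<Q>. {} \<subseteq> p \<and> e q \<notin> p"
    by (rule constructible_compactness[of "\<lambda>_. {}" e]) (use e in auto)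
  define N where "N = (\<Sum>q\<in>\<Q>. n q)"
  have ext: "\<sigma> \<in> extensional ?P" if "\<sigma> \<in> carrier \<Gamma>" for \<sigma>
    using that by (simp add: Spec_simps(1) spec_sections_def PiE_def)
  have "\<tau> [^]\<^bsub>\<Gamma>\<^esub> N = \<zero>\<^bsub>\<Gamma>\<^esub>"
  proof (rule extensionalityI[of _ ?P])
    show "\<tau> [^]\<^bsub>\<Gamma>\<^esub> N \<in> extensional ?P" "\<zero>\<^bsub>\<Gamma>\<^esub> \<in> extensional ?P"
      using ext G.nat_pow_closed[OF \<tau>, of N] G.zero_closed by blast+
    fix p assume "p \<in> ?P"
    then have p: "primeideal p A" by (simp add: points_Spec)
    then obtain q where q: "q \<in> \<Q>" "e q \<notin> p" using cover by blast
    have "n q \<le> N" unfolding N_def using \<Q>(1) q(1) by (simp add: member_le_sum)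
    then obtain m where m: "N = n q + m" using le_Suc_ex by blast
    let ?D = "basic_open (e q)"
    have eq: "e q \<in> carrier A" using e[OF \<Q>(2)[OF q(1)]] by simp
    have D: "openin (topo (Spec A)) ?D" "?D \<subseteq> ?P" "p \<in> ?D"
      using zariski_basic_open[OF eq] p q(2) by (auto simp: openin_Spec basic_open_def points_Spec)
    note rho = spec.restr_hom[OF openin_topspace D(1,2)]
    have "restr (Spec A) ?P ?D (\<tau> [^]\<^bsub>\<Gamma>\<^esub> n q) = restr (Spec A) ?P ?D \<zero>\<^bsub>\<Gamma>\<^esub>"
      using zero[OF \<Q>(2)[OF q(1)]] by (simp add: Spec_simps(6))
    then have "restr (Spec A) ?P ?D (\<tau> [^]\<^bsub>\<Gamma>\<^esub> n q \<otimes>\<^bsub>\<Gamma>\<^esub> \<tau> [^]\<^bsub>\<Gamma>\<^esub> m)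
        = restr (Spec A) ?P ?D (\<zero>\<^bsub>\<Gamma>\<^esub> \<otimes>\<^bsub>\<Gamma>\<^esub> \<tau> [^]\<^bsub>\<Gamma>\<^esub> m)"
      unfolding ring_hom_mult[OF rho G.nat_pow_closed[OF \<tau>] G.nat_pow_closed[OF \<tau>]]
        ring_hom_mult[OF rho G.zero_closed G.nat_pow_closed[OF \<tau>]] by simp
    then have "restr (Spec A) ?P ?D (\<tau> [^]\<^bsub>\<Gamma>\<^esub> N) = restr (Spec A) ?P ?D \<zero>\<^bsub>\<Gamma>\<^esub>"
      using \<tau> by (simp add: m G.nat_pow_mult)
    then show "(\<tau> [^]\<^bsub>\<Gamma>\<^esub> N) p = \<zero>\<^bsub>\<Gamma>\<^esub> p"
      using D(3) unfolding Spec_simps(6) by (metis restrict_apply')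
  qed
  then show thesis by (rule that)
qed


text \<open>The main point is that a prime \<open>Q\<close> of the ring of global sections comes from a prime of \<open>A\<close>, namely from its
  contraction \<open>p\<close>. A global section \<open>\<sigma>\<close> is a fraction \<open>a / b\<close> near \<open>p\<close>, so \<open>\<delta> = b \<sigma> - a\<close> vanishes on the basic
  open set of some \<open>e \<notin> p\<close>. Then \<open>e \<delta>\<close> vanishes at all points, is nilpotent and lies in every prime.
  Hence \<open>\<sigma>\<close> lies in \<open>Q\<close>, or vanishes at \<open>p\<close>, if and only if \<open>a \<in> p\<close>.\<close>

lemma spectrum_like_Spec: "spectrum_like (Spec A) (points (Spec A))"
proof (rule spectrum_like.intro)
  let ?P = "points (Spec A)"
  interpret G: cring \<Gamma> by (rule spec.sect_cring) simp
  have basic: "\<exists>e. e \<in> carrier A \<and> e \<notin> p \<and> basic_open e \<subseteq> N"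
    if N: "openin (topo (Spec A)) N" "p \<in> N" for N p
  proof -
    have "\<exists>E\<subseteq>carrier A. N = {q. primeideal q A \<and> \<not> E \<subseteq> q}"
      using N(1) by (simp add: openin_Spec zariski_open_def)
    then show ?thesis using N(2) by (auto simp: basic_open_def)
  qed
  show "\<exists>s\<in>carrier \<Gamma>. s \<notin> van p \<and> (\<forall>q\<in>?P. s \<notin> van q \<longrightarrow> q \<in> N)"
    if N: "openin (topo (Spec A)) N" "p \<in> N" "N \<subseteq> ?P" for p N
  proof -
    obtain e where e: "e \<in> carrier A" "e \<notin> p" "basic_open e \<subseteq> N" using basic[OF N(1,2)] by blast
    have p: "primeideal p A" using N(2,3) by (auto simp: points_Spec)
    show ?thesis
    proof (rule bexI[of _ "global e"], intro conjI ballI impI)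
      show "global e \<in> carrier \<Gamma>" by (rule global_closed[OF e(1)])
      show "global e \<notin> van p" using global_vanishing_iff[OF e(1) p] e(2) by simp
      show "q \<in> N" if "q \<in> ?P" "global e \<notin> van q" for q
        using that global_vanishing_iff[OF e(1), of q] e(3) by (auto simp: basic_open_def points_Spec)
    qed
  qed
  show "\<exists>N' a s. openin (topo (Spec A)) N' \<and> p \<in> N' \<and> N' \<subseteq> N \<and> a \<in> carrier \<Gamma> \<and> s \<in> carrier \<Gamma> \<and>
      (\<forall>q\<in>N'. s \<notin> van q) \<and>
      restr (Spec A) ?P N' s \<otimes>\<^bsub>sect (Spec A) N'\<^esub> restr (Spec A) N N' t = restr (Spec A) ?P N' a"
    if N: "openin (topo (Spec A)) N" "p \<in> N" "N \<subseteq> ?P" "t \<in> carrier (sect (Spec A) N)" for p N t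
  proof -
    obtain V a b where "openin (topo (Spec A)) V" "p \<in> V" "V \<subseteq> N" "a \<in> carrier A" "b \<in> carrier A"
      "\<And>q. q \<in> V \<Longrightarrow> global b \<notin> van q"
      "restr (Spec A) ?P V (global b) \<otimes>\<^bsub>sect (Spec A) V\<^esub> restr (Spec A) N V t = restr (Spec A) ?P V (global a)"
      using Spec_fraction[OF N(1,2,4)] by metis
    then show ?thesis using global_closed by (intro exI[of _ V] exI[of _ "global a"] exI[of _ "global b"]) simp
  qed
  fix Q assume Q: "primeideal Q \<Gamma>"
  note QD = prime_idealD[OF Q]
  define p where "p = comap A global Q"
  have p: "primeideal p A" unfolding p_def by (rule primeideal_comap[OF cring_axioms global_hom Q])
  have pP: "p \<in> ?P" using p by (simp add: points_Spec)
  have p_iff: "global a \<in> Q \<longleftrightarrow> a \<in> p" if "a \<in> carrier A" for a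
    using that by (simp add: p_def comap_def)
  have vP: "primeideal (van p) \<Gamma>" by (rule spec.vanishing_ideal_prime[OF openin_topspace pP])
  have "\<sigma> \<in> van p \<longleftrightarrow> \<sigma> \<in> Q" if \<sigma>: "\<sigma> \<in> carrier \<Gamma>" for \<sigma>
  proof -
    obtain V a b where V: "openin (topo (Spec A)) V" "p \<in> V" "V \<subseteq> ?P" and ab: "a \<in> carrier A" "b \<in> carrier A"
      and b: "\<And>q. q \<in> V \<Longrightarrow> global b \<notin> van q"
      and eq: "restr (Spec A) ?P V (global b) \<otimes>\<^bsub>sect (Spec A) V\<^esub> restr (Spec A) ?P V \<sigma>
        = restr (Spec A) ?P V (global a)"
      using Spec_fraction[OF openin_topspace pP \<sigma>] by metis
    obtain e where e: "e \<in> carrier A" "e \<notin> p" "basic_open e \<subseteq> V" using basic[OF V(1,2)] by blast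
    define \<delta> where "\<delta> = global b \<otimes>\<^bsub>\<Gamma>\<^esub> \<sigma> \<oplus>\<^bsub>\<Gamma>\<^esub> \<ominus>\<^bsub>\<Gamma>\<^esub> global a"
    note gl = global_closed[OF ab(1)] global_closed[OF ab(2)] global_closed[OF e(1)]
    have \<delta>: "\<delta> \<in> carrier \<Gamma>" unfolding \<delta>_def using gl \<sigma> by simp
    note rho = spec.restr_hom[OF openin_topspace V(1,3)]
    interpret V: cring "sect (Spec A) V" by (rule spec.sect_cring[OF V(1)])
    interpret rho: ring_hom_cring \<Gamma> "sect (Spec A) V" "restr (Spec A) ?P V"
      by (rule ring_hom_cringI[OF G.cring_axioms V.cring_axioms rho])
    have "restr (Spec A) ?P V \<delta> = \<zero>\<^bsub>sect (Spec A) V\<^esub>"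
      unfolding \<delta>_def using gl \<sigma> eq by (simp add: V.r_neg)
    then have \<delta>_van: "\<delta> \<in> van q" if "q \<in> V" for q
      using spec.vanishing_restr[OF openin_topspace V(1,3) that \<delta>]
        prime_idealD(4)[OF spec.vanishing_ideal_prime[OF V(1) that]] by simp
    have "global e \<otimes>\<^bsub>\<Gamma>\<^esub> \<delta> \<in> van q" if q: "q \<in> ?P" for q
    proof -
      note vD = prime_idealD[OF spec.vanishing_ideal_prime[OF openin_topspace q]]
      show ?thesis
      proof (cases "q \<in> V")
        case True
        then show ?thesis using vD(9)[OF gl(3) \<delta>_van] by blast
      next
        case False
        then have "e \<in> q" using e(3) q by (auto simp: basic_open_def points_Spec)
        then have "global e \<in> van q" using global_vanishing_iff[OF e(1), of q] q by (simp add: points_Spec)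
        then show ?thesis using vD(8) \<delta> by blast
      qed
    qed
    then obtain n :: nat where n: "(global e \<otimes>\<^bsub>\<Gamma>\<^esub> \<delta>) [^]\<^bsub>\<Gamma>\<^esub> n = \<zero>\<^bsub>\<Gamma>\<^esub>"
      using vanishing_section_nilpotent[of "global e \<otimes>\<^bsub>\<Gamma>\<^esub> \<delta>"] gl(3) \<delta> G.m_closed by metis
    have ed: "global e \<otimes>\<^bsub>\<Gamma>\<^esub> \<delta> \<in> carrier \<Gamma>" using gl(3) \<delta> by simp
    have "global e \<otimes>\<^bsub>\<Gamma>\<^esub> \<delta> \<in> Q" if "(global e \<otimes>\<^bsub>\<Gamma>\<^esub> \<delta>) [^]\<^bsub>\<Gamma>\<^esub> (k::nat) \<in> Q" for k
      using that
    proof (induction k)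
      case 0
      then show ?case using QD(5) by simp
    next
      case (Suc k)
      then show ?case using QD(10)[OF G.nat_pow_closed[OF ed] ed] by auto
    qed
    then have "global e \<otimes>\<^bsub>\<Gamma>\<^esub> \<delta> \<in> Q" using n QD(4) by metis
    then have \<delta>Q: "\<delta> \<in> Q" using QD(10)[OF gl(3) \<delta>] p_iff[OF e(1)] e(2) by simp
    have bp: "b \<notin> p" using b[OF V(2)] global_vanishing_iff[OF ab(2) p] by simp
    have crit: "\<sigma> \<in> q \<longleftrightarrow> global a \<in> q" if q: "primeideal q \<Gamma>" "\<delta> \<in> q" "global b \<notin> q" for q
    proof -
      have "\<sigma> \<in> q \<longleftrightarrow> global b \<otimes>\<^bsub>\<Gamma>\<^esub> \<sigma> \<in> q" using prime_idealD(10)[OF q(1) gl(2) \<sigma>] q(3) by simp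
      also have "\<dots> \<longleftrightarrow> global a \<in> q"
        by (rule prime_ideal_diff_iff[OF q(1)]) (use q(2) gl \<sigma> in \<open>simp_all add: \<delta>_def\<close>)
      finally show ?thesis .
    qed
    have "\<sigma> \<in> van p \<longleftrightarrow> a \<in> p"
      using crit[OF vP \<delta>_van[OF V(2)] b[OF V(2)]] global_vanishing_iff[OF ab(1) p] by simp
    moreover have "\<sigma> \<in> Q \<longleftrightarrow> a \<in> p"
      using crit[OF Q \<delta>Q] p_iff[OF ab(1)] p_iff[OF ab(2)] bp by simp
    ultimately show ?thesis by simp
  qed
  then have van_p: "van p = Q" using QD(3) prime_idealD(3)[OF vP] by blast
  have uniq: "q = p" if q: "q \<in> ?P" "van q = Q" for q
  proof -
    have qp: "primeideal q A" using q(1) by (simp add: points_Spec)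
    have "a \<in> q \<longleftrightarrow> a \<in> p" if "a \<in> carrier A" for a
      using global_vanishing_iff[OF that qp] q(2) p_iff[OF that] by simp
    then show ?thesis using prime_idealD(3)[OF qp] prime_idealD(3)[OF p] by blast
  qed
  show "\<exists>!x. x \<in> ?P \<and> van x = Q"
  proof (rule ex1I[of _ p])
    show "p \<in> ?P \<and> van p = Q" using pP van_p by (rule conjI)
    show "q = p" if "q \<in> ?P \<and> van q = Q" for q using that by (elim conjE) (rule uniq)
  qed
qed

end

lemma spectrum_like_isomorphic:
  assumes f: "lrs_morphism Y Z f" and g: "lrs_morphism Z Y g"
    and fg: "same_map Z Z (comp_map Y f g) id_map" and gf: "same_map Y Y (comp_map Z g f) id_map"
    and Z: "spectrum_like Z (points Z)"
  shows "spectrum_like Y (points Y)"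
proof (rule spectrum_like.intro)
  interpret f: lrs_morphism Y Z f by (rule f)
  interpret g: lrs_morphism Z Y g by (rule g)
  interpret Z: spectrum_like Z "points Z" by (rule Z)
  let ?Y = "points Y" and ?Z = "points Z"
  have pt: "pt_map f (pt_map g z) = z" if "z \<in> ?Z" for z
    using fg that by (simp add: same_map_def comp_map_def id_map_def)
  have pt': "pt_map g (pt_map f y) = y" if "y \<in> ?Y" for y
    using gf that by (simp add: same_map_def comp_map_def id_map_def)
  have pre: "preim Y f (preim Z g N) = N" if "openin (topo Y) N" for N
    using openin_subset[OF that] pt' f.pt_in_points by (auto simp: preim_def)
  have pre': "preim Z g (preim Y f N) = N" if "openin (topo Z) N" for N
    using openin_subset[OF that] pt g.pt_in_points by (auto simp: preim_def)
  have top: "preim Y f ?Z = ?Y" "preim Z g ?Y = ?Z"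
    using f.pt_in_points g.pt_in_points by (auto simp: preim_def)
  have sec: "sec_map f (preim Z g N) (sec_map g N s) = s"
    if "openin (topo Y) N" "s \<in> carrier (sect Y N)" for N s
    using gf that by (simp add: same_map_def comp_map_def id_map_def)
  have closed: "sec_map f ?Z s \<in> carrier (sect Y ?Y)" if "s \<in> carrier (sect Z ?Z)" for s
    using f.sec_map_closed[OF openin_topspace that] by (simp add: top)
  have closed': "sec_map g ?Y s \<in> carrier (sect Z ?Z)" if "s \<in> carrier (sect Y ?Y)" for s
    using g.sec_map_closed[OF openin_topspace that] by (simp add: top)
  have van: "sec_map f ?Z s \<in> vanishing_ideal Y ?Y y \<longleftrightarrow> s \<in> vanishing_ideal Z ?Z (pt_map f y)"
    if "y \<in> ?Y" "s \<in> carrier (sect Z ?Z)" for y s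
    using f.vanishing_sec_map[OF that(1) openin_topspace f.pt_in_points[OF that(1)] that(2)] by (simp add: top)
  have hom: "sec_map f ?Z \<in> ring_hom (sect Z ?Z) (sect Y ?Y)"
    using f.sec_hom[OF openin_topspace] by (simp add: top)
  show "\<exists>!y. y \<in> ?Y \<and> vanishing_ideal Y ?Y y = Q" if Q: "primeideal Q (sect Y ?Y)" for Q
  proof -
    define Q' where "Q' = comap (sect Z ?Z) (sec_map f ?Z) Q"
    have Q': "primeideal Q' (sect Z ?Z)"
      unfolding Q'_def by (rule primeideal_comap[OF f.cod.sect_cring[OF openin_topspace] hom Q])
    have iff: "vanishing_ideal Y ?Y y = Q \<longleftrightarrow> vanishing_ideal Z ?Z (pt_map f y) = Q'" if y: "y \<in> ?Y" for y
    proof -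
      have vY: "vanishing_ideal Y ?Y y \<subseteq> carrier (sect Y ?Y)"
        and vZ: "vanishing_ideal Z ?Z (pt_map f y) \<subseteq> carrier (sect Z ?Z)"
        by (auto simp: vanishing_ideal_iff)
      show ?thesis
      proof
        assume "vanishing_ideal Y ?Y y = Q"
        then show "vanishing_ideal Z ?Z (pt_map f y) = Q'"
          using van[OF y] vZ by (auto simp: Q'_def comap_def)
      next
        assume vQ': "vanishing_ideal Z ?Z (pt_map f y) = Q'"
        have "s \<in> vanishing_ideal Y ?Y y \<longleftrightarrow> s \<in> Q" if s: "s \<in> carrier (sect Y ?Y)" for s
        proof -
          have "s \<in> vanishing_ideal Y ?Y y \<longleftrightarrow> sec_map g ?Y s \<in> Q'"
            using van[OF y closed'[OF s]] sec[OF openin_topspace s] vQ' by (simp add: top)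
          also have "\<dots> \<longleftrightarrow> s \<in> Q"
            using closed'[OF s] sec[OF openin_topspace s] by (simp add: Q'_def comap_def top)
          finally show ?thesis .
        qed
        then show "vanishing_ideal Y ?Y y = Q" using vY prime_idealD(3)[OF Q] by blast
      qed
    qed
    obtain z where z: "z \<in> ?Z" "vanishing_ideal Z ?Z z = Q'"
      and uniq: "\<And>z'. \<lbrakk>z' \<in> ?Z; vanishing_ideal Z ?Z z' = Q'\<rbrakk> \<Longrightarrow> z' = z"
      using Z.point_of_prime[OF Q'] by metis
    show ?thesis
    proof (rule ex1I[of _ "pt_map g z"])
      show "pt_map g z \<in> ?Y \<and> vanishing_ideal Y ?Y (pt_map g z) = Q"
        using g.pt_in_points[OF z(1)] iff[of "pt_map g z"] pt[OF z(1)] z(2) by simp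
      show "y = pt_map g z" if "y \<in> ?Y \<and> vanishing_ideal Y ?Y y = Q" for y
        using uniq[of "pt_map f y"] iff[of y] that f.pt_in_points[of y] pt'[of y] by simp
    qed
  qed
  show "\<exists>s\<in>carrier (sect Y ?Y). s \<notin> vanishing_ideal Y ?Y y \<and>
      (\<forall>y'\<in>?Y. s \<notin> vanishing_ideal Y ?Y y' \<longrightarrow> y' \<in> N)"
    if N: "openin (topo Y) N" "y \<in> N" "N \<subseteq> ?Y" for y N
  proof -
    have y: "y \<in> ?Y" using N by blast
    have fy: "pt_map f y \<in> preim Z g N" "preim Z g N \<subseteq> ?Z"
      using f.pt_in_points[OF y] pt'[OF y] N(2) by (auto simp: preim_def)
    obtain s where s: "s \<in> carrier (sect Z ?Z)" "s \<notin> vanishing_ideal Z ?Z (pt_map f y)"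
      "\<And>z. \<lbrakk>z \<in> ?Z; s \<notin> vanishing_ideal Z ?Z z\<rbrakk> \<Longrightarrow> z \<in> preim Z g N"
      using Z.basic_neighbourhood[OF g.preim_open[OF N(1)] fy] by blast
    show ?thesis
    proof (rule bexI[of _ "sec_map f ?Z s"], intro conjI ballI impI)
      show "sec_map f ?Z s \<in> carrier (sect Y ?Y)" by (rule closed[OF s(1)])
      show "sec_map f ?Z s \<notin> vanishing_ideal Y ?Y y" using van[OF y s(1)] s(2) by simp
      show "y' \<in> N" if "y' \<in> ?Y" "sec_map f ?Z s \<notin> vanishing_ideal Y ?Y y'" for y'
        using s(3)[OF f.pt_in_points[OF that(1)]] van[OF that(1) s(1)] that(2) pt'[OF that(1)]
        by (simp add: preim_def)
    qed
  qed
  show "\<exists>N' a s. openin (topo Y) N' \<and> y \<in> N' \<and> N' \<subseteq> N \<and>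
      a \<in> carrier (sect Y ?Y) \<and> s \<in> carrier (sect Y ?Y) \<and> (\<forall>y'\<in>N'. s \<notin> vanishing_ideal Y ?Y y') \<and>
      restr Y ?Y N' s \<otimes>\<^bsub>sect Y N'\<^esub> restr Y N N' t = restr Y ?Y N' a"
    if N: "openin (topo Y) N" "y \<in> N" "N \<subseteq> ?Y" and t: "t \<in> carrier (sect Y N)" for y N t
  proof -
    have y: "y \<in> ?Y" using N by blast
    let ?N = "preim Z g N" and ?t = "sec_map g N t"
    have fy: "pt_map f y \<in> ?N" "?N \<subseteq> ?Z"
      using f.pt_in_points[OF y] pt'[OF y] N(2) by (auto simp: preim_def)
    note oN = g.preim_open[OF N(1)] and ct = g.sec_map_closed[OF N(1) t]
    obtain M a s where M: "openin (topo Z) M" "pt_map f y \<in> M" "M \<subseteq> ?N"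
      and a: "a \<in> carrier (sect Z ?Z)" and s: "s \<in> carrier (sect Z ?Z)" "\<forall>z\<in>M. s \<notin> vanishing_ideal Z ?Z z"
      and eq: "restr Z ?Z M s \<otimes>\<^bsub>sect Z M\<^esub> restr Z ?N M ?t = restr Z ?Z M a"
      using Z.local_fraction[OF oN fy ct] by blast
    let ?M = "preim Y f M"
    have MZ: "M \<subseteq> ?Z" using M(3) fy(2) by blast
    have nat: "sec_map f M (restr Z ?Z M c) = restr Y ?Y ?M (sec_map f ?Z c)" if "c \<in> carrier (sect Z ?Z)" for c
      using f.sec_natural[OF openin_topspace M(1) MZ that] by (simp add: top)
    have nat_t: "sec_map f M (restr Z ?N M ?t) = restr Y N ?M t"
      using f.sec_natural[OF oN M(1,3) ct] sec[OF N(1) t] pre[OF N(1)] by simp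
    have "restr Y ?Y ?M (sec_map f ?Z s) \<otimes>\<^bsub>sect Y ?M\<^esub> restr Y N ?M t = restr Y ?Y ?M (sec_map f ?Z a)"
      using arg_cong[OF eq, of "sec_map f M"]
        ring_hom_mult[OF f.sec_hom[OF M(1)] f.cod.restr_closed[OF openin_topspace M(1) MZ s(1)]
          f.cod.restr_closed[OF oN M(1,3) ct]] nat[OF s(1)] nat[OF a] nat_t by simp
    moreover have "sec_map f ?Z s \<notin> vanishing_ideal Y ?Y y'" if "y' \<in> ?M" for y'
      using that van[of y' s] s by (simp add: preim_def)
    moreover have "y \<in> ?M" using y M(2) by (simp add: preim_def)
    moreover have "?M \<subseteq> N" using f.preim_mono[OF M(3)] pre[OF N(1)] by simp
    ultimately show ?thesis
      using f.preim_open[OF M(1)] closed[OF s(1)] closed[OF a]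
      by (intro exI[of _ ?M] exI[of _ "sec_map f ?Z a"] exI[of _ "sec_map f ?Z s"]) simp
  qed
qed

text \<open>The germs of the two spaces are different sets, but vanishing is the absence of a local inverse, which is the
  same in both.\<close>

lemma spectrum_like_open_subspace:
  assumes \<XX>: "locally_ringed_space \<XX>" and U: "openin (topo \<XX>) U"
    and sub: "locally_ringed_space (open_subspace \<XX> U)"
    and spec: "spectrum_like (open_subspace \<XX> U) U"
  shows "spectrum_like \<XX> U"
proof -
  let ?Y = "open_subspace \<XX> U"
  interpret X: locally_ringed_space \<XX> by (rule \<XX>)
  interpret Y: locally_ringed_space ?Y by (rule sub)
  interpret S: spectrum_like ?Y U by (rule spec)
  have simps: "sect ?Y = sect \<XX>" "restr ?Y = restr \<XX>" by (simp_all add: open_subspace_def)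
  have opn: "openin (topo ?Y) W \<longleftrightarrow> openin (topo \<XX>) W \<and> W \<subseteq> U" for W
    using openin_open_subtopology[OF U] by (simp add: open_subspace_def)
  have van: "vanishing_ideal ?Y U x = vanishing_ideal \<XX> U x" if x: "x \<in> U" for x
  proof -
    have oU: "openin (topo ?Y) U" using opn U by simp
    have "s \<in> vanishing_ideal ?Y U x \<longleftrightarrow> s \<in> vanishing_ideal \<XX> U x" if s: "s \<in> carrier (sect \<XX> U)" for s
    proof -
      have "s \<notin> vanishing_ideal ?Y U x \<longleftrightarrow> s \<notin> vanishing_ideal \<XX> U x"
        using X.nonvanishing_iff_invertible[OF U x s] Y.nonvanishing_iff_invertible[OF oU x] s
        by (simp add: simps opn) blast
      then show ?thesis by simp
    qed
    then show ?thesis by (auto simp: vanishing_ideal_iff simps)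
  qed
  show ?thesis
  proof (rule spectrum_like.intro)
    show "\<exists>!x. x \<in> U \<and> vanishing_ideal \<XX> U x = Q" if "primeideal Q (sect \<XX> U)" for Q
      using S.point_of_prime[of Q] that van by (simp add: simps cong: conj_cong)
    show "\<exists>s\<in>carrier (sect \<XX> U). s \<notin> vanishing_ideal \<XX> U x \<and>
        (\<forall>y\<in>U. s \<notin> vanishing_ideal \<XX> U y \<longrightarrow> y \<in> N)"
      if "openin (topo \<XX>) N" "x \<in> N" "N \<subseteq> U" for x N
      using S.basic_neighbourhood[of N x] that van[of x] van subsetD[OF that(3,2)]
      by (simp add: simps opn)
    show "\<exists>N' a s. openin (topo \<XX>) N' \<and> x \<in> N' \<and> N' \<subseteq> N \<and>
        a \<in> carrier (sect \<XX> U) \<and> s \<in> carrier (sect \<XX> U) \<and>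
        (\<forall>y\<in>N'. s \<notin> vanishing_ideal \<XX> U y) \<and>
        restr \<XX> U N' s \<otimes>\<^bsub>sect \<XX> N'\<^esub> restr \<XX> N N' t = restr \<XX> U N' a"
      if N: "openin (topo \<XX>) N" "x \<in> N" "N \<subseteq> U" and t: "t \<in> carrier (sect \<XX> N)" for x N t
    proof -
      obtain N' a s where N': "openin (topo \<XX>) N'" "x \<in> N'" "N' \<subseteq> N"
        and as: "a \<in> carrier (sect \<XX> U)" "s \<in> carrier (sect \<XX> U)"
        and nv: "\<forall>y\<in>N'. s \<notin> vanishing_ideal ?Y U y"
        and eq: "restr \<XX> U N' s \<otimes>\<^bsub>sect \<XX> N'\<^esub> restr \<XX> N N' t = restr \<XX> U N' a"
        using S.local_fraction[of N x t] N t unfolding simps opn by blast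
      have "\<forall>y\<in>N'. s \<notin> vanishing_ideal \<XX> U y" using nv van N'(3) N(3) by auto
      then show ?thesis using N' as eq by (intro exI[of _ N'] exI[of _ a] exI[of _ s]) simp
    qed
  qed
qed

lemma affine_open_spectrum_like:
  assumes \<XX>: "locally_ringed_space \<XX>" and U: "affine_open \<XX> U"
  shows "spectrum_like \<XX> U"
proof -
  obtain A :: "'b ring" where oU: "openin (topo \<XX>) U" and A: "cring A"
    and "lrs_isomorphic (open_subspace \<XX> U) (Spec A)"
    using U unfolding affine_open_def by blast
  then obtain f g where f: "lrs_morphism (open_subspace \<XX> U) (Spec A) f"
    and g: "lrs_morphism (Spec A) (open_subspace \<XX> U) g"
    and fg: "same_map (Spec A) (Spec A) (comp_map (open_subspace \<XX> U) f g) id_map"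
    and gf: "same_map (open_subspace \<XX> U) (open_subspace \<XX> U) (comp_map (Spec A) g f) id_map"
    unfolding lrs_isomorphic_def by blast
  have Y: "locally_ringed_space (open_subspace \<XX> U)" by (rule lrs_morphism.axioms(1)[OF f])
  interpret spectrum A
    by (intro spectrum.intro plain_cring.intro A lrs_morphism.axioms(2)[OF f])
  have pts: "points (open_subspace \<XX> U) = U"
    using openin_subset[OF oU] by (auto simp: open_subspace_def)
  have "spectrum_like (open_subspace \<XX> U) U"
    using spectrum_like_isomorphic[OF f g fg gf spectrum_like_Spec] unfolding pts .
  then show ?thesis by (rule spectrum_like_open_subspace[OF \<XX> oU Y])
qed

section \<open>Compactness of a scheme in the constructible topology\<close>

text \<open>Near \<open>x\<close>, the set \<open>E\<close> contains the zero set of finitely many sections that vanish at \<open>x\<close>. A condition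
  that a section be non-zero is open and goes into the choice of \<open>N\<close>.\<close>

definition constructible_nbhd :: "('x, 'r) rspace \<Rightarrow> 'x \<Rightarrow> 'x set \<Rightarrow> bool" where
  "constructible_nbhd \<XX> x E \<longleftrightarrow> (\<exists>N F. openin (topo \<XX>) N \<and> x \<in> N \<and> finite F \<and>
     F \<subseteq> vanishing_ideal \<XX> N x \<and> (\<forall>y\<in>N. F \<subseteq> vanishing_ideal \<XX> N y \<longrightarrow> y \<in> E))"

context locally_ringed_space
begin

lemma constructible_nbhdE:
  assumes E: "constructible_nbhd \<XX> x E" and U: "openin (topo \<XX>) U" "x \<in> U"
  obtains N F where "openin (topo \<XX>) N" "x \<in> N" "N \<subseteq> U" "finite F" "F \<subseteq> vanishing_ideal \<XX> N x"
    "\<And>y. \<lbrakk>y \<in> N; F \<subseteq> vanishing_ideal \<XX> N y\<rbrakk> \<Longrightarrow> y \<in> E"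
proof -
  obtain N F where N: "openin (topo \<XX>) N" "x \<in> N" and F: "finite F" "F \<subseteq> vanishing_ideal \<XX> N x"
    and sub: "\<And>y. \<lbrakk>y \<in> N; F \<subseteq> vanishing_ideal \<XX> N y\<rbrakk> \<Longrightarrow> y \<in> E"
    using E unfolding constructible_nbhd_def by blast
  let ?M = "N \<inter> U"
  have M: "openin (topo \<XX>) ?M" "?M \<subseteq> N" using N(1) U(1) by auto
  have Fc: "t \<in> carrier (sect \<XX> N)" if "t \<in> F" for t using F(2) that by (auto simp: vanishing_ideal_iff)
  have van: "restr \<XX> N ?M ` F \<subseteq> vanishing_ideal \<XX> ?M y \<longleftrightarrow> F \<subseteq> vanishing_ideal \<XX> N y" if "y \<in> ?M" for y
    using vanishing_restr[OF N(1) M that Fc] by auto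
  show thesis
  proof (rule that[of ?M "restr \<XX> N ?M ` F"])
    show "openin (topo \<XX>) ?M" "x \<in> ?M" "?M \<subseteq> U" using M N U by auto
    show "finite (restr \<XX> N ?M ` F)" using F(1) by simp
    show "restr \<XX> N ?M ` F \<subseteq> vanishing_ideal \<XX> ?M x" using van[of x] N(2) U(2) F(2) by simp
    show "y \<in> E" if "y \<in> ?M" "restr \<XX> N ?M ` F \<subseteq> vanishing_ideal \<XX> ?M y" for y
      using sub[of y] van[OF that(1)] that by simp
  qed
qed

lemma constructible_nbhd_Int_open:
  assumes "constructible_nbhd \<XX> x E" "openin (topo \<XX>) U" "x \<in> U"
  shows "constructible_nbhd \<XX> x (E \<inter> U)"
proof -
  obtain N F where "openin (topo \<XX>) N" "x \<in> N" "N \<subseteq> U" "finite F" "F \<subseteq> vanishing_ideal \<XX> N x"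
    "\<And>y. \<lbrakk>y \<in> N; F \<subseteq> vanishing_ideal \<XX> N y\<rbrakk> \<Longrightarrow> y \<in> E"
    by (rule constructible_nbhdE[OF assms]) (rule that)
  then show ?thesis
    unfolding constructible_nbhd_def by (intro exI[of _ N] exI[of _ F]) auto
qed

text \<open>Equations near a point are fractions of global ones, so that inside an affine open set a
  constructible neighbourhood may be given by sections over the whole set.\<close>

lemma constructible_nbhd_affine:
  assumes U: "openin (topo \<XX>) U" and spec: "spectrum_like \<XX> U" and x: "x \<in> U"
    and E: "constructible_nbhd \<XX> x E"
  obtains F s where "finite F" "F \<subseteq> vanishing_ideal \<XX> U x"
    "s \<in> carrier (sect \<XX> U) - vanishing_ideal \<XX> U x"
    "\<And>y. \<lbrakk>y \<in> U; F \<subseteq> vanishing_ideal \<XX> U y; s \<notin> vanishing_ideal \<XX> U y\<rbrakk> \<Longrightarrow> y \<in> E"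
proof -
  interpret S: spectrum_like \<XX> U by (rule spec)
  obtain N F where N: "openin (topo \<XX>) N" "x \<in> N" "N \<subseteq> U" and F: "finite F" "F \<subseteq> vanishing_ideal \<XX> N x"
    and sub: "\<And>y. \<lbrakk>y \<in> N; F \<subseteq> vanishing_ideal \<XX> N y\<rbrakk> \<Longrightarrow> y \<in> E"
    by (rule constructible_nbhdE[OF E U x]) (rule that)
  have Fc: "t \<in> carrier (sect \<XX> N)" if "t \<in> F" for t using F(2) that by (auto simp: vanishing_ideal_iff)
  have "\<forall>t\<in>F. \<exists>N' a s. openin (topo \<XX>) N' \<and> x \<in> N' \<and> N' \<subseteq> N \<and>
        a \<in> carrier (sect \<XX> U) \<and> s \<in> carrier (sect \<XX> U) \<and> (\<forall>y\<in>N'. s \<notin> vanishing_ideal \<XX> U y) \<and>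
        restr \<XX> U N' s \<otimes>\<^bsub>sect \<XX> N'\<^esub> restr \<XX> N N' t = restr \<XX> U N' a"
    using S.local_fraction[OF N Fc] by blast
  then obtain N' a s where fr: "\<forall>t\<in>F. openin (topo \<XX>) (N' t) \<and> x \<in> N' t \<and> N' t \<subseteq> N \<and>
        a t \<in> carrier (sect \<XX> U) \<and> s t \<in> carrier (sect \<XX> U) \<and> (\<forall>y\<in>N' t. s t \<notin> vanishing_ideal \<XX> U y) \<and>
        restr \<XX> U (N' t) (s t) \<otimes>\<^bsub>sect \<XX> (N' t)\<^esub> restr \<XX> N (N' t) t = restr \<XX> U (N' t) (a t)"
    by metis
  have iff: "t \<in> vanishing_ideal \<XX> N y \<longleftrightarrow> a t \<in> vanishing_ideal \<XX> U y" if "t \<in> F" "y \<in> N' t" for t y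
    using vanishing_fraction_iff[OF U N(1,3) _ _ that(2) Fc[OF that(1)], of "a t" "s t"] fr that by simp
  define M where "M = (\<Inter>t\<in>F. N' t) \<inter> N"
  have M: "openin (topo \<XX>) M" "x \<in> M" "M \<subseteq> U"
  proof -
    have "openin (topo \<XX>) ((\<Inter>t\<in>F. N' t) \<inter> topspace (topo \<XX>))"
      using F(1) fr by (intro openin_INT) auto
    note openin_Int[OF this N(1)]
    moreover have "(\<Inter>t\<in>F. N' t) \<inter> topspace (topo \<XX>) \<inter> N = M" using openin_subset[OF N(1)] by (auto simp: M_def)
    ultimately show "openin (topo \<XX>) M" by simp
  qed (use N fr in \<open>auto simp: M_def\<close>)
  obtain r where r: "r \<in> carrier (sect \<XX> U)" "r \<notin> vanishing_ideal \<XX> U x"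
    and rM: "\<And>y. \<lbrakk>y \<in> U; r \<notin> vanishing_ideal \<XX> U y\<rbrakk> \<Longrightarrow> y \<in> M"
    using S.basic_neighbourhood[OF M] by blast
  show thesis
  proof (rule that[of "a ` F" r])
    show "finite (a ` F)" using F(1) by simp
    show "a ` F \<subseteq> vanishing_ideal \<XX> U x" using iff fr F(2) by blast
    show "r \<in> carrier (sect \<XX> U) - vanishing_ideal \<XX> U x" using r by simp
    fix y assume y: "y \<in> U" "a ` F \<subseteq> vanishing_ideal \<XX> U y" "r \<notin> vanishing_ideal \<XX> U y"
    have "y \<in> M" by (rule rM[OF y(1,3)])
    then have "F \<subseteq> vanishing_ideal \<XX> N y" "y \<in> N" using iff y(2) by (auto simp: M_def)
    then show "y \<in> E" using sub by blast
  qed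
qed

lemma affine_constructibly_compact:
  assumes U: "openin (topo \<XX>) U" and spec: "spectrum_like \<XX> U"
    and E: "\<And>x. x \<in> U \<Longrightarrow> constructible_nbhd \<XX> x (E x)"
  obtains B where "finite B" "B \<subseteq> U" "U \<subseteq> (\<Union>x\<in>B. E x)"
proof -
  interpret S: spectrum_like \<XX> U by (rule spec)
  interpret R: cring "sect \<XX> U" by (rule sect_cring[OF U])
  have "\<exists>F s. finite F \<and> F \<subseteq> vanishing_ideal \<XX> U x \<and> s \<in> carrier (sect \<XX> U) - vanishing_ideal \<XX> U x \<and>
      (\<forall>y. y \<in> U \<longrightarrow> F \<subseteq> vanishing_ideal \<XX> U y \<longrightarrow> s \<notin> vanishing_ideal \<XX> U y \<longrightarrow> y \<in> E x)" if x: "x \<in> U" for x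
    by (rule constructible_nbhd_affine[OF U spec x E[OF x]]) blast
  then obtain F s where Fs: "\<And>x. x \<in> U \<Longrightarrow> finite (F x) \<and> F x \<subseteq> vanishing_ideal \<XX> U x \<and>
      s x \<in> carrier (sect \<XX> U) - vanishing_ideal \<XX> U x \<and>
      (\<forall>y. y \<in> U \<longrightarrow> F x \<subseteq> vanishing_ideal \<XX> U y \<longrightarrow> s x \<notin> vanishing_ideal \<XX> U y \<longrightarrow> y \<in> E x)"
    by metis
  obtain pt where pt: "\<And>Q. primeideal Q (sect \<XX> U) \<Longrightarrow> pt Q \<in> U \<and> vanishing_ideal \<XX> U (pt Q) = Q"
    using S.point_of_prime by metis
  have F: "finite (F (pt Q)) \<and> F (pt Q) \<subseteq> Q" if "primeideal Q (sect \<XX> U)" for Q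
    using Fs[of "pt Q"] pt[OF that] by simp
  have s: "s (pt Q) \<in> carrier (sect \<XX> U) - Q" if "primeideal Q (sect \<XX> U)" for Q
    using Fs[of "pt Q"] pt[OF that] by simp
  obtain \<Q> where \<Q>: "finite \<Q>" "\<And>q. q \<in> \<Q> \<Longrightarrow> primeideal q (sect \<XX> U)"
    and cover: "\<And>p. primeideal p (sect \<XX> U) \<Longrightarrow> \<exists>q\<in>\<Q>. F (pt q) \<subseteq> p \<and> s (pt q) \<notin> p"
    by (rule R.constructible_compactness[of "\<lambda>Q. F (pt Q)" "\<lambda>Q. s (pt Q)", OF F s]) (assumption | rule that)+
  show thesis
  proof (rule that[of "pt ` \<Q>"])
    show "finite (pt ` \<Q>)" "pt ` \<Q> \<subseteq> U" using \<Q> pt by auto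
    show "U \<subseteq> (\<Union>x\<in>pt ` \<Q>. E x)"
    proof
      fix y assume y: "y \<in> U"
      obtain q where q: "q \<in> \<Q>" "F (pt q) \<subseteq> vanishing_ideal \<XX> U y" "s (pt q) \<notin> vanishing_ideal \<XX> U y"
        using cover[OF vanishing_ideal_prime[OF U y]] by blast
      then have "y \<in> E (pt q)" using Fs[of "pt q"] pt[OF \<Q>(2)[OF q(1)]] y by simp
      then show "y \<in> (\<Union>x\<in>pt ` \<Q>. E x)" using q(1) by blast
    qed
  qed
qed

end

lemma scheme_constructibly_compact:
  assumes sch: "scheme \<XX>" and qc: "quasi_compact \<XX>"
    and E: "\<And>x. x \<in> points \<XX> \<Longrightarrow> constructible_nbhd \<XX> x (E x)"
  obtains B where "finite B" "B \<subseteq> points \<XX>" "points \<XX> \<subseteq> (\<Union>x\<in>B. E x)"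
proof -
  interpret locally_ringed_space \<XX> using sch by (simp add: scheme_def)
  define \<U> where "\<U> = {U. affine_open \<XX> U}"
  have opn: "openin (topo \<XX>) U" if "U \<in> \<U>" for U using that by (simp add: \<U>_def affine_open_def)
  have "points \<XX> \<subseteq> \<Union>\<U>" using sch by (auto simp: scheme_def \<U>_def)
  then obtain \<V> where \<V>: "finite \<V>" "\<V> \<subseteq> \<U>" "points \<XX> \<subseteq> \<Union>\<V>"
    using compactinD[OF qc[unfolded quasi_compact_def compact_space_def] opn] by metis
  have "\<exists>B. finite B \<and> B \<subseteq> V \<and> V \<subseteq> (\<Union>x\<in>B. E x)" if V: "V \<in> \<V>" for V
  proof -
    have aff: "affine_open \<XX> V" and o: "openin (topo \<XX>) V"
      using V \<V>(2) opn by (auto simp: \<U>_def)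
    show ?thesis
    proof (rule affine_constructibly_compact[OF o affine_open_spectrum_like[OF locally_ringed_space_axioms aff]])
      show "constructible_nbhd \<XX> x (E x)" if "x \<in> V" for x using that openin_subset[OF o] E by blast
    qed blast
  qed
  then obtain B where B: "\<And>V. V \<in> \<V> \<Longrightarrow> finite (B V) \<and> B V \<subseteq> V \<and> V \<subseteq> (\<Union>x\<in>B V. E x)" by metis
  show thesis
  proof (rule that[of "\<Union>V\<in>\<V>. B V"])
    show "finite (\<Union>V\<in>\<V>. B V)" using \<V>(1) B by blast
    show "(\<Union>V\<in>\<V>. B V) \<subseteq> points \<XX>"
    proof (rule UN_least)
      fix V assume V: "V \<in> \<V>"
      have "B V \<subseteq> V" using B[OF V] by simp
      also have "V \<subseteq> points \<XX>" by (rule openin_subset[OF opn[OF subsetD[OF \<V>(2) V]]])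
      finally show "B V \<subseteq> points \<XX>" .
    qed
    show "points \<XX> \<subseteq> (\<Union>x\<in>(\<Union>V\<in>\<V>. B V). E x)"
    proof
      fix y assume "y \<in> points \<XX>"
      then obtain V where V: "V \<in> \<V>" "y \<in> V" using \<V>(3) by auto
      then have "y \<in> (\<Union>x\<in>B V. E x)" using B[OF V(1)] by auto
      then show "y \<in> (\<Union>x\<in>(\<Union>V\<in>\<V>. B V). E x)" using V(1) by auto
    qed
  qed
qed

section \<open>Spreading out points and splittings\<close>

lemma ring_eval_scale:
  assumes L: "cring L" and t: "t \<in> carrier L" and x: "x \<in> carrier L" and ps: "set ps \<subseteq> carrier L"
  shows "t \<otimes>\<^bsub>L\<^esub> ring.eval L ps x = ring.eval L (map (\<lambda>c. t \<otimes>\<^bsub>L\<^esub> c) ps) x"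
proof -
  interpret L: cring L by (rule L)
  show ?thesis using ps
  proof (induction ps)
    case (Cons c ps)
    then have "ring.eval L ps x \<in> carrier L" using L.eval_in_carrier x by simp
    then show ?case using Cons t x by (simp add: L.r_distr L.m_assoc)
  qed (use t in simp)
qed

lemma horner_snoc:
  assumes B: "cring B" and b: "b \<in> carrier B" and cs: "h ` set (cs @ [c]) \<subseteq> carrier B"
  shows "horner B h b (cs @ [c]) = horner B h b cs \<oplus>\<^bsub>B\<^esub> h c \<otimes>\<^bsub>B\<^esub> b [^]\<^bsub>B\<^esub> length cs"
proof -
  interpret B: cring B by (rule B)
  show ?thesis using cs
  proof (induction cs)
    case (Cons a cs)
    have c: "horner B h b cs \<in> carrier B" "h a \<in> carrier B" "h c \<in> carrier B"
      using Cons.prems horner_closed[OF B _ b, of h cs] by auto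
    have "b \<otimes>\<^bsub>B\<^esub> (horner B h b cs \<oplus>\<^bsub>B\<^esub> h c \<otimes>\<^bsub>B\<^esub> b [^]\<^bsub>B\<^esub> length cs)
        = b \<otimes>\<^bsub>B\<^esub> horner B h b cs \<oplus>\<^bsub>B\<^esub> h c \<otimes>\<^bsub>B\<^esub> (b [^]\<^bsub>B\<^esub> length cs \<otimes>\<^bsub>B\<^esub> b)"
      using c b by (simp add: B.r_distr B.m_ac)
    then show ?case using Cons c b by (simp add: B.a_assoc)
  qed (use b in simp)
qed

text \<open>Coefficients are listed from the constant one on by \<open>horner\<close>, but from the leading one on by \<open>ring.eval\<close>.\<close>

lemma horner_rev_eq_eval:
  assumes B: "cring B" and b: "b \<in> carrier B" and ps: "h ` set ps \<subseteq> carrier B"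
  shows "horner B h b (rev ps) = ring.eval B (map h ps) b"
proof -
  interpret B: cring B by (rule B)
  show ?thesis using ps
  proof (induction ps)
    case (Cons c ps)
    have e: "ring.eval B (map h ps) b \<in> carrier B" using Cons.prems b by (intro B.eval_in_carrier) auto
    have "horner B h b (rev ps @ [c]) = horner B h b (rev ps) \<oplus>\<^bsub>B\<^esub> h c \<otimes>\<^bsub>B\<^esub> b [^]\<^bsub>B\<^esub> length (rev ps)"
      by (rule horner_snoc[OF B b]) (use Cons.prems in auto)
    then show ?case using Cons e b by (simp add: B.a_comm)
  qed simp
qed

text \<open>The product of the elements \<open>s e\<close> does this.\<close>

lemma prime_avoids_finitely_many:
  assumes R: "cring R" and E: "finite E" "\<And>e. e \<in> E \<Longrightarrow> s e \<in> carrier R - p" and p: "primeideal p R"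
  obtains c where "c \<in> carrier R - p" "\<And>q e. \<lbrakk>primeideal q R; c \<notin> q; e \<in> E\<rbrakk> \<Longrightarrow> s e \<notin> q"
proof -
  interpret R: cring R by (rule R)
  have "\<exists>c\<in>carrier R - p. \<forall>q. primeideal q R \<longrightarrow> c \<notin> q \<longrightarrow> (\<forall>e\<in>E. s e \<notin> q)"
    using E
  proof (induction E)
    case empty
    then show ?case using prime_idealD(5)[OF p] by (intro bexI[of _ "\<one>\<^bsub>R\<^esub>"]) auto
  next
    case (insert e E)
    then obtain c where c: "c \<in> carrier R - p" "\<And>q e. \<lbrakk>primeideal q R; c \<notin> q; e \<in> E\<rbrakk> \<Longrightarrow> s e \<notin> q"
      by fastforce
    have se: "s e \<in> carrier R - p" using insert.prems by simp
    show ?case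
    proof (rule bexI[of _ "c \<otimes>\<^bsub>R\<^esub> s e"], intro allI impI ballI)
      show "c \<otimes>\<^bsub>R\<^esub> s e \<in> carrier R - p" using c(1) se prime_idealD(10)[OF p] by simp
      fix q d assume q: "primeideal q R" "c \<otimes>\<^bsub>R\<^esub> s e \<notin> q" and d: "d \<in> insert e E"
      have "c \<notin> q" "s e \<notin> q" using prime_idealD(10)[OF q(1), of c "s e"] q(2) c(1) se by auto
      then show "s d \<notin> q" using c(2)[OF q(1)] d by auto
    qed
  qed
  then show thesis using that by metis
qed

locale affine_morphism = lrs_morphism Y \<XX> f
  for Y :: "('y, 's) rspace" and \<XX> :: "('x, 'r) rspace" and f :: "('y, 's, 'x, 'r) rmap" +
  fixes V :: "'y set" and W :: "'x set"
  assumes V_affine: "affine_open Y V" and W_affine: "affine_open \<XX> W"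
    and maps_to: "pt_map f ` V \<subseteq> W"
begin

abbreviation R :: "'r ring" where "R \<equiv> sect \<XX> W"
abbreviation S :: "'s ring" where "S \<equiv> sect Y V"

definition h :: "'r \<Rightarrow> 's" where
  "h s = restr Y (preim Y f W) V (sec_map f W s)"

lemma V_open: "openin (topo Y) V" and W_open: "openin (topo \<XX>) W"
  using V_affine W_affine by (auto simp: affine_open_def)

lemma R_cring: "cring R" and S_cring: "cring S"
  using cod.sect_cring[OF W_open] dom.sect_cring[OF V_open] .

lemma V_preim: "V \<subseteq> preim Y f W"
  using maps_to openin_subset[OF V_open] by (auto simp: preim_def)

lemma V_points: "y \<in> V \<Longrightarrow> y \<in> points Y"
  using openin_subset[OF V_open] by blast

lemma maps_W: "y \<in> V \<Longrightarrow> pt_map f y \<in> W"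
  using maps_to by blast

lemma h_hom: "h \<in> ring_hom R S"
proof -
  have "h = restr Y (preim Y f W) V \<circ> sec_map f W" by (auto simp: h_def)
  then show ?thesis
    using ring_hom_trans[OF sec_hom[OF W_open] dom.restr_hom[OF preim_open[OF W_open] V_open V_preim]] by simp
qed

sublocale h: ring_hom_cring R S h
  by (rule ring_hom_cringI[OF R_cring S_cring h_hom])

sublocale V: spectrum_like Y V
  by (rule affine_open_spectrum_like[OF dom.locally_ringed_space_axioms V_affine])

sublocale W: spectrum_like \<XX> W
  by (rule affine_open_spectrum_like[OF cod.locally_ringed_space_axioms W_affine])

lemma comap_vanishing:
  assumes y: "y \<in> V"
  shows "comap R h (vanishing_ideal Y V y) = vanishing_ideal \<XX> W (pt_map f y)"
proof -
  have "h s \<in> vanishing_ideal Y V y \<longleftrightarrow> s \<in> vanishing_ideal \<XX> W (pt_map f y)" if "s \<in> carrier R" for s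
    using dom.vanishing_restr[OF preim_open[OF W_open] V_open V_preim y sec_map_closed[OF W_open that]]
      vanishing_sec_map[OF V_points[OF y] W_open maps_W[OF y] that] by (simp add: h_def)
  then show ?thesis by (auto simp: comap_def vanishing_ideal_iff)
qed

lemma h_vanishing_iff:
  "y \<in> V \<Longrightarrow> s \<in> carrier R \<Longrightarrow> h s \<in> vanishing_ideal Y V y \<longleftrightarrow> s \<in> vanishing_ideal \<XX> W (pt_map f y)"
  using comap_vanishing[of y] by (auto simp: comap_def)

text \<open>The local form of Chevalley's theorem for \<open>R \<rightarrow> S\<close>, read on points, which correspond to the primes of \<open>R\<close> and \<open>S\<close>.\<close>

lemma spread_out_point:
  assumes fp: "finitely_presented R S h" and y: "y \<in> V"
    and alg: "residually_algebraic R S h (vanishing_ideal Y V y)"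
    and G: "finite G" "G \<subseteq> vanishing_ideal Y V y" and b: "b \<in> carrier S - vanishing_ideal Y V y"
  shows "constructible_nbhd \<XX> (pt_map f y)
    {x. \<exists>y'\<in>V. pt_map f y' = x \<and> G \<subseteq> vanishing_ideal Y V y' \<and> b \<notin> vanishing_ideal Y V y'}"
proof -
  let ?x = "pt_map f y"
  interpret R: plain_cring R by (rule plain_cring.intro[OF R_cring])
  have xW: "?x \<in> W" by (rule maps_W[OF y])
  have "constructibly_open_at R S h (vanishing_ideal Y V y)"
    by (rule R.constructibly_open_at_finitely_presented[OF S_cring fp dom.vanishing_ideal_prime[OF V_open y] alg])
  note co = this[unfolded constructibly_open_at_def comap_vanishing[OF y], rule_format,
      OF conjI[OF G(1) conjI[OF G(2) b]]]
  then obtain F s where F: "finite F" "F \<subseteq> vanishing_ideal \<XX> W ?x" and s: "s \<in> carrier R - vanishing_ideal \<XX> W ?x"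
    and ex: "\<And>q. \<lbrakk>primeideal q R; F \<subseteq> q; s \<notin> q\<rbrakk> \<Longrightarrow> \<exists>Q. primeideal Q S \<and> G \<subseteq> Q \<and> b \<notin> Q \<and> comap R h Q = q"
    by (elim exE conjE) (rule that, assumption, assumption, assumption, blast)
  let ?N = "{x \<in> W. s \<notin> vanishing_ideal \<XX> W x}"
  have N: "openin (topo \<XX>) ?N" "?N \<subseteq> W" "?x \<in> ?N"
    using cod.nonvanishing_locus_open[OF W_open] s xW by auto
  have Fc: "t \<in> carrier R" if "t \<in> F" for t using F(2) that by (auto simp: vanishing_ideal_iff)
  have van: "restr \<XX> W ?N ` F \<subseteq> vanishing_ideal \<XX> ?N x \<longleftrightarrow> F \<subseteq> vanishing_ideal \<XX> W x" if "x \<in> ?N" for x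
    using cod.vanishing_restr[OF W_open N(1,2) that Fc] by auto
  have "\<exists>y'\<in>V. pt_map f y' = x \<and> G \<subseteq> vanishing_ideal Y V y' \<and> b \<notin> vanishing_ideal Y V y'"
    if x: "x \<in> ?N" "F \<subseteq> vanishing_ideal \<XX> W x" for x
  proof -
    have xW: "x \<in> W" and sx: "s \<notin> vanishing_ideal \<XX> W x" using x(1) by auto
    note pr = cod.vanishing_ideal_prime[OF W_open xW]
    obtain Q where Q: "primeideal Q S" "G \<subseteq> Q" "b \<notin> Q" "comap R h Q = vanishing_ideal \<XX> W x"
      using ex[OF pr x(2) sx] by metis
    obtain y' where y': "y' \<in> V" "vanishing_ideal Y V y' = Q" using V.point_of_prime[OF Q(1)] by metis
    have "vanishing_ideal \<XX> W (pt_map f y') = vanishing_ideal \<XX> W x"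
      using comap_vanishing[OF y'(1)] y'(2) Q(4) by simp
    then have "pt_map f y' = x" using W.point_of_prime[OF pr] maps_W[OF y'(1)] xW by metis
    then show ?thesis using y' Q(2,3) by (intro bexI[of _ y']) simp_all
  qed
  note image = this
  show ?thesis
    unfolding constructible_nbhd_def
  proof (rule exI[of _ ?N], rule exI[of _ "restr \<XX> W ?N ` F"], intro conjI ballI impI)
    show "openin (topo \<XX>) ?N" "?x \<in> ?N" by (rule N)+
    show "finite (restr \<XX> W ?N ` F)" using F(1) by (rule finite_imageI)
    show "restr \<XX> W ?N ` F \<subseteq> vanishing_ideal \<XX> ?N ?x" unfolding van[OF N(3)] by (rule F(2))
    fix x assume x: "x \<in> ?N" "restr \<XX> W ?N ` F \<subseteq> vanishing_ideal \<XX> ?N x"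
    have "F \<subseteq> vanishing_ideal \<XX> W x" using x(2) unfolding van[OF x(1)] .
    then show "x \<in> {x. \<exists>y'\<in>V. pt_map f y' = x \<and> G \<subseteq> vanishing_ideal Y V y' \<and> b \<notin> vanishing_ideal Y V y'}"
      using image[OF x(1)] by (intro CollectI)
  qed
qed

end

lemma (in locally_ringed_space) stalk_fraction:
  assumes U: "openin (topo \<XX>) U" and spec: "spectrum_like \<XX> U" and x: "x \<in> U"
    and z: "z \<in> carrier (stalk \<XX> x)"
  obtains a s where "a \<in> carrier (sect \<XX> U)" "s \<in> carrier (sect \<XX> U)" "s \<notin> vanishing_ideal \<XX> U x"
    "germ \<XX> x U s \<otimes>\<^bsub>stalk \<XX> x\<^esub> z = germ \<XX> x U a"
proof -
  interpret S: spectrum_like \<XX> U by (rule spec)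
  obtain M t where M: "openin (topo \<XX>) M" "x \<in> M" "t \<in> carrier (sect \<XX> M)" and zt: "z = germ \<XX> x M t"
    by (rule stalk_carrierE[OF z])
  let ?N = "M \<inter> U"
  have N: "openin (topo \<XX>) ?N" "x \<in> ?N" "?N \<subseteq> U" "?N \<subseteq> M" using M U x by auto
  let ?t = "restr \<XX> M ?N t"
  have t: "?t \<in> carrier (sect \<XX> ?N)" by (rule restr_closed[OF M(1) N(1,4) M(3)])
  obtain N' a s where N': "openin (topo \<XX>) N'" "x \<in> N'" "N' \<subseteq> ?N"
    and as: "a \<in> carrier (sect \<XX> U)" "s \<in> carrier (sect \<XX> U)" "\<forall>y\<in>N'. s \<notin> vanishing_ideal \<XX> U y"
    and eq: "restr \<XX> U N' s \<otimes>\<^bsub>sect \<XX> N'\<^esub> restr \<XX> ?N N' ?t = restr \<XX> U N' a"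
    using S.local_fraction[OF N(1-3) t] by metis
  have N'U: "N' \<subseteq> U" using N'(3) by blast
  note gh = germ_hom[OF N'(1,2)]
  have "germ \<XX> x U a = germ \<XX> x N' (restr \<XX> U N' s) \<otimes>\<^bsub>stalk \<XX> x\<^esub> germ \<XX> x N' (restr \<XX> ?N N' ?t)"
    unfolding ring_hom_mult[OF gh restr_closed[OF U N'(1) N'U as(2)] restr_closed[OF N(1) N'(1,3) t], symmetric] eq
    by (rule germ_restr[OF U N'(1) N'U N'(2) as(1), symmetric])
  also have "germ \<XX> x N' (restr \<XX> U N' s) = germ \<XX> x U s" by (rule germ_restr[OF U N'(1) N'U N'(2) as(2)])
  also have "germ \<XX> x N' (restr \<XX> ?N N' ?t) = z"
    unfolding zt germ_restr[OF N(1) N'(1,3,2) t] by (rule germ_restr[OF M(1) N(1,4,2) M(3)])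
  finally show thesis using that as N'(2) by simp
qed

context affine_morphism
begin

definition ev :: "'y \<Rightarrow> 's \<Rightarrow> ('y set \<times> 's) set set" where
  "ev y c = residue (stalk Y y) (germ Y y V c)"

lemma stalks_local:
  assumes "y \<in> V"
  shows "local_ring (stalk Y y)" "local_ring (stalk \<XX> (pt_map f y))"
  using dom.stalk_local_at[OF V_open assms] cod.stalk_local_at[OF W_open maps_W[OF assms]] .

lemma residue_field_is_field: "y \<in> V \<Longrightarrow> field (residue_field_at Y y)"
  unfolding residue_field_at_def by (rule local_ringD(5)[OF stalks_local(1)])

lemma ev_hom: "y \<in> V \<Longrightarrow> ev y \<in> ring_hom S (residue_field_at Y y)"
proof -
  assume y: "y \<in> V"
  have "ev y = residue (stalk Y y) \<circ> germ Y y V" by (auto simp: ev_def)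
  then show ?thesis
    unfolding residue_field_at_def
    using ring_hom_trans[OF dom.germ_hom[OF V_open y] residue_hom[OF stalks_local(1)[OF y]]] by simp
qed

lemma ev_eq_zero_iff:
  "y \<in> V \<Longrightarrow> c \<in> carrier S \<Longrightarrow> ev y c = \<zero>\<^bsub>residue_field_at Y y\<^esub> \<longleftrightarrow> c \<in> vanishing_ideal Y V y"
  using residue_eq_zero_iff[OF stalks_local(1) dom.germ_closed[OF V_open]]
  by (simp add: ev_def residue_field_at_def vanishing_ideal_iff)

lemma ev_eq_iff:
  assumes y: "y \<in> V" and c: "c \<in> carrier S" and d: "d \<in> carrier S"
  shows "ev y c = ev y d \<longleftrightarrow> c \<oplus>\<^bsub>S\<^esub> \<ominus>\<^bsub>S\<^esub> d \<in> vanishing_ideal Y V y"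
proof -
  interpret L: field "residue_field_at Y y" by (rule residue_field_is_field[OF y])
  interpret e: ring_hom_cring S "residue_field_at Y y" "ev y"
    by (rule ring_hom_cringI[OF S_cring L.cring_axioms ev_hom[OF y]])
  have "ev y (c \<oplus>\<^bsub>S\<^esub> \<ominus>\<^bsub>S\<^esub> d) = ev y c \<ominus>\<^bsub>residue_field_at Y y\<^esub> ev y d"
    using c d by (simp add: a_minus_def)
  then show ?thesis
    using ev_eq_zero_iff[OF y, of "c \<oplus>\<^bsub>S\<^esub> \<ominus>\<^bsub>S\<^esub> d"] L.r_right_minus_eq[OF e.hom_closed[OF c] e.hom_closed[OF d]] c d
    by simp
qed

lemma stalk_map_h:
  assumes y: "y \<in> V" and s: "s \<in> carrier R"
  shows "stalk_map Y f y (germ \<XX> (pt_map f y) W s) = germ Y y V (h s)"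
  unfolding stalk_map_germ[OF V_points[OF y] W_open maps_W[OF y] s] h_def
  by (rule dom.germ_restr[OF preim_open[OF W_open] V_open V_preim y sec_map_closed[OF W_open s], symmetric])

text \<open>A germ on the base is a fraction of sections over \<open>W\<close>; this is pushed forward to the residue field at \<open>y\<close>.\<close>

lemma base_residue_fraction:
  assumes y: "y \<in> V" and z: "z \<in> carrier (stalk \<XX> (pt_map f y))"
  obtains a s where "a \<in> carrier R" "s \<in> carrier R" "s \<notin> vanishing_ideal \<XX> W (pt_map f y)"
    "ev y (h s) \<otimes>\<^bsub>residue_field_at Y y\<^esub> residue (stalk Y y) (stalk_map Y f y z) = ev y (h a)"
proof -
  let ?x = "pt_map f y"
  obtain a s where as: "a \<in> carrier R" "s \<in> carrier R" "s \<notin> vanishing_ideal \<XX> W ?x"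
    and eq: "germ \<XX> ?x W s \<otimes>\<^bsub>stalk \<XX> ?x\<^esub> z = germ \<XX> ?x W a"
    by (rule cod.stalk_fraction[OF W_open W.spectrum_like_axioms maps_W[OF y] z])
  note hom = ring_hom_trans[OF local_homD(1)[OF stalk_local_hom[OF V_points[OF y]]] residue_hom[OF stalks_local(1)[OF y]]]
  have "residue (stalk Y y) (stalk_map Y f y (germ \<XX> ?x W s)) \<otimes>\<^bsub>residue_field_at Y y\<^esub>
      residue (stalk Y y) (stalk_map Y f y z) = residue (stalk Y y) (stalk_map Y f y (germ \<XX> ?x W a))"
    using ring_hom_mult[OF hom cod.germ_closed[OF W_open maps_W[OF y] as(2)] z] eq
    by (simp add: residue_field_at_def)
  then have "ev y (h s) \<otimes>\<^bsub>residue_field_at Y y\<^esub> residue (stalk Y y) (stalk_map Y f y z) = ev y (h a)"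
    by (simp add: stalk_map_h[OF y] as ev_def)
  then show thesis by (rule that[OF as])
qed

text \<open>The extension of residue fields at \<open>y\<close> is trivial: each element of \<open>S\<close> takes at \<open>y\<close> the value
  of a fraction of elements of \<open>R\<close>.\<close>

definition splits_at :: "'y \<Rightarrow> bool" where
  "splits_at y \<longleftrightarrow> (\<forall>b\<in>carrier S. \<exists>a\<in>carrier R. \<exists>s\<in>carrier R.
     s \<notin> vanishing_ideal \<XX> W (pt_map f y) \<and> ev y (h s) \<otimes>\<^bsub>residue_field_at Y y\<^esub> ev y b = ev y (h a))"

text \<open>An element of the residue field at \<open>y\<close> is a fraction \<open>b / t\<close> of values of elements of \<open>S\<close>. If \<open>b\<close> and \<open>t\<close>
  both take values of fractions over \<open>R\<close>, then so does \<open>b / t\<close>.\<close>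

lemma residue_field_iso_iff_splits:
  assumes y: "y \<in> V"
  shows "residue_field_map Y f y \<in> ring_iso (residue_field_at \<XX> (pt_map f y)) (residue_field_at Y y)
    \<longleftrightarrow> splits_at y"
proof -
  let ?x = "pt_map f y" and ?L = "residue_field_at Y y" and ?sm = "stalk_map Y f y"
  let ?\<rho> = "residue (stalk Y y)"
  note lh = stalk_local_hom[OF V_points[OF y]]
  interpret L: field ?L by (rule residue_field_is_field[OF y])
  interpret e: ring_hom_cring S ?L "ev y"
    by (rule ring_hom_cringI[OF S_cring L.cring_axioms ev_hom[OF y]])
  interpret X: cring "stalk \<XX> ?x" by (rule local_ringD(1)[OF stalks_local(2)[OF y]])
  note sm_hom = ring_hom_trans[OF local_homD(1)[OF lh] residue_hom[OF stalks_local(1)[OF y]],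
      folded residue_field_at_def]
  have \<rho>_closed: "?\<rho> z \<in> carrier ?L" if "z \<in> carrier (stalk Y y)" for z
    unfolding residue_field_at_def by (rule ring_hom_closed[OF residue_hom[OF stalks_local(1)[OF y]] that])
  have "residue_field_map Y f y \<in> ring_iso (residue_field_at \<XX> ?x) ?L \<longleftrightarrow>
      (\<forall>z\<in>carrier (stalk Y y). \<exists>w\<in>carrier (stalk \<XX> ?x). ?\<rho> z = ?\<rho> (?sm w))"
    unfolding residue_field_map_def residue_field_at_def
    by (rule residue_map_iso_iff[OF stalks_local(2)[OF y] stalks_local(1)[OF y] lh])
  also have "\<dots> \<longleftrightarrow> splits_at y"
  proof
    assume L: "\<forall>z\<in>carrier (stalk Y y). \<exists>w\<in>carrier (stalk \<XX> ?x). ?\<rho> z = ?\<rho> (?sm w)"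
    show "splits_at y"
      unfolding splits_at_def
    proof
      fix b assume b: "b \<in> carrier S"
      obtain w where w: "w \<in> carrier (stalk \<XX> ?x)" "ev y b = ?\<rho> (?sm w)"
        using L dom.germ_closed[OF V_open y b] unfolding ev_def by blast
      obtain a s where "a \<in> carrier R" "s \<in> carrier R" "s \<notin> vanishing_ideal \<XX> W ?x"
        "ev y (h s) \<otimes>\<^bsub>?L\<^esub> ?\<rho> (?sm w) = ev y (h a)"
        by (rule base_residue_fraction[OF y w(1)])
      then show "\<exists>a\<in>carrier R. \<exists>s\<in>carrier R. s \<notin> vanishing_ideal \<XX> W ?x \<and>
          ev y (h s) \<otimes>\<^bsub>?L\<^esub> ev y b = ev y (h a)"
        unfolding w(2) by (intro bexI[of _ a] bexI[of _ s] conjI)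
    qed
  next
    assume sp: "splits_at y"
    show "\<forall>z\<in>carrier (stalk Y y). \<exists>w\<in>carrier (stalk \<XX> ?x). ?\<rho> z = ?\<rho> (?sm w)"
    proof
      fix z assume z: "z \<in> carrier (stalk Y y)"
      obtain b t where b: "b \<in> carrier S" and t: "t \<in> carrier S" "t \<notin> vanishing_ideal Y V y"
        and eq: "germ Y y V t \<otimes>\<^bsub>stalk Y y\<^esub> z = germ Y y V b"
        by (rule dom.stalk_fraction[OF V_open V.spectrum_like_axioms y z])
      have tz: "ev y t \<otimes>\<^bsub>?L\<^esub> ?\<rho> z = ev y b"
        unfolding ev_def eq[symmetric] residue_field_at_def
        by (rule ring_hom_mult[OF residue_hom[OF stalks_local(1)[OF y]] dom.germ_closed[OF V_open y t(1)] z, symmetric])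
      obtain a s where as: "a \<in> carrier R" "s \<in> carrier R" "s \<notin> vanishing_ideal \<XX> W ?x"
        and eb: "ev y (h s) \<otimes>\<^bsub>?L\<^esub> ev y b = ev y (h a)"
        using sp b unfolding splits_at_def by meson
      obtain a' s' where as': "a' \<in> carrier R" "s' \<in> carrier R" "s' \<notin> vanishing_ideal \<XX> W ?x"
        and et: "ev y (h s') \<otimes>\<^bsub>?L\<^esub> ev y t = ev y (h a')"
        using sp t(1) unfolding splits_at_def by meson
      have nz: "ev y (h c) \<noteq> \<zero>\<^bsub>?L\<^esub> \<longleftrightarrow> c \<notin> vanishing_ideal \<XX> W ?x" if "c \<in> carrier R" for c
        using ev_eq_zero_iff[OF y h.hom_closed[OF that]] h_vanishing_iff[OF y that] by simp
      define p where "p = ev y (h s)"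
      define p' where "p' = ev y (h s')"
      have pc: "p \<in> carrier ?L" "p' \<in> carrier ?L" "p \<noteq> \<zero>\<^bsub>?L\<^esub>" "p' \<noteq> \<zero>\<^bsub>?L\<^esub>"
        using nz as as' by (auto simp: p_def p'_def)
      have tc: "ev y t \<in> carrier ?L" "ev y t \<noteq> \<zero>\<^bsub>?L\<^esub>" "ev y b \<in> carrier ?L" "?\<rho> z \<in> carrier ?L"
        using t b ev_eq_zero_iff[OF y t(1)] \<rho>_closed[OF z] by auto
      have "ev y (h a') \<noteq> \<zero>\<^bsub>?L\<^esub>" using pc tc L.integral et unfolding p'_def by metis
      then have sa': "s \<otimes>\<^bsub>R\<^esub> a' \<notin> vanishing_ideal \<XX> W ?x" "s \<otimes>\<^bsub>R\<^esub> a' \<in> carrier R"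
        using as as' nz prime_idealD(10)[OF cod.vanishing_ideal_prime[OF W_open maps_W[OF y]] as(2) as'(1)] by auto
      let ?u = "germ \<XX> ?x W (s \<otimes>\<^bsub>R\<^esub> a')" and ?n = "germ \<XX> ?x W (a \<otimes>\<^bsub>R\<^esub> s')"
      have uc: "?u \<in> carrier (stalk \<XX> ?x)" by (rule cod.germ_closed[OF W_open maps_W[OF y] sa'(2)])
      have nR: "a \<otimes>\<^bsub>R\<^esub> s' \<in> carrier R" using as as' by simp
      have nc: "?n \<in> carrier (stalk \<XX> ?x)" by (rule cod.germ_closed[OF W_open maps_W[OF y] nR])
      have unit: "?u \<in> Units (stalk \<XX> ?x)"
        using max_ideal_eq_nonunits[OF stalks_local(2)[OF y]] uc sa' by (simp add: vanishing_ideal_iff)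
      define w where "w = ?n \<otimes>\<^bsub>stalk \<XX> ?x\<^esub> inv\<^bsub>stalk \<XX> ?x\<^esub> ?u"
      have wc: "w \<in> carrier (stalk \<XX> ?x)" unfolding w_def by (intro X.m_closed nc X.Units_inv_closed unit)
      have wu: "w \<otimes>\<^bsub>stalk \<XX> ?x\<^esub> ?u = ?n"
        unfolding w_def using X.m_assoc[OF nc X.Units_inv_closed[OF unit] uc] X.Units_l_inv[OF unit] nc by simp
      have \<rho>w: "?\<rho> (?sm w) \<in> carrier ?L" using ring_hom_closed[OF sm_hom wc] by simp
      have "?\<rho> (?sm w) \<otimes>\<^bsub>?L\<^esub> ev y (h (s \<otimes>\<^bsub>R\<^esub> a')) = ev y (h (a \<otimes>\<^bsub>R\<^esub> s'))"
        using ring_hom_mult[OF sm_hom wc uc] wu stalk_map_h[OF y sa'(2)] stalk_map_h[OF y nR] by (simp add: ev_def)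
      also have "\<dots> = ev y (h a) \<otimes>\<^bsub>?L\<^esub> p'" using as as' by (simp add: p'_def)
      also have "\<dots> = (p \<otimes>\<^bsub>?L\<^esub> (ev y t \<otimes>\<^bsub>?L\<^esub> ?\<rho> z)) \<otimes>\<^bsub>?L\<^esub> p'" unfolding eb[symmetric] tz p_def ..
      also have "\<dots> = ?\<rho> z \<otimes>\<^bsub>?L\<^esub> (p \<otimes>\<^bsub>?L\<^esub> (p' \<otimes>\<^bsub>?L\<^esub> ev y t))"
        using pc tc by (simp add: L.m_ac)
      also have "\<dots> = ?\<rho> z \<otimes>\<^bsub>?L\<^esub> ev y (h (s \<otimes>\<^bsub>R\<^esub> a'))" unfolding p'_def et p_def using as as' by simp
      finally have "?\<rho> (?sm w) = ?\<rho> z"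
        using L.m_rcancel[OF _ _ \<rho>w tc(4), of "ev y (h (s \<otimes>\<^bsub>R\<^esub> a'))"] nz[OF sa'(2)] sa' by simp
      then show "\<exists>w\<in>carrier (stalk \<XX> ?x). ?\<rho> z = ?\<rho> (?sm w)" using wc by metis
    qed
  qed
  finally show ?thesis .
qed

text \<open>The value of \<open>b\<close> is a root of a polynomial over the residue field of the base; a common denominator of its
  coefficients turns it into a polynomial over \<open>R\<close>.\<close>

lemma unramified_residually_algebraic:
  assumes unr: "unramified_at Y \<XX> f y" and y: "y \<in> V"
  shows "residually_algebraic R S h (vanishing_ideal Y V y)"
  unfolding residually_algebraic_def
proof
  fix b assume b: "b \<in> carrier S"
  let ?x = "pt_map f y" and ?L = "residue_field_at Y y" and ?sm = "stalk_map Y f y"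
  let ?K = "residue_field_map Y f y ` carrier (residue_field_at \<XX> ?x)"
  let ?v = "vanishing_ideal \<XX> W ?x"
  have sep: "finite_separable_extension ?L ?K" using unr by (simp add: unramified_at_def)
  interpret L: field ?L by (rule residue_field_is_field[OF y])
  interpret e: ring_hom_cring S ?L "ev y"
    by (rule ring_hom_cringI[OF S_cring L.cring_axioms ev_hom[OF y]])
  note vD = prime_idealD[OF cod.vanishing_ideal_prime[OF W_open maps_W[OF y]]]
  have \<beta>: "ev y b \<in> carrier ?L" using b by simp
  have sub: "subfield ?K ?L" and alg: "ring.algebraic ?L ?K (ev y b)"
    using sep \<beta> unfolding finite_separable_extension_def by blast+
  obtain ps where ps: "ps \<in> carrier (?K[X]\<^bsub>?L\<^esub>)" "ps \<noteq> []" and root: "ring.eval ?L ps (ev y b) = \<zero>\<^bsub>?L\<^esub>"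
    using L.algebraicE[OF subfieldE(1)[OF sub] \<beta>] alg unfolding over_def by blast
  have pK: "set ps \<subseteq> ?K" and lead: "hd ps \<noteq> \<zero>\<^bsub>?L\<^esub>"
    using ps unfolding univ_poly_carrier[symmetric] polynomial_def by auto
  have K_frac: "\<exists>a s. a \<in> carrier R \<and> s \<in> carrier R \<and> s \<notin> ?v \<and> ev y (h s) \<otimes>\<^bsub>?L\<^esub> k = ev y (h a)"
    if k: "k \<in> ?K" for k
  proof -
    obtain A where A: "A \<in> carrier (residue_field (stalk \<XX> ?x))" "k = residue_map (stalk Y y) ?sm A"
      using k unfolding residue_field_map_def residue_field_at_def by blast
    obtain z where z: "z \<in> carrier (stalk \<XX> ?x)" "A = residue (stalk \<XX> ?x) z"
      using A(1) unfolding residue_surj by blast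
    have "k = residue (stalk Y y) (?sm z)"
      unfolding A(2) z(2)
      by (rule residue_map_residue[OF stalks_local(2)[OF y] stalks_local(1)[OF y] stalk_local_hom[OF V_points[OF y]] z(1)])
    then show ?thesis using base_residue_fraction[OF y z(1)] by metis
  qed
  \<comment> \<open>a common denominator of the coefficients\<close>
  have "\<exists>s as. s \<in> carrier R \<and> s \<notin> ?v \<and> set as \<subseteq> carrier R \<and>
      map (\<lambda>k. ev y (h s) \<otimes>\<^bsub>?L\<^esub> k) qs = map (\<lambda>a. ev y (h a)) as" if "set qs \<subseteq> ?K" for qs
    using that
  proof (induction qs)
    case Nil
    then show ?case using vD(5) by (intro exI[of _ "\<one>\<^bsub>R\<^esub>"] exI[of _ "[]"]) simp
  next
    case (Cons k qs)
    then obtain s as where s: "s \<in> carrier R" "s \<notin> ?v" "set as \<subseteq> carrier R"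
      and eq: "map (\<lambda>k. ev y (h s) \<otimes>\<^bsub>?L\<^esub> k) qs = map (\<lambda>a. ev y (h a)) as" by auto
    obtain a' s' where s': "a' \<in> carrier R" "s' \<in> carrier R" "s' \<notin> ?v"
      and eq': "ev y (h s') \<otimes>\<^bsub>?L\<^esub> k = ev y (h a')"
      using K_frac[of k] Cons.prems by auto
    have KL: "k \<in> carrier ?L" "\<And>q. q \<in> set qs \<Longrightarrow> q \<in> carrier ?L"
      using Cons.prems subfieldE(3)[OF sub] by auto
    have "map (\<lambda>q. ev y (h (s' \<otimes>\<^bsub>R\<^esub> s)) \<otimes>\<^bsub>?L\<^esub> q) qs
        = map (\<lambda>z. ev y (h s') \<otimes>\<^bsub>?L\<^esub> z) (map (\<lambda>k. ev y (h s) \<otimes>\<^bsub>?L\<^esub> k) qs)"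
      using KL s s' by (simp add: L.m_assoc)
    also have "\<dots> = map (\<lambda>a. ev y (h a)) (map (\<lambda>a. s' \<otimes>\<^bsub>R\<^esub> a) as)"
      unfolding eq using s s' by (auto simp: subset_iff)
    finally have tail: "map (\<lambda>q. ev y (h (s' \<otimes>\<^bsub>R\<^esub> s)) \<otimes>\<^bsub>?L\<^esub> q) qs
        = map (\<lambda>a. ev y (h a)) (map (\<lambda>a. s' \<otimes>\<^bsub>R\<^esub> a) as)" .
    have "ev y (h (s' \<otimes>\<^bsub>R\<^esub> s)) \<otimes>\<^bsub>?L\<^esub> k = ev y (h s) \<otimes>\<^bsub>?L\<^esub> (ev y (h s') \<otimes>\<^bsub>?L\<^esub> k)"
      using KL s s' by (simp add: L.m_ac)
    also have "\<dots> = ev y (h (s \<otimes>\<^bsub>R\<^esub> a'))" unfolding eq' using s s' by simp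
    finally have head: "ev y (h (s' \<otimes>\<^bsub>R\<^esub> s)) \<otimes>\<^bsub>?L\<^esub> k = ev y (h (s \<otimes>\<^bsub>R\<^esub> a'))" .
    have "s' \<otimes>\<^bsub>R\<^esub> s \<in> carrier R" "s' \<otimes>\<^bsub>R\<^esub> s \<notin> ?v" using s s' vD(10)[OF s'(2) s(1)] by auto
    moreover have "set (s \<otimes>\<^bsub>R\<^esub> a' # map (\<lambda>a. s' \<otimes>\<^bsub>R\<^esub> a) as) \<subseteq> carrier R" using s s' by (auto simp: subset_iff)
    ultimately show ?case
      using tail head
      by (intro exI[of _ "s' \<otimes>\<^bsub>R\<^esub> s"] exI[of _ "s \<otimes>\<^bsub>R\<^esub> a' # map (\<lambda>a. s' \<otimes>\<^bsub>R\<^esub> a) as"]) simp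
  qed
  from this[OF pK] obtain s as where s: "s \<in> carrier R" "s \<notin> ?v" "set as \<subseteq> carrier R"
    and coeffs: "map (\<lambda>k. ev y (h s) \<otimes>\<^bsub>?L\<^esub> k) ps = map (\<lambda>a. ev y (h a)) as" by blast
  have hs: "ev y (h s) \<in> carrier ?L" "ev y (h s) \<noteq> \<zero>\<^bsub>?L\<^esub>"
    using s ev_eq_zero_iff[OF y h.hom_closed[OF s(1)]] h_vanishing_iff[OF y s(1)] by auto
  have asS: "h ` set (rev as) \<subseteq> carrier S" using s(3) by auto
  have "ev y (horner S h b (rev as)) = horner ?L (ev y \<circ> h) (ev y b) (rev as)"
    by (rule horner_hom[OF S_cring L.cring_axioms ev_hom[OF y] asS b])
  also have "\<dots> = ring.eval ?L (map (ev y \<circ> h) as) (ev y b)"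
    by (rule horner_rev_eq_eval[OF L.cring_axioms \<beta>]) (use s(3) in auto)
  also have "map (ev y \<circ> h) as = map (\<lambda>k. ev y (h s) \<otimes>\<^bsub>?L\<^esub> k) ps" unfolding coeffs by simp
  also have "ring.eval ?L \<dots> (ev y b) = ev y (h s) \<otimes>\<^bsub>?L\<^esub> ring.eval ?L ps (ev y b)"
    by (rule ring_eval_scale[OF L.cring_axioms hs(1) \<beta>, symmetric]) (use pK subfieldE(3)[OF sub] in blast)
  also have "\<dots> = \<zero>\<^bsub>?L\<^esub>" unfolding root using hs by simp
  finally have "horner S h b (rev as) \<in> vanishing_ideal Y V y"
    using ev_eq_zero_iff[OF y horner_closed[OF S_cring asS b]] by simp
  moreover have "\<exists>c\<in>set (rev as). h c \<notin> vanishing_ideal Y V y"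
  proof -
    obtain k qs where k: "ps = k # qs" using ps(2) by (cases ps) auto
    then obtain a as' where a: "as = a # as'" "ev y (h s) \<otimes>\<^bsub>?L\<^esub> k = ev y (h a)"
      using coeffs by (cases as) auto
    have "k \<in> carrier ?L" using k pK subfieldE(3)[OF sub] by auto
    then have "ev y (h a) \<noteq> \<zero>\<^bsub>?L\<^esub>" using a(2) hs lead k L.integral by (metis list.sel(1))
    moreover have "a \<in> carrier R" using a(1) s(3) by simp
    ultimately have "h a \<notin> vanishing_ideal Y V y" using ev_eq_zero_iff[OF y h.hom_closed] by simp
    then show ?thesis using a(1) by simp
  qed
  ultimately show "\<exists>cs. set cs \<subseteq> carrier R \<and> horner S h b cs \<in> vanishing_ideal Y V y \<and>
      (\<exists>c\<in>set cs. h c \<notin> vanishing_ideal Y V y)"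
    using s(3) by (intro exI[of _ "rev as"]) simp
qed

text \<open>Whether a point splits can be tested on finitely many generators \<open>e\<close> of \<open>S\<close> over \<open>R\<close>. At \<open>y\<close> each of them takes the
  value of some \<open>a e / s e\<close>; the conditions that \<open>s e\<close> is not zero and that \<open>s e * e\<close> equals \<open>a e\<close> are
  constructible, and a point where they hold splits.\<close>

lemma spread_out_splitting:
  assumes fp: "finitely_presented R S h" and y: "y \<in> V"
    and alg: "residually_algebraic R S h (vanishing_ideal Y V y)" and sp: "splits_at y"
  shows "constructible_nbhd \<XX> (pt_map f y) {x. \<exists>y'\<in>V. pt_map f y' = x \<and> splits_at y'}"
proof -
  let ?v = "vanishing_ideal Y V y"
  interpret R: plain_cring R by (rule plain_cring.intro[OF R_cring])
  obtain E where E: "finite E" "E \<subseteq> carrier S"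
    and gen: "generates_algebra R S h E"
    by (rule R.finitely_presented_generators[OF S_cring fp]) (rule that)
  have "\<forall>e\<in>E. \<exists>a s. a \<in> carrier R \<and> s \<in> carrier R \<and> s \<notin> vanishing_ideal \<XX> W (pt_map f y) \<and>
      ev y (h s) \<otimes>\<^bsub>residue_field_at Y y\<^esub> ev y e = ev y (h a)"
    using sp E(2) unfolding splits_at_def by blast
  then obtain a s where as: "\<And>e. e \<in> E \<Longrightarrow> a e \<in> carrier R \<and> s e \<in> carrier R \<and>
      s e \<notin> vanishing_ideal \<XX> W (pt_map f y) \<and> ev y (h (s e)) \<otimes>\<^bsub>residue_field_at Y y\<^esub> ev y e = ev y (h (a e))"
    by metis
  have ev_iff: "ev y' (h (s e)) \<otimes>\<^bsub>residue_field_at Y y'\<^esub> ev y' e = ev y' (h (a e)) \<longleftrightarrow>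
      h (s e) \<otimes>\<^bsub>S\<^esub> e \<oplus>\<^bsub>S\<^esub> \<ominus>\<^bsub>S\<^esub> h (a e) \<in> vanishing_ideal Y V y'" if "y' \<in> V" "e \<in> E" for y' e
  proof -
    have c: "h (s e) \<in> carrier S" "e \<in> carrier S" "h (a e) \<in> carrier S" using as[OF that(2)] E(2) that(2) by auto
    then show ?thesis
      using ev_eq_iff[OF that(1), of "h (s e) \<otimes>\<^bsub>S\<^esub> e" "h (a e)"] ring_hom_mult[OF ev_hom[OF that(1)] c(1,2)] by simp
  qed
  define G where "G = (\<lambda>e. h (s e) \<otimes>\<^bsub>S\<^esub> e \<oplus>\<^bsub>S\<^esub> \<ominus>\<^bsub>S\<^esub> h (a e)) ` E"
  have G: "finite G" "G \<subseteq> ?v" using E(1) as ev_iff[OF y] by (auto simp: G_def)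
  have "h (s e) \<in> carrier S - ?v" if "e \<in> E" for e
    using as[OF that] h_vanishing_iff[OF y] by simp
  then obtain c where c: "c \<in> carrier S - ?v"
    and c_av: "\<And>q e. \<lbrakk>primeideal q S; c \<notin> q; e \<in> E\<rbrakk> \<Longrightarrow> h (s e) \<notin> q"
    using prime_avoids_finitely_many[OF S_cring E(1) _ dom.vanishing_ideal_prime[OF V_open y], of "\<lambda>e. h (s e)"]
    by metis
  have "splits_at y'" if y': "y' \<in> V" "G \<subseteq> vanishing_ideal Y V y'" "c \<notin> vanishing_ideal Y V y'" for y'
    unfolding splits_at_def
  proof
    let ?L = "residue_field_at Y y'" and ?w = "vanishing_ideal \<XX> W (pt_map f y')"
    note wD = prime_idealD[OF cod.vanishing_ideal_prime[OF W_open maps_W[OF y'(1)]]]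
    interpret L: field ?L by (rule residue_field_is_field[OF y'(1)])
    interpret e: ring_hom_cring S ?L "ev y'"
      by (rule ring_hom_cringI[OF S_cring L.cring_axioms ev_hom[OF y'(1)]])
    let ?Z = "\<lambda>b. \<exists>a\<in>carrier R. \<exists>s\<in>carrier R. s \<notin> ?w \<and> ev y' (h s) \<otimes>\<^bsub>?L\<^esub> ev y' b = ev y' (h a)"
    fix b assume b: "b \<in> carrier S"
    have "carrier S \<subseteq> {b. ?Z b}"
    proof (rule gen[unfolded generates_algebra_def, rule_format], intro conjI ballI subsetI)
      have "?Z (h r)" if "r \<in> carrier R" for r
        using that wD(5) by (intro bexI[of _ r] bexI[of _ "\<one>\<^bsub>R\<^esub>"]) auto
      then show "b \<in> {b. ?Z b}" if "b \<in> h ` carrier R" for b using that by blast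
      show "e \<in> {b. ?Z b}" if e: "e \<in> E" for e
      proof -
        have "h (s e) \<otimes>\<^bsub>S\<^esub> e \<oplus>\<^bsub>S\<^esub> \<ominus>\<^bsub>S\<^esub> h (a e) \<in> vanishing_ideal Y V y'" using y'(2) e by (auto simp: G_def)
        then have "ev y' (h (s e)) \<otimes>\<^bsub>?L\<^esub> ev y' e = ev y' (h (a e))" using ev_iff[OF y'(1) e] by simp
        moreover have "h (s e) \<notin> vanishing_ideal Y V y'"
          by (rule c_av[OF dom.vanishing_ideal_prime[OF V_open y'(1)] y'(3) e])
        then have "s e \<notin> ?w" using h_vanishing_iff[OF y'(1), of "s e"] as[OF e] by simp
        ultimately show ?thesis using as[OF e] by (intro CollectI bexI[of _ "a e"] bexI[of _ "s e"] conjI) simp_all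
      qed
      fix b c assume "b \<in> carrier S \<inter> {b. ?Z b}" "c \<in> carrier S \<inter> {b. ?Z b}"
      then have bc: "b \<in> carrier S" "c \<in> carrier S" and Zb: "?Z b" and Zc: "?Z c" by simp_all
      obtain r t where r: "r \<in> carrier R" "t \<in> carrier R" "t \<notin> ?w" and eb: "ev y' (h t) \<otimes>\<^bsub>?L\<^esub> ev y' b = ev y' (h r)"
        using Zb by blast
      obtain r' t' where r': "r' \<in> carrier R" "t' \<in> carrier R" "t' \<notin> ?w" and ec: "ev y' (h t') \<otimes>\<^bsub>?L\<^esub> ev y' c = ev y' (h r')"
        using Zc by blast
      have tt: "t \<otimes>\<^bsub>R\<^esub> t' \<in> carrier R" "t \<otimes>\<^bsub>R\<^esub> t' \<notin> ?w" using r r' wD(10)[OF r(2) r'(2)] by auto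
      have cl: "ev y' (h t) \<in> carrier ?L" "ev y' (h t') \<in> carrier ?L" "ev y' b \<in> carrier ?L" "ev y' c \<in> carrier ?L"
        using r r' bc by auto
      have "ev y' (h (t \<otimes>\<^bsub>R\<^esub> t')) \<otimes>\<^bsub>?L\<^esub> ev y' (b \<oplus>\<^bsub>S\<^esub> c)
          = ev y' (h t') \<otimes>\<^bsub>?L\<^esub> (ev y' (h t) \<otimes>\<^bsub>?L\<^esub> ev y' b) \<oplus>\<^bsub>?L\<^esub> ev y' (h t) \<otimes>\<^bsub>?L\<^esub> (ev y' (h t') \<otimes>\<^bsub>?L\<^esub> ev y' c)"
        using r r' bc cl by (simp add: L.r_distr L.m_ac)
      also have "\<dots> = ev y' (h (t' \<otimes>\<^bsub>R\<^esub> r \<oplus>\<^bsub>R\<^esub> t \<otimes>\<^bsub>R\<^esub> r'))"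
        unfolding eb ec using r r' by simp
      finally show "b \<oplus>\<^bsub>S\<^esub> c \<in> {b. ?Z b}"
        using tt r r' by (intro CollectI bexI[of _ "t' \<otimes>\<^bsub>R\<^esub> r \<oplus>\<^bsub>R\<^esub> t \<otimes>\<^bsub>R\<^esub> r'"] bexI[of _ "t \<otimes>\<^bsub>R\<^esub> t'"] conjI) simp_all
      have "ev y' (h (t \<otimes>\<^bsub>R\<^esub> t')) \<otimes>\<^bsub>?L\<^esub> ev y' (b \<otimes>\<^bsub>S\<^esub> c)
          = (ev y' (h t) \<otimes>\<^bsub>?L\<^esub> ev y' b) \<otimes>\<^bsub>?L\<^esub> (ev y' (h t') \<otimes>\<^bsub>?L\<^esub> ev y' c)"
        using r r' bc cl by (simp add: L.m_ac)
      also have "\<dots> = ev y' (h (r \<otimes>\<^bsub>R\<^esub> r'))"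
        unfolding eb ec using r r' by simp
      finally show "b \<otimes>\<^bsub>S\<^esub> c \<in> {b. ?Z b}"
        using tt r r' by (intro CollectI bexI[of _ "r \<otimes>\<^bsub>R\<^esub> r'"] bexI[of _ "t \<otimes>\<^bsub>R\<^esub> t'"] conjI) simp_all
    qed
    then show "?Z b" using b by blast
  qed
  then have "{x. \<exists>y'\<in>V. pt_map f y' = x \<and> G \<subseteq> vanishing_ideal Y V y' \<and> c \<notin> vanishing_ideal Y V y'}
      \<subseteq> {x. \<exists>y'\<in>V. pt_map f y' = x \<and> splits_at y'}" by auto
  then show ?thesis
    using spread_out_point[OF fp y alg G c] unfolding constructible_nbhd_def by (meson subsetD)
qed

end

section \<open>Finite subcoverings\<close>

text \<open>Elements of a residue field are represented by sections, on which the two morphisms agree.\<close>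

lemma residue_field_map_cong:
  assumes f: "lrs_morphism Y \<XX> f" and g: "lrs_morphism Y \<XX> g" and y: "y \<in> points Y"
    and pt: "\<And>z. z \<in> points Y \<Longrightarrow> pt_map f z = pt_map g z"
    and sec: "\<And>V s. \<lbrakk>openin (topo \<XX>) V; s \<in> carrier (sect \<XX> V)\<rbrakk> \<Longrightarrow> sec_map f V s = sec_map g V s"
    and A: "A \<in> carrier (residue_field_at \<XX> (pt_map f y))"
  shows "residue_field_map Y f y A = residue_field_map Y g y A"
proof -
  interpret f: lrs_morphism Y \<XX> f by (rule f)
  interpret g: lrs_morphism Y \<XX> g by (rule g)
  let ?x = "pt_map f y"
  have x: "?x \<in> points \<XX>" "pt_map g y = ?x" using f.pt_in_points[OF y] pt[OF y] by auto
  note loc = f.cod.stalk_local[OF x(1)] f.dom.stalk_local[OF y]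
  obtain z where z: "z \<in> carrier (stalk \<XX> ?x)" "A = residue (stalk \<XX> ?x) z"
    using A unfolding residue_field_at_def residue_surj by blast
  obtain V s where V: "openin (topo \<XX>) V" "?x \<in> V" "s \<in> carrier (sect \<XX> V)" "z = germ \<XX> ?x V s"
    by (rule f.cod.stalk_carrierE[OF z(1)])
  have "preim Y f V = preim Y g V" using pt by (auto simp: preim_def)
  then have "stalk_map Y f y z = stalk_map Y g y z"
    using f.stalk_map_germ[OF y V(1-3)] g.stalk_map_germ[OF y V(1), of s] V sec[OF V(1,3)] x(2) by simp
  then show ?thesis
    unfolding residue_field_map_def z(2)
    using residue_map_residue[OF loc f.stalk_local_hom[OF y] z(1)]
      residue_map_residue[OF _ loc(2) g.stalk_local_hom[OF y], of z] loc(1) z(1) x(2) by simp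
qed

lemma ring_iso_cong:
  assumes "\<And>a. a \<in> carrier A \<Longrightarrow> h a = k a" and A: "ring A"
  shows "h \<in> ring_iso A B \<longleftrightarrow> k \<in> ring_iso A B"
proof -
  interpret ring A by (rule A)
  have "h \<in> ring_hom A B \<longleftrightarrow> k \<in> ring_hom A B" unfolding ring_hom_def Pi_def using assms(1) by auto
  moreover have "bij_betw h (carrier A) (carrier B) \<longleftrightarrow> bij_betw k (carrier A) (carrier B)"
    by (rule bij_betw_cong[OF assms(1)])
  ultimately show ?thesis by (simp add: ring_iso_def)
qed

text \<open>Finite presentation provides affine open sets around \<open>y\<close> and its image, and an unramified point has
  an algebraic residue field extension.\<close>

lemma etale_spread_out:
  assumes et: "etale Y \<XX> f" and y: "y \<in> points Y"
  shows "constructible_nbhd \<XX> (pt_map f y) (pt_map f ` points Y)"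
    and "residue_field_map Y f y \<in> ring_iso (residue_field_at \<XX> (pt_map f y)) (residue_field_at Y y) \<Longrightarrow>
      constructible_nbhd \<XX> (pt_map f y) {x. \<exists>y'\<in>points Y. pt_map f y' = x \<and>
        residue_field_map Y f y' \<in> ring_iso (residue_field_at \<XX> x) (residue_field_at Y y')}"
proof -
  have mor: "lrs_morphism Y \<XX> f" using et by (simp add: etale_def scheme_morphism_def)
  have unr: "unramified_at Y \<XX> f y" and fpa: "finitely_presented_at Y \<XX> f y" using et y by (auto simp: etale_def)
  obtain V W where V: "affine_open Y V" "y \<in> V" and W: "affine_open \<XX> W" "pt_map f ` V \<subseteq> W"
    and fp: "finitely_presented (sect \<XX> W) (sect Y V) (\<lambda>s. restr Y (preim Y f W) V (sec_map f W s))"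
    using fpa unfolding finitely_presented_at_def by blast
  interpret affine_morphism Y \<XX> f V W
    by (intro affine_morphism.intro affine_morphism_axioms.intro mor V W)
  have "h = (\<lambda>s. restr Y (preim Y f W) V (sec_map f W s))" by (auto simp: h_def)
  then have fph: "finitely_presented R S h" using fp by simp
  note alg = unramified_residually_algebraic[OF unr V(2)]
  have mono: "constructible_nbhd \<XX> x E'" if "constructible_nbhd \<XX> x E" "E \<subseteq> E'" for x E E'
    using that unfolding constructible_nbhd_def by (meson subsetD)
  have one: "\<one>\<^bsub>S\<^esub> \<in> carrier S - vanishing_ideal Y V y"
    using prime_idealD(5)[OF dom.vanishing_ideal_prime[OF V_open V(2)]] by simp
  show "constructible_nbhd \<XX> (pt_map f y) (pt_map f ` points Y)"
    by (rule mono[OF spread_out_point[OF fph V(2) alg finite.emptyI empty_subsetI one]]) (use V_points in auto)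
  assume "residue_field_map Y f y \<in> ring_iso (residue_field_at \<XX> (pt_map f y)) (residue_field_at Y y)"
  then have "splits_at y" using residue_field_iso_iff_splits[OF V(2)] by simp
  from spread_out_splitting[OF fph V(2) alg this]
  show "constructible_nbhd \<XX> (pt_map f y) {x. \<exists>y'\<in>points Y. pt_map f y' = x \<and>
      residue_field_map Y f y' \<in> ring_iso (residue_field_at \<XX> x) (residue_field_at Y y')}"
  proof (rule mono, intro subsetI CollectI)
    fix x assume "x \<in> {x. \<exists>y'\<in>V. pt_map f y' = x \<and> splits_at y'}"
    then obtain y' where y': "y' \<in> V" "pt_map f y' = x" "splits_at y'" by blast
    then show "\<exists>y'\<in>points Y. pt_map f y' = x \<and>
      residue_field_map Y f y' \<in> ring_iso (residue_field_at \<XX> x) (residue_field_at Y y')"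
      using residue_field_iso_iff_splits[OF y'(1)] V_points[OF y'(1)] by (intro bexI[of _ y']) auto
  qed
qed

theorem proposition3p1:
  fixes \<XX> :: "('x, 'r) rspace" and T :: "'x set"
    and Z :: "('z, 't) rspace" and j :: "('z, 't, 'x, 'r) rmap"
    and I :: "'i set" and U :: "'i \<Rightarrow> ('u, 's) rspace" and S :: "'i \<Rightarrow> 'u set"
    and f p :: "'i \<Rightarrow> ('u, 's, 'x, 'r) rmap"
  assumes "scheme \<XX>" and "quasi_compact \<XX>"
    and "closed_immersion Z \<XX> j" and "T = pt_map j ` points Z"
    and "met_covering \<XX> T \<XX> T id_map I U S f p"
  shows "\<exists>J\<subseteq>I. finite J \<and> met_covering \<XX> T \<XX> T id_map J U S f p"
proof -
  interpret X: locally_ringed_space \<XX> using assms(1) by (simp add: scheme_def)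
  have T_closed: "closedin (topo \<XX>) T" using assms(3,4) by (simp add: closed_immersion_def)
  note cov = assms(5)[unfolded met_covering_def]
  have mor: "met_morphism \<XX> T (U i) (S i) (f i) \<XX> T id_map (p i)" if "i \<in> I" for i using cov that by blast
  let ?split = "\<lambda>i u x. residue_field_map (U i) (p i) u \<in> ring_iso (residue_field_at \<XX> x) (residue_field_at (U i) u)"
  have et: "etale (U i) \<XX> (f i)" and Si: "S i = preim (U i) (f i) T" and pm: "lrs_morphism (U i) \<XX> (p i)"
    and pt: "\<And>u. u \<in> points (U i) \<Longrightarrow> pt_map (p i) u = pt_map (f i) u"
    and sec: "\<And>V s. \<lbrakk>openin (topo \<XX>) V; s \<in> carrier (sect \<XX> V)\<rbrakk> \<Longrightarrow> sec_map (p i) V s = sec_map (f i) V s"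
    if i: "i \<in> I" for i
  proof -
    note m = mor[OF i, unfolded met_morphism_def met_object_def marked_morphism_def]
    show "etale (U i) \<XX> (f i)" "S i = preim (U i) (f i) T" "lrs_morphism (U i) \<XX> (p i)"
      using m by (simp_all add: scheme_morphism_def)
    have same: "same_map (U i) \<XX> (comp_map \<XX> id_map (p i)) (f i)" using m by simp
    show "pt_map (p i) u = pt_map (f i) u" if "u \<in> points (U i)" for u
      using same that by (simp add: same_map_def comp_map_def id_map_def)
    show "sec_map (p i) V s = sec_map (f i) V s" if "openin (topo \<XX>) V" "s \<in> carrier (sect \<XX> V)" for V s
    proof -
      have "sec_map (p i) (preim \<XX> id_map V) s = sec_map (f i) V s"
        using same that by (simp add: same_map_def comp_map_def id_map_def)
      moreover have "preim \<XX> id_map V = V" using openin_subset[OF that(1)] by (auto simp: preim_def id_map_def)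
      ultimately show ?thesis by simp
    qed
  qed
  have split_iff: "?split i u (pt_map (f i) u) \<longleftrightarrow> residue_field_map (U i) (f i) u \<in>
      ring_iso (residue_field_at \<XX> (pt_map (f i) u)) (residue_field_at (U i) u)"
    if i: "i \<in> I" and u: "u \<in> points (U i)" for i u
  proof (rule ring_iso_cong)
    have fm: "lrs_morphism (U i) \<XX> (f i)" using et[OF i] by (simp add: etale_def scheme_morphism_def)
    have x: "pt_map (f i) u \<in> points \<XX>" by (rule lrs_morphism.pt_in_points[OF fm u])
    show "ring (residue_field_at \<XX> (pt_map (f i) u))"
      unfolding residue_field_at_def
      using local_ringD(5)[OF X.stalk_local[OF x]] by (simp add: field_def domain_def cring_def)
    show "residue_field_map (U i) (p i) u A = residue_field_map (U i) (f i) u A"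
      if "A \<in> carrier (residue_field_at \<XX> (pt_map (f i) u))" for A
      by (rule residue_field_map_cong[OF pm[OF i] fm u]) (use pt[OF i] sec[OF i] u that in auto)
  qed
  define good where "good i = {x. (\<exists>u\<in>points (U i). pt_map (p i) u = x) \<and>
      (x \<in> T \<longrightarrow> (\<exists>u\<in>S i. pt_map (p i) u = x \<and> ?split i u x))}" for i
  have "\<exists>i\<in>I. constructible_nbhd \<XX> x (good i)" if x: "x \<in> points \<XX>" for x
  proof (cases "x \<in> T")
    case True
    then obtain i u where i: "i \<in> I" and u: "u \<in> S i" "pt_map (p i) u = x" "?split i u x"
      using cov by blast
    have uU: "u \<in> points (U i)" using u(1) Si[OF i] by (simp add: preim_def)
    have fx: "pt_map (f i) u = x" using pt[OF i uU] u(2) by simp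
    have "constructible_nbhd \<XX> x {x. \<exists>u\<in>points (U i). pt_map (f i) u = x \<and>
        residue_field_map (U i) (f i) u \<in> ring_iso (residue_field_at \<XX> x) (residue_field_at (U i) u)}"
      using etale_spread_out(2)[OF et[OF i] uU] split_iff[OF i uU] u(3) unfolding fx by simp
    moreover have "{x. \<exists>u\<in>points (U i). pt_map (f i) u = x \<and>
        residue_field_map (U i) (f i) u \<in> ring_iso (residue_field_at \<XX> x) (residue_field_at (U i) u)} \<subseteq> good i"
    proof
      fix z assume "z \<in> {x. \<exists>u\<in>points (U i). pt_map (f i) u = x \<and>
        residue_field_map (U i) (f i) u \<in> ring_iso (residue_field_at \<XX> x) (residue_field_at (U i) u)}"
      then obtain v where v: "v \<in> points (U i)" "pt_map (f i) v = z"
        "residue_field_map (U i) (f i) v \<in> ring_iso (residue_field_at \<XX> z) (residue_field_at (U i) v)" by blast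
      have "?split i v z" using split_iff[OF i v(1)] v(2,3) by simp
      moreover have "v \<in> S i" if "z \<in> T" using that v(1,2) Si[OF i] by (simp add: preim_def)
      ultimately show "z \<in> good i" using v(1,2) pt[OF i v(1)] unfolding good_def by auto
    qed
    ultimately show ?thesis using i unfolding constructible_nbhd_def by (meson subsetD)
  next
    case False
    then obtain i u where i: "i \<in> I" and u: "u \<in> points (U i)" "pt_map (p i) u = x" using cov x by blast
    have fx: "pt_map (f i) u = x" using pt[OF i u(1)] u(2) by simp
    \<comment> \<open>Points of \<open>T\<close> would have to split, so they are removed from the neighbourhood.\<close>
    have "openin (topo \<XX>) (points \<XX> - T)" "x \<in> points \<XX> - T" using T_closed x False by (auto simp: closedin_def)
    then have "constructible_nbhd \<XX> x (pt_map (f i) ` points (U i) \<inter> (points \<XX> - T))"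
      using X.constructible_nbhd_Int_open etale_spread_out(1)[OF et[OF i] u(1)] unfolding fx by blast
    moreover have "pt_map (f i) ` points (U i) \<inter> (points \<XX> - T) \<subseteq> good i"
      using pt[OF i] unfolding good_def by auto
    ultimately show ?thesis using i unfolding constructible_nbhd_def by (meson subsetD)
  qed
  then obtain idx where idx: "\<And>x. x \<in> points \<XX> \<Longrightarrow> idx x \<in> I \<and> constructible_nbhd \<XX> x (good (idx x))"
    by metis
  obtain B where B: "finite B" "B \<subseteq> points \<XX>" "points \<XX> \<subseteq> (\<Union>x\<in>B. good (idx x))"
    by (rule scheme_constructibly_compact[OF assms(1,2), of "\<lambda>x. good (idx x)"]) (use idx in auto)
  define J where "J = idx ` B"
  have J: "J \<subseteq> I" "finite J" using idx B by (auto simp: J_def)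
  have cover: "\<exists>i\<in>J. x \<in> good i" if "x \<in> points \<XX>" for x using B(3) that by (auto simp: J_def)
  have T_sub: "T \<subseteq> points \<XX>" using closedin_subset[OF T_closed] .
  have "met_covering \<XX> T \<XX> T id_map J U S f p"
    unfolding met_covering_def
  proof (intro conjI ballI)
    show "met_object \<XX> T \<XX> T id_map" using cov by blast
    show "met_morphism \<XX> T (U i) (S i) (f i) \<XX> T id_map (p i)" if "i \<in> J" for i using mor J(1) that by blast
    show "\<exists>i\<in>J. \<exists>u\<in>points (U i). pt_map (p i) u = x" if "x \<in> points \<XX>" for x
      using cover[OF that] by (auto simp: good_def)
    show "\<exists>i\<in>J. \<exists>u\<in>S i. pt_map (p i) u = x \<and> ?split i u x" if "x \<in> T" for x
      using cover[of x] that T_sub by (auto simp: good_def)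
  qed
  with J show ?thesis by blast
qed

end
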